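(* (i) For all constants $c,C>0$ there exist constants $c_1>c_3>0$, $c_2>0$ and $A>0$, depending only on $c,C$, such that for every $S\ge1$, $n\ge2$ and every $Q=(q_1,\dots,q_S)\in\mathcal{M}_S$ with $$c\ln S\le \ln n\le C\ln\left(\sum_{i=1}^S\sqrt{q_i}\wedge q_i\sqrt{n\ln n}\right),$$ the estimator $\hat L^{(1)}$ (defined in the context with these $c_1,c_2,c_3$) satisfies $$\sup_{P\in\mathcal{M}_S}\mathbb{E}_P\big|\hat L^{(1)}-\|P-Q\|_1\big|^2\le A\left(\sum_{i=1}^S q_i\wedge\sqrt{\frac{q_i}{n\ln n}}\right)^2.$$ (ii) For every constant $C>0$ there exist constants $c_1>c_3>0$, $c_2>0$, $A>0$ depending only on $C$ such that, whenever $n\ge 2$ and $\ln n\le C\ln S$, $$\sup_{P,Q\in\mathcal{M}_S}\mathbb{E}_P\big|\hat L^{(1)}-\|P-Q\|_1\big|^2\le A\,\frac{S}{n\ln n}.$$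
   Context: $\mathcal{M}_S$ is the set of probability vectors on $\{1,\dots,S\}$; $\|P-Q\|_1=\sum_i|p_i-q_i|$; $a\wedge b=\min\{a,b\}$, $a\vee b=\max\{a,b\}$; logarithms are natural. For a real $x$ and a set $\mathcal{Y}\subset\mathbb{R}$, $x>\mathcal{Y}$ means $x>y$ for all $y\in\mathcal{Y}$, and $x<\mathcal{Y}$ is analogous. Observations (Poisson sampling, after splitting the sample into two halves and renaming $n/2$ as $n$): mutually independent $\hat p_{i,j}$, $1\le i\le S$, $j=1,2$, with $n\hat p_{i,j}\sim\mathrm{Poi}(np_i)$, where $P=(p_1,\dots,p_S)$ is unknown. $Q$ is known. Construction of $\hat L^{(1)}$. Let $c_1>c_3>0$, $c_2>0$, $K=c_2\ln n$. For $q\in[0,1]$ let $U(q;c_1)=[0,\frac{2c_1\ln n}{n}]$ if $q\le\frac{c_1\ln n}{n}$ and $U(q;c_1)=[q-\sqrt{\frac{c_1q\ln n}{n}},\,q+\sqrt{\frac{c_1q\ln n}{n}}]$ if $\frac{c_1\ln n}{n}<q\le1$; $U_1(q)=[0,\frac{(c_1+c_3)\ln n}{n}]$ if $q\le\frac{c_1\ln n}{n}$ and $U_1(q)=[q-\sqrt{\frac{c_3q\ln n}{n}},\,q+\sqrt{\frac{c_3q\ln n}{n}}]$ if $\frac{c_1\ln n}{n}<q\le1$. Let $P_K(x;q)$ be the polynomial in $x$ of degree at most $K$ minimizing $\max_{z\in U(q;c_1)}\big||z-q|-P(z)\big|$ over polynomials $P$ of degree at most $K$. Let $\tilde P_K(\hat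 p;q)$ be the unbiased estimator of $P_K(p;q)$ from $n\hat p\sim\mathrm{Poi}(np)$, i.e. obtained by replacing each monomial $x^j$ of $P_K(x;q)$ by $\prod_{k=0}^{j-1}(\hat p-\frac kn)$. Define $$\tilde L_1=\sum_{i=1}^S\Big[(\hat p_{i,2}-q_i)\mathbf 1(\hat p_{i,1}>U_1(q_i))+(q_i-\hat p_{i,2})\mathbf 1(\hat p_{i,1}<U_1(q_i))+\tilde P_K(\hat p_{i,2};q_i)\mathbf 1(\hat p_{i,1}\in U_1(q_i))\Big],$$ $$\hat L^{(1)}=0\vee(\tilde L_1\wedge2).$$ *)

theory Defs
  imports "HOL-Probability.Probability" "HOL-Computational_Algebra.Polynomial"
begin

definition prob_vectors :: "nat \<Rightarrow> (nat \<Rightarrow> real) set" where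
  "prob_vectors S = {p. (\<forall>i\<in>{1..S}. 0 \<le> p i) \<and> (\<Sum>i=1..S. p i) = 1}"

definition L1_dist :: "nat \<Rightarrow> (nat \<Rightarrow> real) \<Rightarrow> (nat \<Rightarrow> real) \<Rightarrow> real" where
  "L1_dist S p q = (\<Sum>i=1..S. \<bar>p i - q i\<bar>)"

text \<open>
  The library's \<open>poisson_pmf\<close> is only specified for positive rates, whereas cells of
  probability zero have rate zero.
\<close>

definition poisson0_pmf :: "real \<Rightarrow> nat pmf" where
  "poisson0_pmf r = (if r = 0 then return_pmf 0 else poisson_pmf r)"

text \<open>
  The joint law of the independent counts \<open>n * phat i j\<close>, indexed by the symbol
  \<open>i\<close> and the half-sample \<open>j \<in> {1, 2}\<close>. The parameter \<open>n\<close> is half of an integer sample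
  size, hence real.
\<close>

definition counts_pmf :: "real \<Rightarrow> nat \<Rightarrow> (nat \<Rightarrow> real) \<Rightarrow> (nat \<times> nat \<Rightarrow> nat) pmf" where
  "counts_pmf n S p = Pi_pmf ({1..S} \<times> {1, 2}) 0 (\<lambda>(i, j). poisson0_pmf (n * p i))"

definition phat :: "real \<Rightarrow> (nat \<times> nat \<Rightarrow> nat) \<Rightarrow> nat \<Rightarrow> nat \<Rightarrow> real" where
  "phat n N i j = real (N (i, j)) / n"

definition U_int :: "real \<Rightarrow> real \<Rightarrow> real \<Rightarrow> real set" where
  "U_int n c1 q =
    (if q \<le> c1 * ln n / n then {0..2 * c1 * ln n / n}
     else {q - sqrt (c1 * q * ln n / n)..q + sqrt (c1 * q * ln n / n)})"

definition U1_int :: "real \<Rightarrow> real \<Rightarrow> real \<Rightarrow> real \<Rightarrow> real set" where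
  "U1_int n c1 c3 q =
    (if q \<le> c1 * ln n / n then {0..(c1 + c3) * ln n / n}
     else {q - sqrt (c3 * q * ln n / n)..q + sqrt (c3 * q * ln n / n)})"

definition above_set :: "real \<Rightarrow> real set \<Rightarrow> bool" where
  "above_set x Y \<longleftrightarrow> (\<forall>y\<in>Y. x > y)"

definition below_set :: "real \<Rightarrow> real set \<Rightarrow> bool" where
  "below_set x Y \<longleftrightarrow> (\<forall>y\<in>Y. x < y)"

text \<open>
  For \<open>n > 1\<close>, \<open>c1 > 0\<close> and \<open>K \<ge> 0\<close>, \<open>U_int n c1 q\<close> is a nondegenerate compact
  interval, so the supremum is a maximum and, by Chebyshev's theorem, the minimizer
  exists and is unique. The degree bound \<open>K\<close> need not be an integer.
\<close>

definition best_poly :: "real \<Rightarrow> real \<Rightarrow> real \<Rightarrow> real \<Rightarrow> real poly" where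
  "best_poly n c1 K q =
    (ARG_MIN (\<lambda>P. SUP z\<in>U_int n c1 q. \<bar>\<bar>z - q\<bar> - poly P z\<bar>) P. real (degree P) \<le> K)"

definition unbiased_poly :: "real \<Rightarrow> real poly \<Rightarrow> real \<Rightarrow> real" where
  "unbiased_poly n P x = (\<Sum>j\<le>degree P. coeff P j * (\<Prod>k<j. x - real k / n))"

definition L1_tilde ::
  "real \<Rightarrow> real \<Rightarrow> real \<Rightarrow> real \<Rightarrow> nat \<Rightarrow> (nat \<Rightarrow> real) \<Rightarrow> (nat \<times> nat \<Rightarrow> nat) \<Rightarrow> real" where
  "L1_tilde c1 c2 c3 n S q N =
    (\<Sum>i=1..S.
      (phat n N i 2 - q i) * of_bool (above_set (phat n N i 1) (U1_int n c1 c3 (q i)))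
      + (q i - phat n N i 2) * of_bool (below_set (phat n N i 1) (U1_int n c1 c3 (q i)))
      + unbiased_poly n (best_poly n c1 (c2 * ln n) (q i)) (phat n N i 2)
          * of_bool (phat n N i 1 \<in> U1_int n c1 c3 (q i)))"

definition L1_hat ::
  "real \<Rightarrow> real \<Rightarrow> real \<Rightarrow> real \<Rightarrow> nat \<Rightarrow> (nat \<Rightarrow> real) \<Rightarrow> (nat \<times> nat \<Rightarrow> nat) \<Rightarrow> real" where
  "L1_hat c1 c2 c3 n S q N = max 0 (min (L1_tilde c1 c2 c3 n S q N) 2)"

definition L1_risk ::
  "real \<Rightarrow> real \<Rightarrow> real \<Rightarrow> real \<Rightarrow> nat \<Rightarrow> (nat \<Rightarrow> real) \<Rightarrow> (nat \<Rightarrow> real) \<Rightarrow> ennreal" where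
  "L1_risk c1 c2 c3 n S q p =
    (\<integral>\<^sup>+ N. ennreal (\<bar>L1_hat c1 c2 c3 n S q N - L1_dist S p q\<bar>\<^sup>2) \<partial>measure_pmf (counts_pmf n S p))"

end

theory Submission
  imports Defs
begin

text \<open>
  The squared error is split into three parts: a bad event, a variance and a squared bias.
  Write \<open>\<Delta> = ln n / n\<close>.

  Bad event. Replace the summand of a symbol whose probability \<open>p i\<close> lies outside the wide
  interval \<open>U\<close> around \<open>q i\<close> by the signed plug-in term with the sign that \<open>p i\<close> dictates.
  Since \<open>U\<close> exceeds the test interval \<open>U1\<close> by a multiple of the Poisson deviation, the first half-sample
  sees the wrong side only with probability \<open>n powr (- \<beta>)\<close>, where \<open>\<beta>\<close> is as large as
  one wishes. The clipped estimator errs by at most \<open>2\<close>, so the exchange costs at most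
  \<open>4 * S * n powr (- \<beta>)\<close>. It removes the unbounded polynomial estimators evaluated
  outside the range where they are controlled (\<open>idealized_cell_moments\<close>, \<open>L1_risk_bound\<close>).

  Bias. For \<open>p \<in> U\<close> the second half-sample estimates the approximating polynomial without bias, so
  the bias is the best uniform approximation error of \<open>\<bar>x - q\<bar>\<close> on \<open>U\<close>, up to a tail
  probability. This error is at most \<open>2 * q\<close>, by comparison with \<open>x - q\<close>, and at most a
  constant times \<open>sqrt (q / (n ln n))\<close>, by Jackson's theorem with degree of order \<open>ln n\<close>
  (\<open>best_poly_error\<close>). When \<open>q\<close> lies near the left end \<open>0\<close> of \<open>U = {0..L}\<close>, the substitution
  \<open>x = L * s\<^sup>2\<close> turns the kink into a bump whose Lipschitz constant is of order
  \<open>sqrt (q * L)\<close>; this yields the gain over the error \<open>L / ln n\<close> of a generic kink.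

  Variance. The polynomial differs from \<open>x - q\<close> by at most \<open>4 * min q (sqrt (c1 * q * \<Delta>))\<close> on \<open>U\<close>.
  Its coefficients, expanded at \<open>p\<close>, grow only exponentially in the degree (Lagrange interpolation), and
  the unbiased estimators of \<open>(x - p) ^ j\<close> are Charlier polynomials with second moment \<open>fact j * (p / n) ^ j\<close>
  (\<open>expectation_charlier_square\<close>). With degree \<open>c2 * ln n\<close> the exponential becomes a factor
  \<open>n powr \<epsilon>\<close>, and the variances sum to at most a multiple of \<open>n powr \<epsilon> * \<Delta>\<close>, whatever the
  number of symbols.

  In \<open>L1_risk_rate\<close> these parts are collected with free \<open>\<beta>\<close> and \<open>\<epsilon>\<close>. Each claim then follows by a
  choice of these exponents for which its hypotheses on \<open>ln n\<close> let the squared bias dominate; for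
  bounded \<open>n\<close> the trivial bound \<open>4\<close> on the risk is enough.
\<close>

section \<open>Poisson counts: integration by parts, moments, tails\<close>

text \<open>
  The closed form also covers rate zero, because \<open>0 ^ 0 = 1\<close>; symbols of probability zero
  then need no separate treatment.
\<close>

lemma pmf_poisson0:
  assumes "r \<ge> 0"
  shows "pmf (poisson0_pmf r) k = r ^ k / fact k * exp (- r)"
  using assms by (cases "r = 0") (auto simp: poisson0_pmf_def power_0_left)

lemma integrable_nat_pmf_iff:
  fixes f :: "nat \<Rightarrow> real"
  shows "integrable (measure_pmf D) f \<longleftrightarrow> summable (\<lambda>k. norm (pmf D k * f k))"
  unfolding measure_pmf_eq_density
  by (subst integrable_density) (auto simp: integrable_count_space_nat_iff)

lemma expectation_nat_pmf:
  fixes f :: "nat \<Rightarrow> real"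
  assumes "integrable (measure_pmf D) f"
  shows "measure_pmf.expectation D f = (\<Sum>k. pmf D k * f k)"
proof -
  have "measure_pmf.expectation D f = (\<integral>k. pmf D k *\<^sub>R f k \<partial>count_space UNIV)"
    unfolding measure_pmf_eq_density by (subst integral_density) auto
  also have "\<dots> = (\<Sum>k. pmf D k * f k)"
    using assms by (subst integral_count_space_nat)
      (auto simp: integrable_nat_pmf_iff integrable_count_space_nat_iff)
  finally show ?thesis .
qed

text \<open>
  The Poisson weights satisfy \<open>(k + 1) * w (k + 1) = r * w k\<close>, so a factor \<open>k\<close> can be traded
  for a shift of the argument. This identity drives all moment computations below.
\<close>

lemma poisson_stein:
  fixes h :: "nat \<Rightarrow> real"
  assumes r: "r \<ge> 0" and int: "integrable (measure_pmf (poisson0_pmf r)) (\<lambda>k. h (Suc k))"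
  shows "integrable (measure_pmf (poisson0_pmf r)) (\<lambda>k. real k * h k)"
    and "measure_pmf.expectation (poisson0_pmf r) (\<lambda>k. real k * h k)
      = r * measure_pmf.expectation (poisson0_pmf r) (\<lambda>k. h (Suc k))"
proof -
  let ?w = "pmf (poisson0_pmf r)"
  have shift: "?w (Suc k) * (real (Suc k) * h (Suc k)) = r * (?w k * h (Suc k))" for k
    using r by (simp add: pmf_poisson0 field_simps del: of_nat_Suc)
  have "summable (\<lambda>k. r * norm (?w k * h (Suc k)))"
    using int unfolding integrable_nat_pmf_iff by (rule summable_mult)
  also have "(\<lambda>k. r * norm (?w k * h (Suc k))) = (\<lambda>k. norm (?w (Suc k) * (real (Suc k) * h (Suc k))))"
    using r by (intro ext) (simp only: shift, simp add: abs_mult)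
  finally have sm: "summable (\<lambda>k. norm (?w k * (real k * h k)))"
    by (subst summable_Suc_iff[symmetric])
  then show int': "integrable (measure_pmf (poisson0_pmf r)) (\<lambda>k. real k * h k)"
    unfolding integrable_nat_pmf_iff .
  have "measure_pmf.expectation (poisson0_pmf r) (\<lambda>k. real k * h k) = (\<Sum>k. ?w k * (real k * h k))"
    by (rule expectation_nat_pmf[OF int'])
  also have "\<dots> = (\<Sum>k. ?w (Suc k) * (real (Suc k) * h (Suc k)))"
    using suminf_split_head[OF summable_norm_cancel[OF sm]] by simp
  also have "\<dots> = r * (\<Sum>k. ?w k * h (Suc k))"
    unfolding shift
    by (rule suminf_mult[OF summable_norm_cancel[OF int[unfolded integrable_nat_pmf_iff]]])
  also have "\<dots> = r * measure_pmf.expectation (poisson0_pmf r) (\<lambda>k. h (Suc k))"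
    by (subst expectation_nat_pmf[OF int]) simp
  finally show "measure_pmf.expectation (poisson0_pmf r) (\<lambda>k. real k * h k)
      = r * measure_pmf.expectation (poisson0_pmf r) (\<lambda>k. h (Suc k))" .
qed

lemma poisson_exp:
  assumes r: "r \<ge> 0"
  shows "integrable (measure_pmf (poisson0_pmf r)) (\<lambda>k. exp (t * real k))"
    and "measure_pmf.expectation (poisson0_pmf r) (\<lambda>k. exp (t * real k)) = exp (r * (exp t - 1))"
proof -
  have eq: "pmf (poisson0_pmf r) k * exp (t * real k) = exp (- r) * ((r * exp t) ^ k /\<^sub>R fact k)" for k
    using r by (simp add: pmf_poisson0 exp_of_nat2_mult power_mult_distrib field_simps)
  have s: "(\<lambda>k. pmf (poisson0_pmf r) k * exp (t * real k)) sums (exp (- r) * exp (r * exp t))"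
    unfolding eq by (intro sums_mult exp_converges)
  then have "summable (\<lambda>k. norm (pmf (poisson0_pmf r) k * exp (t * real k)))"
    by (simp add: sums_iff)
  then show i: "integrable (measure_pmf (poisson0_pmf r)) (\<lambda>k. exp (t * real k))"
    unfolding integrable_nat_pmf_iff .
  show "measure_pmf.expectation (poisson0_pmf r) (\<lambda>k. exp (t * real k)) = exp (r * (exp t - 1))"
    using s by (subst expectation_nat_pmf[OF i]) (simp add: sums_iff exp_add[symmetric] algebra_simps)
qed

lemma power_le_fact_exp:
  fixes x :: real
  assumes "x \<ge> 0"
  shows "x ^ k \<le> fact k * exp x"
proof -
  have "(\<Sum>j\<in>{k}. x ^ j /\<^sub>R fact j) \<le> exp x"
    unfolding exp_def using assms summable_exp_generic[of x] by (intro sum_le_suminf) auto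
  then show ?thesis by (simp add: field_simps)
qed

text \<open>
  The exponential moment dominates every power.
\<close>

lemma integrable_poisson_poly:
  assumes "r \<ge> 0"
  shows "integrable (measure_pmf (poisson0_pmf r)) (\<lambda>k. poly P (real k))"
proof -
  have "integrable (measure_pmf (poisson0_pmf r)) (\<lambda>k. real k ^ j)" for j
  proof (rule Bochner_Integration.integrable_bound)
    show "integrable (measure_pmf (poisson0_pmf r)) (\<lambda>k. fact j * exp (1 * real k))"
      using poisson_exp(1)[OF assms, of 1] by (intro integrable_mult_right) simp
  qed (auto intro!: AE_I2 simp: power_le_fact_exp)
  then show ?thesis
    unfolding poly_altdef by (intro Bochner_Integration.integrable_sum integrable_mult_right)
qed

text \<open>
  Chernoff's bound with \<open>t = s / (2 * \<nu>)\<close>. The condition \<open>s \<le> 2 * \<nu>\<close> is \<open>t \<le> 1\<close>, where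
  \<open>exp t \<le> 1 + t + t\<^sup>2\<close>. The bound \<open>\<nu>\<close> on the rate is separate from the threshold because
  the rate may be much smaller than the scale at which deviations are measured.
\<close>

lemma poisson_upper_tail:
  assumes r: "r \<ge> 0" and le: "r + s \<le> a" "r \<le> \<nu>" and s: "0 \<le> s" "s \<le> 2 * \<nu>" and \<nu>: "\<nu> > 0"
  shows "measure_pmf.prob (poisson0_pmf r) {k. real k \<ge> a} \<le> exp (- (s\<^sup>2 / (4 * \<nu>)))"
proof -
  let ?D = "poisson0_pmf r"
  define t where "t = s / (2 * \<nu>)"
  have t: "0 \<le> t" "t \<le> 1" using s \<nu> by (auto simp: t_def)
  have "measure_pmf.prob ?D {k. real k \<ge> a} = measure_pmf.expectation ?D (indicator {k. real k \<ge> a})"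
    by simp
  also have "\<dots> \<le> measure_pmf.expectation ?D (\<lambda>k. exp (- t * a) * exp (t * real k))"
  proof (rule integral_mono)
    show "integrable (measure_pmf ?D) (\<lambda>k. exp (- t * a) * exp (t * real k))"
      by (intro integrable_mult_right poisson_exp r)
    show "indicator {k. real k \<ge> a} k \<le> exp (- t * a) * exp (t * real k)" for k
      using t by (auto simp: indicator_def exp_add[symmetric] mult_left_mono)
  qed (auto simp: integrable_indicator_iff less_top[symmetric])
  also have "\<dots> = exp (- t * a + r * (exp t - 1))"
    unfolding exp_add integral_mult_right_zero poisson_exp(2)[OF r] ..
  also have "\<dots> \<le> exp (- (s\<^sup>2 / (4 * \<nu>)))"
  proof -
    have "exp t - 1 \<le> t + t\<^sup>2" using exp_bound[OF t] by simp
    then have "r * (exp t - 1) \<le> r * (t + t\<^sup>2)" using r by (rule mult_left_mono)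
    also have "\<dots> \<le> r * t + \<nu> * t\<^sup>2" using le by (simp add: distrib_left mult_right_mono)
    finally have "- t * a + r * (exp t - 1) \<le> - t * (a - r) + \<nu> * t\<^sup>2" by (simp add: algebra_simps)
    also have "\<dots> \<le> - t * s + \<nu> * t\<^sup>2" using t le by (simp add: mult_left_mono)
    also have "\<dots> = - (s\<^sup>2 / (4 * \<nu>))"
      using \<nu> by (simp add: t_def power2_eq_square field_simps)
    finally show ?thesis by simp
  qed
  finally show ?thesis .
qed

text \<open>
  Chernoff's bound at \<open>- t\<close>. Larger rates make the lower tail smaller, so the estimate at the reference
  rate \<open>\<mu>\<close> serves all rates above it.
\<close>

lemma poisson_lower_tail:
  assumes le: "\<mu> \<le> r" "a + s \<le> \<mu>" and s: "0 \<le> s" and \<mu>: "\<mu> > 0"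
  shows "measure_pmf.prob (poisson0_pmf r) {k. real k \<le> a} \<le> exp (- (s\<^sup>2 / (4 * \<mu>)))"
proof -
  let ?D = "poisson0_pmf r"
  define t where "t = s / (2 * \<mu>)"
  have t: "0 \<le> t" using s \<mu> by (auto simp: t_def)
  have r: "r \<ge> 0" using le \<mu> by simp
  have "measure_pmf.prob ?D {k. real k \<le> a} = measure_pmf.expectation ?D (indicator {k. real k \<le> a})"
    by simp
  also have "\<dots> \<le> measure_pmf.expectation ?D (\<lambda>k. exp (t * a) * exp ((- t) * real k))"
  proof (rule integral_mono)
    show "integrable (measure_pmf ?D) (\<lambda>k. exp (t * a) * exp ((- t) * real k))"
      by (intro integrable_mult_right poisson_exp r)
    show "indicator {k. real k \<le> a} k \<le> exp (t * a) * exp ((- t) * real k)" for k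
      using t by (auto simp: indicator_def exp_add[symmetric] mult_left_mono)
  qed (auto simp: integrable_indicator_iff less_top[symmetric])
  also have "\<dots> = exp (t * a + r * (exp (- t) - 1))"
    unfolding exp_add integral_mult_right_zero poisson_exp(2)[OF r] ..
  also have "\<dots> \<le> exp (- (s\<^sup>2 / (4 * \<mu>)))"
  proof -
    have e: "exp (- t) - 1 \<le> - t + t\<^sup>2"
    proof -
      have "exp (- t) \<le> 1 / (1 + t)"
        using exp_ge_add_one_self[of t] t by (simp add: exp_minus field_simps)
      also have "\<dots> \<le> 1 - t + t\<^sup>2"
        using t by (simp add: field_simps power2_eq_square)
      finally show ?thesis by simp
    qed
    have "exp (- t) - 1 \<le> 0" using t by simp
    then have "r * (exp (- t) - 1) \<le> \<mu> * (exp (- t) - 1)" using le by (intro mult_right_mono_neg)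
    also have "\<dots> \<le> \<mu> * (- t + t\<^sup>2)" using e \<mu> by (intro mult_left_mono) auto
    finally have "t * a + r * (exp (- t) - 1) \<le> - t * (\<mu> - a) + \<mu> * t\<^sup>2" by (simp add: algebra_simps)
    also have "\<dots> \<le> - t * s + \<mu> * t\<^sup>2" using t le by (simp add: mult_left_mono)
    also have "\<dots> = - (s\<^sup>2 / (4 * \<mu>))"
      using \<mu> by (simp add: t_def power2_eq_square field_simps)
    finally show ?thesis by simp
  qed
  finally show ?thesis .
qed

section \<open>Unbiased estimation of polynomials of a Poisson mean\<close>

text \<open>
  A common degree bound makes the estimators of different polynomials sums over the same index set,
  from which linearity is immediate.
\<close>

lemma unbiased_poly_bound:
  assumes "degree P \<le> d"
  shows "unbiased_poly n P x = (\<Sum>j\<le>d. coeff P j * (\<Prod>k<j. x - real k / n))"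
  unfolding unbiased_poly_def using assms
  by (intro sum.mono_neutral_left) (auto simp: coeff_eq_0)

lemma unbiased_poly_0 [simp]: "unbiased_poly n 0 x = 0"
  by (simp add: unbiased_poly_def)

text \<open>
  Multiplication of a polynomial by \<open>x\<close> corresponds to multiplying the estimator by \<open>x\<close> and shifting
  its argument by one count. This is the side of the Stein identity that matches \<open>poisson_stein\<close>.
\<close>

lemma unbiased_poly_pCons [simp]:
  "unbiased_poly n (pCons a P) x = a + x * unbiased_poly n P (x - 1 / n)"
proof -
  have "unbiased_poly n (pCons a P) x
      = (\<Sum>j\<le>Suc (degree P). coeff (pCons a P) j * (\<Prod>k<j. x - real k / n))"
    by (rule unbiased_poly_bound) (rule degree_pCons_le)
  also have "\<dots> = a + (\<Sum>j\<le>degree P. coeff P j * (\<Prod>k<Suc j. x - real k / n))"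
    by (subst sum.atMost_Suc_shift) simp
  also have "(\<lambda>j. \<Prod>k<Suc j. x - real k / n) = (\<lambda>j. x * (\<Prod>k<j. x - 1 / n - real k / n))"
    by (rule ext, subst prod.lessThan_Suc_shift) (simp add: add_divide_distrib algebra_simps)
  finally show ?thesis
    by (simp add: unbiased_poly_def sum_distrib_left mult.left_commute)
qed

lemma unbiased_poly_add: "unbiased_poly n (P + Q) x = unbiased_poly n P x + unbiased_poly n Q x"
proof -
  define d where "d = max (degree P) (degree Q)"
  have "degree (P + Q) \<le> d" "degree P \<le> d" "degree Q \<le> d"
    by (auto simp: d_def degree_add_le)
  then show ?thesis by (simp add: unbiased_poly_bound[of _ d] distrib_right sum.distrib)
qed

lemma unbiased_poly_smult: "unbiased_poly n (smult c P) x = c * unbiased_poly n P x"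
  by (simp add: unbiased_poly_bound[of _ "degree P"] degree_smult_le sum_distrib_left mult.assoc)

lemma unbiased_poly_sum:
  "unbiased_poly n (\<Sum>i\<in>I. P i) x = (\<Sum>i\<in>I. unbiased_poly n (P i) x)"
  by (induction I rule: infinite_finite_induct) (auto simp: unbiased_poly_add)

lemma unbiased_poly_eq_poly: "\<exists>Q. \<forall>x. unbiased_poly n P x = poly Q x"
proof (induction P)
  case (pCons a P)
  then obtain Q where "\<forall>x. unbiased_poly n P x = poly Q x" by blast
  then have "\<forall>x. unbiased_poly n (pCons a P) x = poly (pCons a (Q \<circ>\<^sub>p [:- 1 / n, 1:])) x"
    by (simp add: poly_pcompose)
  then show ?case by blast
qed (auto intro: exI[of _ 0])

text \<open>
  On estimators the forward difference by one count plays the part of differentiation.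
\<close>

lemma unbiased_poly_shift:
  "unbiased_poly n P (x + 1 / n) - unbiased_poly n P x = unbiased_poly n (pderiv P) x / n"
proof (induction P arbitrary: x)
  case (pCons a P)
  from pCons.IH[of "x - 1 / n"] show ?case
    by (simp add: pderiv_pCons unbiased_poly_add algebra_simps add_divide_distrib[symmetric])
qed simp

lemma integrable_poisson_unbiased_mult:
  assumes "r \<ge> 0"
  shows "integrable (measure_pmf (poisson0_pmf r))
    (\<lambda>k. unbiased_poly n P (real k / n + a) * unbiased_poly n Q (real k / n + b))"
proof -
  obtain P' Q' where "\<forall>x. unbiased_poly n P x = poly P' x" "\<forall>x. unbiased_poly n Q x = poly Q' x"
    using unbiased_poly_eq_poly by meson
  then have "(\<lambda>k. unbiased_poly n P (real k / n + a) * unbiased_poly n Q (real k / n + b))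
      = (\<lambda>k. poly ((P' \<circ>\<^sub>p [:a, 1 / n:]) * (Q' \<circ>\<^sub>p [:b, 1 / n:])) (real k))"
    by (auto simp: poly_pcompose algebra_simps)
  then show ?thesis using integrable_poisson_poly[OF assms] by metis
qed

lemma integrable_poisson_unbiased:
  assumes "r \<ge> 0"
  shows "integrable (measure_pmf (poisson0_pmf r)) (\<lambda>k. unbiased_poly n P (real k / n))"
  using integrable_poisson_unbiased_mult[OF assms, of n P 0 "[:1:]" 0] by simp

lemma expectation_unbiased_poly:
  assumes "n > 0" "p \<ge> 0"
  shows "measure_pmf.expectation (poisson0_pmf (n * p)) (\<lambda>k. unbiased_poly n P (real k / n)) = poly P p"
proof (induction P)
  case (pCons a P)
  let ?E = "measure_pmf.expectation (poisson0_pmf (n * p))"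
  have r: "n * p \<ge> 0" using assms by simp
  have eq: "unbiased_poly n (pCons a P) (real k / n)
      = a + (1 / n) * (real k * unbiased_poly n P (real k / n - 1 / n))" for k
    by simp
  have s: "(\<lambda>k. unbiased_poly n P (real (Suc k) / n - 1 / n)) = (\<lambda>k. unbiased_poly n P (real k / n))"
    by (simp add: add_divide_distrib)
  have i: "integrable (measure_pmf (poisson0_pmf (n * p)))
      (\<lambda>k. unbiased_poly n P (real (Suc k) / n - 1 / n))"
    unfolding s by (rule integrable_poisson_unbiased[OF r])
  note st = poisson_stein[of "n * p" "\<lambda>k. unbiased_poly n P (real k / n - 1 / n)", OF r i]
  have "?E (\<lambda>k. unbiased_poly n (pCons a P) (real k / n))
      = a + (1 / n) * ?E (\<lambda>k. real k * unbiased_poly n P (real k / n - 1 / n))"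
    unfolding eq using st(1)
    by (subst Bochner_Integration.integral_add) (auto intro!: integrable_mult_right simp del: times_divide_eq_left)
  also have "\<dots> = a + p * ?E (\<lambda>k. unbiased_poly n P (real k / n))"
    unfolding st(2) s using assms by simp
  finally show ?case using pCons.IH by simp
qed simp

text \<open>
  The estimators of \<open>(x - p) ^ j\<close> are the Charlier polynomials. One factor of the square is reduced by the
  recurrence that raises \<open>j\<close>; the Stein identity turns this into a forward difference of the other
  factor, which lowers its index again. One step therefore contributes \<open>p * Suc j / n\<close>.
\<close>

lemma expectation_charlier_square:
  assumes n: "n > 0" and p: "p \<ge> 0"
  shows "measure_pmf.expectation (poisson0_pmf (n * p))
      (\<lambda>k. (unbiased_poly n ([:- p, 1:] ^ j) (real k / n))\<^sup>2) = fact j * (p / n) ^ j"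
proof (induction j)
  case 0
  show ?case by (simp add: one_pCons)
next
  case (Suc j)
  let ?D = "poisson0_pmf (n * p)"
  let ?E = "measure_pmf.expectation ?D"
  define G where "G j x = unbiased_poly n ([:- p, 1:] ^ j) x" for j x
  have r: "n * p \<ge> 0" using assms by simp
  have rec: "G (Suc j) x = x * G j (x - 1 / n) - p * G j x" for x
  proof -
    have "[:- p, 1:] ^ Suc j = pCons 0 ([:- p, 1:] ^ j) + smult (- p) ([:- p, 1:] ^ j)" by simp
    then show ?thesis unfolding G_def
      by (simp only: unbiased_poly_add unbiased_poly_smult unbiased_poly_pCons)
  qed
  have diff: "G (Suc j) (x + 1 / n) - G (Suc j) x = (real (Suc j) / n) * G j x" for x
    unfolding G_def unbiased_poly_shift
    by (simp add: pderiv_power_Suc pderiv_pCons one_pCons[symmetric] unbiased_poly_smult del: power_Suc of_nat_Suc)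
  have int: "integrable ?D (\<lambda>k. G i (real k / n + a) * G i' (real k / n + b))" for i i' a b
    unfolding G_def by (rule integrable_poisson_unbiased_mult[OF r])
  define h where "h k = G j (real k / n - 1 / n) * G (Suc j) (real k / n)" for k
  have hS: "h (Suc k) = G j (real k / n) * G (Suc j) (real k / n + 1 / n)" for k
    by (simp add: h_def add_divide_distrib add.commute)
  have i1: "integrable ?D (\<lambda>k. h (Suc k))" unfolding hS using int[of j 0 "Suc j" "1 / n"] by simp
  have i2: "integrable ?D (\<lambda>k. G j (real k / n) * G (Suc j) (real k / n))"
    using int[of j 0 "Suc j" 0] by simp
  note st = poisson_stein[OF r i1]
  have "?E (\<lambda>k. (G (Suc j) (real k / n))\<^sup>2)
      = ?E (\<lambda>k. (1 / n) * (real k * h k) - p * (G j (real k / n) * G (Suc j) (real k / n)))"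
  proof (rule Bochner_Integration.integral_cong[OF refl])
    fix k
    have "(G (Suc j) (real k / n))\<^sup>2 = (real k / n * G j (real k / n - 1 / n) - p * G j (real k / n)) * G (Suc j) (real k / n)"
      by (simp only: rec[symmetric] power2_eq_square)
    then show "(G (Suc j) (real k / n))\<^sup>2
        = (1 / n) * (real k * h k) - p * (G j (real k / n) * G (Suc j) (real k / n))"
      by (simp add: h_def algebra_simps)
  qed
  also have "\<dots> = (1 / n) * ?E (\<lambda>k. real k * h k) - p * ?E (\<lambda>k. G j (real k / n) * G (Suc j) (real k / n))"
    using st(1) i2 by (subst Bochner_Integration.integral_diff) (auto simp del: times_divide_eq_left times_divide_eq_right)
  also have "\<dots> = p * (?E (\<lambda>k. h (Suc k)) - ?E (\<lambda>k. G j (real k / n) * G (Suc j) (real k / n)))"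
    unfolding st(2) using n by (simp add: algebra_simps)
  also have "\<dots> = p * ?E (\<lambda>k. h (Suc k) - G j (real k / n) * G (Suc j) (real k / n))"
    using i1 i2 by simp
  also have "(\<lambda>k. h (Suc k) - G j (real k / n) * G (Suc j) (real k / n))
      = (\<lambda>k. (real (Suc j) / n) * (G j (real k / n))\<^sup>2)"
    unfolding hS right_diff_distrib[symmetric] diff by (simp add: power2_eq_square mult.left_commute)
  also have "p * ?E \<dots> = p * (real (Suc j) / n) * (fact j * (p / n) ^ j)"
    using Suc.IH unfolding G_def by (simp only: integral_mult_right_zero mult.assoc)
  also have "\<dots> = fact (Suc j) * (p / n) ^ Suc j" by (simp add: field_simps)
  finally show ?case unfolding G_def .
qed

section \<open>Coefficients of bounded polynomials\<close>

text \<open>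
  Induction over the factors: a coefficient of the product with one more factor has two contributions, and the weight
  \<open>\<rho> ^ m\<close> turns the shift of index in one of them into the factor \<open>\<rho>\<close>.
\<close>

lemma abs_coeff_prod_linear:
  fixes x :: "'a \<Rightarrow> real"
  assumes "finite J" "\<rho> \<ge> 0"
  shows "\<bar>coeff (\<Prod>j\<in>J. [:- x j, 1:]) m\<bar> * \<rho> ^ m \<le> (\<Prod>j\<in>J. \<rho> + \<bar>x j\<bar>)"
  using assms(1)
proof (induction J arbitrary: m rule: finite_induct)
  case empty
  show ?case by (simp add: coeff_1 )
next
  case (insert i J)
  let ?g = "\<Prod>j\<in>J. [:- x j, 1:]" and ?B = "\<Prod>j\<in>J. \<rho> + \<bar>x j\<bar>"
  have B: "\<bar>coeff ?g m\<bar> * \<rho> ^ m \<le> ?B" for m by (rule insert.IH)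
  have "\<bar>coeff ([:- x i, 1:] * ?g) m\<bar> * \<rho> ^ m \<le> \<rho> * ?B + \<bar>x i\<bar> * ?B"
  proof (cases m)
    case 0
    have "\<bar>x i\<bar> * \<bar>coeff ?g 0\<bar> \<le> \<bar>x i\<bar> * ?B"
      using B[of 0] by (intro mult_left_mono) auto
    moreover have "0 \<le> \<rho> * ?B" using assms by (intro mult_nonneg_nonneg prod_nonneg) auto
    ultimately show ?thesis using 0 by (simp add: abs_mult)
  next
    case (Suc l)
    have "\<bar>coeff ([:- x i, 1:] * ?g) m\<bar> * \<rho> ^ m
        = \<bar>coeff ?g l - x i * coeff ?g m\<bar> * \<rho> ^ m" by (simp add: Suc)
    also have "\<dots> \<le> (\<bar>coeff ?g l\<bar> + \<bar>x i\<bar> * \<bar>coeff ?g m\<bar>) * \<rho> ^ m"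
      using assms abs_triangle_ineq4[of "coeff ?g l" "x i * coeff ?g m"]
      by (intro mult_right_mono) (auto simp: abs_mult)
    also have "\<dots> = \<rho> * (\<bar>coeff ?g l\<bar> * \<rho> ^ l) + \<bar>x i\<bar> * (\<bar>coeff ?g m\<bar> * \<rho> ^ m)"
      by (simp add: Suc algebra_simps)
    also have "\<dots> \<le> \<rho> * ?B + \<bar>x i\<bar> * ?B"
      using B assms by (intro add_mono mult_left_mono) auto
    finally show ?thesis .
  qed
  then show ?case using insert.hyps by (simp add: distrib_right)
qed

lemma prod_node_distances:
  assumes "i \<le> K"
  shows "(\<Prod>j\<in>{..K} - {i}. \<bar>real i - real j\<bar>) = fact i * fact (K - i)"
proof -
  have "(\<Prod>j\<in>{..K} - {i}. \<bar>real i - real j\<bar>) = (\<Prod>j\<in>{..<i} \<union> {i<..K}. \<bar>real i - real j\<bar>)"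
    using assms by (intro prod.cong) auto
  also have "\<dots> = (\<Prod>j<i. \<bar>real i - real j\<bar>) * (\<Prod>j\<in>{i<..K}. \<bar>real i - real j\<bar>)"
    by (rule prod.union_disjoint) auto
  also have "(\<Prod>j<i. \<bar>real i - real j\<bar>) = fact i"
    unfolding fact_prod_rev[of i] of_nat_prod by (rule prod.cong) (auto simp: of_nat_diff)
  also have "(\<Prod>j\<in>{i<..K}. \<bar>real i - real j\<bar>) = (\<Prod>j\<in>{1..K - i}. real j)"
    by (rule prod.reindex_bij_witness[of _ "\<lambda>j. j + i" "\<lambda>j. j - i"]) (auto simp: of_nat_diff)
  also have "\<dots> = fact (K - i)" by (simp add: fact_prod)
  finally show ?thesis .
qed

lemma lagrange_interpolation:
  fixes f :: "real poly"
  assumes "degree f \<le> K"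
  shows "f = (\<Sum>i\<le>K. smult (poly f (real i) / (\<Prod>j\<in>{..K} - {i}. real i - real j))
      (\<Prod>j\<in>{..K} - {i}. [:- real j, 1:]))" (is "f = ?L")
proof (rule poly_eqI_degree[where A = "real ` {..K}"])
  show "card (real ` {..K}) > degree f" using assms by (simp add: card_image)
  have "degree (\<Prod>j\<in>{..K} - {i}. [:- real j, 1:]) \<le> K" if "i \<le> K" for i
    using degree_prod_sum_le[of "{..K} - {i}" "\<lambda>j. [:- real j, 1:]"] that by simp
  then have "degree ?L \<le> K"
    by (intro degree_sum_le) (auto intro: order_trans[OF degree_smult_le])
  then show "card (real ` {..K}) > degree ?L" by (simp add: card_image)
  fix x assume "x \<in> real ` {..K}"
  then obtain l where l: "l \<le> K" "x = real l" by auto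
  have "poly ?L x = (\<Sum>i\<le>K. poly f (real i) / (\<Prod>j\<in>{..K} - {i}. real i - real j)
      * (\<Prod>j\<in>{..K} - {i}. real l - real j))"
    by (simp add: poly_sum poly_prod l)
  also have "\<dots> = (\<Sum>i\<le>K. if i = l then poly f x else 0)"
    using l by (intro sum.cong) auto
  finally show "poly f x = poly ?L x" using l by simp
qed

text \<open>
  Lagrange interpolation at \<open>0, ..., K\<close>: each basis polynomial has weighted coefficients at most
  \<open>(2 * K) ^ K / (fact i * fact (K - i)) \<le> 4 ^ K * K ^ K / fact K \<le> 12 ^ K\<close>, and there
  are \<open>K + 1 \<le> 2 ^ K\<close> of them. Only exponential growth in \<open>K\<close> matters, not the base.
\<close>

lemma abs_coeff_le_on_grid:
  fixes f :: "real poly"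
  assumes deg: "degree f \<le> K" and M: "\<And>i. i \<le> K \<Longrightarrow> \<bar>poly f (real i)\<bar> \<le> M"
  shows "\<bar>coeff f m\<bar> * real K ^ m \<le> M * 24 ^ K"
proof -
  have M0: "0 \<le> M" using M[of 0] by simp
  let ?c = "\<lambda>i. poly f (real i) / (\<Prod>j\<in>{..K} - {i}. real i - real j)"
  let ?P = "\<lambda>i. \<Prod>j\<in>{..K} - {i}. [:- real j, 1:]"
  have "coeff f m = (\<Sum>i\<le>K. ?c i * coeff (?P i) m)"
    by (subst lagrange_interpolation[OF deg]) (simp add: coeff_sum)
  then have "\<bar>coeff f m\<bar> * real K ^ m \<le> (\<Sum>i\<le>K. \<bar>?c i * coeff (?P i) m\<bar>) * real K ^ m"
    by (simp only:) (intro mult_right_mono sum_abs, simp)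
  also have "\<dots> = (\<Sum>i\<le>K. \<bar>?c i\<bar> * (\<bar>coeff (?P i) m\<bar> * real K ^ m))"
    by (simp add: sum_distrib_right abs_mult mult.assoc)
  also have "\<dots> \<le> (\<Sum>i\<le>K. M * 12 ^ K)"
  proof (rule sum_mono)
    fix i assume "i \<in> {..K}"
    then have i: "i \<le> K" by simp
    have "\<bar>coeff (?P i) m\<bar> * real K ^ m \<le> (\<Prod>j\<in>{..K} - {i}. real K + \<bar>real j\<bar>)"
      by (rule abs_coeff_prod_linear) auto
    also have "\<dots> \<le> (\<Prod>j\<in>{..K} - {i}. 2 * real K)"
      by (rule prod_mono) auto
    also have "\<dots> = (2 * real K) ^ K" using i by (simp add: card_Diff_singleton)
    finally have P: "\<bar>coeff (?P i) m\<bar> * real K ^ m \<le> (2 * real K) ^ K" .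
    have c: "\<bar>?c i\<bar> \<le> M / (fact i * fact (K - i))"
      using M[OF i] prod_node_distances[OF i]
      by (simp add: abs_prod divide_right_mono)
    have "real (K choose i) \<le> 2 ^ K"
      using binomial_le_pow2[of K i] by (metis of_nat_le_iff of_nat_numeral of_nat_power)
    then have "1 / (fact i * fact (K - i)) \<le> 2 ^ K / (fact K :: real)"
      using i by (simp add: binomial_fact field_simps)
    then have "M * (1 / (fact i * fact (K - i))) \<le> M * (2 ^ K / fact K)"
      using M0 by (rule mult_left_mono)
    with c have c': "\<bar>?c i\<bar> \<le> M * 2 ^ K / fact K" by simp
    have "\<bar>?c i\<bar> * (\<bar>coeff (?P i) m\<bar> * real K ^ m) \<le> (M * 2 ^ K / fact K) * (2 * real K) ^ K"
      using c' P M0 by (intro mult_mono) auto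
    also have "\<dots> = M * 4 ^ K * (real K ^ K / fact K)"
    proof -
      have "(4 :: real) ^ K = 2 ^ K * 2 ^ K" by (simp add: power_mult_distrib[symmetric])
      then show ?thesis by (simp add: power_mult_distrib)
    qed
    also have "\<dots> \<le> M * 4 ^ K * 3 ^ K"
    proof -
      have "real K ^ K \<le> fact K * exp (real K)" by (rule power_le_fact_exp) simp
      also have "exp (real K) = exp 1 ^ K" using exp_of_nat_mult[of K 1] by simp
      also have "fact K * exp 1 ^ K \<le> fact K * (3 :: real) ^ K"
        using exp_le by (intro mult_left_mono power_mono) auto
      finally show ?thesis using M0 by (intro mult_left_mono) (auto simp: field_simps)
    qed
    also have "\<dots> = M * 12 ^ K"
    proof -
      have "(12 :: real) ^ K = 4 ^ K * 3 ^ K" by (simp add: power_mult_distrib[symmetric])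
      then show ?thesis by simp
    qed
    finally show "\<bar>?c i\<bar> * (\<bar>coeff (?P i) m\<bar> * real K ^ m) \<le> M * 12 ^ K" .
  qed
  also have "\<dots> = real (K + 1) * (M * 12 ^ K)" by simp
  also have "\<dots> \<le> 2 ^ K * (M * 12 ^ K)"
  proof (rule mult_right_mono)
    have "K + 1 \<le> 2 ^ K" by (induction K) auto
    then show "real (K + 1) \<le> 2 ^ K" by (metis of_nat_le_iff of_nat_numeral of_nat_power)
  qed (use M0 in auto)
  also have "\<dots> = M * 24 ^ K"
  proof -
    have "(24 :: real) ^ K = 2 ^ K * 12 ^ K" by (simp add: power_mult_distrib[symmetric])
    then show ?thesis by simp
  qed
  finally show ?thesis .
qed

lemma abs_coeff_le_on_unit_interval:
  fixes g :: "real poly"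
  assumes deg: "degree g \<le> K" and M: "\<And>y. 0 \<le> y \<Longrightarrow> y \<le> 1 \<Longrightarrow> \<bar>poly g y\<bar> \<le> M"
  shows "\<bar>coeff g m\<bar> \<le> M * 24 ^ K"
proof (cases "K = 0")
  case True
  then obtain a where "g = [:a:]" using deg degree_eq_zeroE by auto
  then show ?thesis using M[of 0] True by (cases m) (auto simp: coeff_pCons split: nat.splits)
next
  case False
  define f where "f = g \<circ>\<^sub>p [:0, 1 / real K:]"
  have "\<bar>coeff f m\<bar> * real K ^ m \<le> M * 24 ^ K"
  proof (rule abs_coeff_le_on_grid)
    show "degree f \<le> K" using deg False by (simp add: f_def degree_pcompose)
    show "\<bar>poly f (real i)\<bar> \<le> M" if "i \<le> K" for i
      using that False M[of "real i / real K"] by (simp add: f_def poly_pcompose)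
  qed
  also have "coeff f m = coeff g m * (1 / real K) ^ m"
    unfolding f_def by (simp add: coeff_pcompose_linear)
  finally show ?thesis using False by (simp add: abs_mult power_one_over)
qed

text \<open>
  The polynomial is expanded at \<open>p\<close> itself, on a segment of length \<open>r\<close> that starts at \<open>p\<close> and runs
  in the direction \<open>\<sigma>\<close> staying inside the interval where the polynomial is bounded. The \<open>j\<close>-th
  coefficient is at most \<open>M * 24 ^ K / r ^ j\<close>, and under \<open>K * p / n \<le> r\<^sup>2\<close> the second moment
  \<open>fact j * (p / n) ^ j\<close> of the Charlier polynomial cancels the power of \<open>r\<close>.
\<close>

lemma second_moment_unbiased_poly:
  fixes R :: "real poly"
  assumes n: "n > 0" and p: "p \<ge> 0" and r: "r > 0" and deg: "degree R \<le> K"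
    and M: "\<And>y. 0 \<le> y \<Longrightarrow> y \<le> 1 \<Longrightarrow> \<bar>poly R (p + \<sigma> * r * y)\<bar> \<le> M"
    and \<sigma>: "\<sigma> = 1 \<or> \<sigma> = - 1"
    and Kp: "real K * p / n \<le> r\<^sup>2"
  shows "measure_pmf.expectation (poisson0_pmf (n * p)) (\<lambda>k. (unbiased_poly n R (real k / n))\<^sup>2)
    \<le> (real (K + 1) * 24 ^ K * M)\<^sup>2"
proof -
  let ?D = "poisson0_pmf (n * p)"
  let ?E = "measure_pmf.expectation ?D"
  have np: "n * p \<ge> 0" using n p by simp
  have ss: "\<sigma> * \<sigma> = 1" using \<sigma> by auto
  have M0: "0 \<le> M" using M[of 0] by simp
  define g where "g = R \<circ>\<^sub>p [:p, \<sigma> * r:]"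
  define b where "b k = coeff g k * (\<sigma> / r) ^ k" for k
  have degg: "degree g \<le> K" using deg by (simp add: g_def degree_pcompose)
  have g: "\<bar>coeff g m\<bar> \<le> M * 24 ^ K" for m
    using degg M by (intro abs_coeff_le_on_unit_interval) (auto simp: g_def poly_pcompose algebra_simps)
  have R: "R = (\<Sum>k\<le>K. smult (b k) ([:- p, 1:] ^ k))"
  proof -
    have "poly R x = poly (\<Sum>k\<le>K. smult (b k) ([:- p, 1:] ^ k)) x" for x
    proof -
      have "poly R x = poly g ((x - p) * \<sigma> / r)"
      proof -
        have "p + (x - p) * \<sigma> / r * (\<sigma> * r) = p + (x - p) * (\<sigma> * \<sigma>)" using r by simp
        then show ?thesis using ss by (simp add: g_def poly_pcompose)
      qed
      also have "\<dots> = (\<Sum>k\<le>K. coeff g k * ((x - p) * \<sigma> / r) ^ k)"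
        unfolding poly_altdef using degg by (intro sum.mono_neutral_left) (auto simp: coeff_eq_0)
      also have "\<dots> = (\<Sum>k\<le>K. b k * (x - p) ^ k)"
        by (simp add: b_def power_mult_distrib power_divide mult_ac)
      finally show ?thesis by (simp add: poly_sum poly_power)
    qed
    then show ?thesis by (simp add: poly_eq_poly_eq_iff[symmetric] fun_eq_iff)
  qed
  define G where "G k N = unbiased_poly n ([:- p, 1:] ^ k) (real N / n)" for k N
  have TR: "unbiased_poly n R (real N / n) = (\<Sum>k\<le>K. b k * G k N)" for N
    by (subst R) (simp add: unbiased_poly_sum unbiased_poly_smult G_def)
  have intG: "integrable ?D (\<lambda>N. (G k N)\<^sup>2)" for k
    using integrable_poisson_unbiased_mult[OF np, of n "[:- p, 1:] ^ k" 0 "[:- p, 1:] ^ k" 0]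
    by (simp add: G_def power2_eq_square)
  have "?E (\<lambda>N. (unbiased_poly n R (real N / n))\<^sup>2)
      \<le> ?E (\<lambda>N. real (K + 1) * (\<Sum>k\<le>K. (b k)\<^sup>2 * (G k N)\<^sup>2))"
  proof (rule integral_mono)
    show "integrable ?D (\<lambda>N. (unbiased_poly n R (real N / n))\<^sup>2)"
      using integrable_poisson_unbiased_mult[OF np, of n R 0 R 0] by (simp add: power2_eq_square)
    show "integrable ?D (\<lambda>N. real (K + 1) * (\<Sum>k\<le>K. (b k)\<^sup>2 * (G k N)\<^sup>2))"
      using intG by (intro integrable_mult_right Bochner_Integration.integrable_sum)
    fix N
    have "(\<Sum>k\<le>K. 1 * (b k * G k N))\<^sup>2 \<le> (\<Sum>k\<le>K. 1\<^sup>2) * (\<Sum>k\<le>K. (b k * G k N)\<^sup>2)"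
      by (rule Cauchy_Schwarz_ineq_sum)
    then show "(unbiased_poly n R (real N / n))\<^sup>2 \<le> real (K + 1) * (\<Sum>k\<le>K. (b k)\<^sup>2 * (G k N)\<^sup>2)"
      by (simp add: TR power_mult_distrib)
  qed
  also have "\<dots> = real (K + 1) * (\<Sum>k\<le>K. (b k)\<^sup>2 * (fact k * (p / n) ^ k))"
    using intG unfolding integral_mult_right_zero
    by (subst Bochner_Integration.integral_sum)
      (auto simp: G_def expectation_charlier_square[OF n p])
  also have "\<dots> \<le> real (K + 1) * (\<Sum>k\<le>K. (M * 24 ^ K)\<^sup>2)"
  proof (intro mult_left_mono sum_mono)
    fix k assume "k \<in> {..K}"
    then have k: "k \<le> K" by simp
    have "(b k)\<^sup>2 = (coeff g k)\<^sup>2 / (r\<^sup>2) ^ k"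
    proof -
      have "(b k)\<^sup>2 = (coeff g k)\<^sup>2 * ((\<sigma> / r) ^ 2) ^ k"
        by (simp add: b_def power_mult_distrib power_mult[symmetric] mult.commute)
      also have "(\<sigma> / r) ^ 2 = 1 / r\<^sup>2" using ss by (simp add: power_divide power2_eq_square)
      finally show ?thesis by (simp add: power_one_over divide_simps)
    qed
    moreover have "fact k * (p / n) ^ k \<le> (r\<^sup>2) ^ k"
    proof -
      have "fact k \<le> real K ^ k"
      proof -
        have "fact k \<le> (real k ^ k :: real)" using fact_le_power[of k, where 'a = real] by simp
        also have "\<dots> \<le> real K ^ k" using k by (intro power_mono) auto
        finally show ?thesis .
      qed
      then have "fact k * (p / n) ^ k \<le> real K ^ k * (p / n) ^ k"
        using n p by (intro mult_right_mono) auto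
      also have "\<dots> = (real K * p / n) ^ k" by (simp add: power_mult_distrib power_divide)
      also have "\<dots> \<le> (r\<^sup>2) ^ k" using Kp n p by (intro power_mono) auto
      finally show ?thesis .
    qed
    ultimately have "(b k)\<^sup>2 * (fact k * (p / n) ^ k) \<le> (coeff g k)\<^sup>2 / (r\<^sup>2) ^ k * (r\<^sup>2) ^ k"
      by (simp only:) (rule mult_left_mono, auto)
    also have "\<dots> = \<bar>coeff g k\<bar>\<^sup>2" using r by simp
    also have "\<dots> \<le> (M * 24 ^ K)\<^sup>2" using g by (intro power_mono) auto
    finally show "(b k)\<^sup>2 * (fact k * (p / n) ^ k) \<le> (M * 24 ^ K)\<^sup>2" .
  qed simp
  also have "\<dots> = (real (K + 1) * 24 ^ K * M)\<^sup>2"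
    by (simp add: power2_eq_square algebra_simps)
  finally show ?thesis .
qed

section \<open>Jackson's theorem for Lipschitz functions\<close>

lemma sum_cos_equidistant:
  fixes e :: int
  assumes N: "N > 0" and e: "e \<noteq> 0" "\<bar>e\<bar> < int N"
  shows "(\<Sum>l<N. cos (\<alpha> + of_int e * (2 * pi * real l / real N))) = 0"
proof -
  define w where "w = cis (of_int e * (2 * pi / real N))"
  have "w \<noteq> 1"
  proof
    assume "w = 1"
    then have "cos (of_int e * (2 * pi / real N)) = 1" by (simp add: w_def complex_eq_iff)
    then obtain m :: int where "of_int e * (2 * pi / real N) = of_int m * 2 * pi"
      using cos_one_2pi_int by auto
    then have "(of_int e :: real) = of_int (m * int N)" using N by (simp add: field_simps)
    then have "e = m * int N" by (simp only: of_int_eq_iff)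
    then have "int N dvd e" by simp
    then show False using e zdvd_not_zless[of "\<bar>e\<bar>" "int N"] by auto
  qed
  moreover have "w ^ N = 1"
  proof -
    have "w ^ N = cis (2 * pi * of_int e)" using N unfolding w_def Complex.DeMoivre by (intro arg_cong[of _ _ cis]) simp
    then show ?thesis by (simp add: cis_multiple_2pi)
  qed
  ultimately have "(\<Sum>l<N. w ^ l) = 0" by (simp add: sum_gp_strict)
  then have "0 = Re (cis \<alpha> * (\<Sum>l<N. w ^ l))" by simp
  also have "\<dots> = (\<Sum>l<N. Re (cis \<alpha> * w ^ l))" by (simp add: sum_distrib_left)
  also have "\<dots> = (\<Sum>l<N. cos (\<alpha> + of_int e * (2 * pi * real l / real N)))"
    by (intro sum.cong) (simp_all add: w_def Complex.DeMoivre cis_mult mult_ac)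
  finally show ?thesis by simp
qed

text \<open>
  The right-hand side is linear in the functions \<open>cos (d * t)\<close>; this is what lets a squared kernel be
  read as an algebraic polynomial in \<open>cos t\<close>.
\<close>

lemma norm_square_trig_sum:
  fixes a :: "nat \<Rightarrow> real"
  shows "(cmod (\<Sum>k<m. of_real (a k) * cis (real k * t)))\<^sup>2
    = (\<Sum>k<m. \<Sum>k'<m. a k * a k' * cos ((real k - real k') * t))"
proof -
  have "(cmod (\<Sum>k<m. of_real (a k) * cis (real k * t)))\<^sup>2
      = (\<Sum>k<m. a k * cos (real k * t))\<^sup>2 + (\<Sum>k<m. a k * sin (real k * t))\<^sup>2"
    by (simp add: cmod_power2)
  also have "\<dots> = (\<Sum>k<m. \<Sum>k'<m. a k * cos (real k * t) * (a k' * cos (real k' * t))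
      + a k * sin (real k * t) * (a k' * sin (real k' * t)))"
    by (simp add: power2_eq_square sum_product sum.distrib)
  also have "\<dots> = (\<Sum>k<m. \<Sum>k'<m. a k * a k' * cos ((real k - real k') * t))"
    by (intro sum.cong) (simp_all add: left_diff_distrib cos_diff algebra_simps)
  finally show ?thesis .
qed

text \<open>
  Equidistant nodes integrate trigonometric polynomials of degree below \<open>N\<close> exactly, so all integrals of
  the classical proof of Jackson's theorem become finite sums.
\<close>

lemma discrete_parseval:
  fixes a :: "nat \<Rightarrow> real" and s :: int
  assumes N: "m \<le> N" "N > 0" and s: "s = 1 \<or> s = - 1"
  shows "(\<Sum>l<N. (cmod (\<Sum>k<m. of_real (a k) * cis (real k * (\<theta> + of_int s * (2 * pi * real l / real N)))))\<^sup>2)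
    = real N * (\<Sum>k<m. (a k)\<^sup>2)"
proof -
  let ?t = "\<lambda>l. \<theta> + of_int s * (2 * pi * real l / real N)"
  have inner: "(\<Sum>l<N. cos ((real k - real k') * ?t l)) = (if k = k' then real N else 0)"
    if "k < m" "k' < m" for k k'
  proof (cases "k = k'")
    case False
    have "(\<Sum>l<N. cos ((real k - real k') * \<theta> + of_int ((int k - int k') * s) * (2 * pi * real l / real N))) = 0"
      using that N s False by (intro sum_cos_equidistant) (auto simp: abs_mult)
    then show ?thesis using False by (simp add: algebra_simps)
  qed simp
  have "(\<Sum>l<N. (cmod (\<Sum>k<m. of_real (a k) * cis (real k * ?t l)))\<^sup>2)
      = (\<Sum>l<N. \<Sum>k<m. \<Sum>k'<m. a k * a k' * cos ((real k - real k') * ?t l))"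
    by (simp only: norm_square_trig_sum)
  also have "\<dots> = (\<Sum>k<m. \<Sum>l<N. \<Sum>k'<m. a k * a k' * cos ((real k - real k') * ?t l))"
    by (rule sum.swap)
  also have "\<dots> = (\<Sum>k<m. \<Sum>k'<m. \<Sum>l<N. a k * a k' * cos ((real k - real k') * ?t l))"
    by (intro sum.cong refl sum.swap)
  also have "\<dots> = (\<Sum>k<m. \<Sum>k'<m. a k * a k' * (if k = k' then real N else 0))"
    unfolding sum_distrib_left[symmetric] by (intro sum.cong refl) (simp only: inner lessThan_iff)
  also have "\<dots> = (\<Sum>k<m. a k * a k * real N)"
    by (intro sum.cong refl) (simp add: if_distrib cong: if_cong)
  finally show ?thesis by (simp add: power2_eq_square sum_distrib_left mult_ac)
qed

lemma chebyshev_poly_ex: "\<exists>T :: real poly. degree T \<le> d \<and> (\<forall>t. poly T (cos t) = cos (real d * t))"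
proof (induction d rule: less_induct)
  case (less d)
  consider "d = 0" | "d = 1" | e where "d = Suc (Suc e)"
    by (metis One_nat_def not0_implies_Suc)
  then show ?case
  proof cases
    case 1
    then show ?thesis by (intro exI[of _ 1]) simp
  next
    case 2
    then show ?thesis by (intro exI[of _ "[:0, 1:]"]) simp
  next
    case 3
    obtain T0 T1 :: "real poly" where T: "degree T0 \<le> e" "\<forall>t. poly T0 (cos t) = cos (real e * t)"
      "degree T1 \<le> Suc e" "\<forall>t. poly T1 (cos t) = cos (real (Suc e) * t)"
      using less.IH[of e] less.IH[of "Suc e"] 3 by auto
    have "degree ([:0, 2:] * T1 - T0) \<le> d"
      using T 3 by (intro degree_diff_le order_trans[OF degree_mult_le]) auto
    moreover have "poly ([:0, 2:] * T1 - T0) (cos t) = cos (real d * t)" for t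
    proof -
      have "cos (real (Suc e) * t + t) + cos (real (Suc e) * t - t) = 2 * cos t * cos (real (Suc e) * t)"
        by (simp only: cos_add cos_diff) simp
      moreover have "real (Suc e) * t + t = real d * t" "real (Suc e) * t - t = real e * t"
        by (simp_all add: 3 algebra_simps)
      ultimately show ?thesis using T by simp
    qed
    ultimately show ?thesis by blast
  qed
qed

lemma one_minus_cis_times_trig_sum:
  fixes a :: "nat \<Rightarrow> real"
  assumes "a m = 0"
  shows "(1 - cis t) * (\<Sum>k<m. of_real (a k) * cis (real k * t))
    = (\<Sum>k<Suc m. of_real (a k - (if k = 0 then 0 else a (k - 1))) * cis (real k * t))"
proof -
  have "(\<Sum>k<Suc m. of_real (a k - (if k = 0 then 0 else a (k - 1))) * cis (real k * t))
      = (\<Sum>k<Suc m. of_real (a k) * cis (real k * t))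
        - (\<Sum>k<Suc m. of_real (if k = 0 then 0 else a (k - 1)) * cis (real k * t))"
    by (simp only: of_real_diff left_diff_distrib sum_subtractf)
  also have "(\<Sum>k<Suc m. of_real (a k) * cis (real k * t)) = (\<Sum>k<m. of_real (a k) * cis (real k * t))"
    using assms by simp
  also have "(\<Sum>k<Suc m. of_real (if k = 0 then 0 else a (k - 1)) * cis (real k * t))
      = (\<Sum>k<m. of_real (a k) * cis (real (Suc k) * t))"
    by (subst sum.lessThan_Suc_shift) simp
  also have "\<dots> = cis t * (\<Sum>k<m. of_real (a k) * cis (real k * t))"
    unfolding sum_distrib_left
    by (intro sum.cong refl) (simp add: mult.left_commute[of "cis t"] cis_mult distrib_right)
  finally show ?thesis by (simp add: algebra_simps)
qed

text \<open>
  With \<open>A (z) = (1 + z + ... + z ^ (j - 1))\<^sup>2\<close>, the Jackson kernel, the weights \<open>\<bar>A (z)\<bar>\<^sup>2 / W\<close>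
  at the nodes form a probability distribution concentrated at distance of order \<open>1 / j\<close> from the
  evaluation point. Indeed the second moment of the chord \<open>\<bar>1 - z\<bar>\<close> is the sum of \<open>\<bar>(1 - z) A (z)\<bar>\<^sup>2 / W\<close>,
  where \<open>(1 - z) A (z)\<close> has coefficients at most one, while \<open>A\<close> has coefficients up to \<open>j\<close>.
  Averaging a Lipschitz function of \<open>cos\<close> against the weights therefore moves it by at most
  a multiple of \<open>\<Lambda> / j\<close>. Symmetrizing the weights under \<open>u \<mapsto> - u\<close> makes the average a polynomial in \<open>cos\<close>.
\<close>

lemma jackson_lipschitz:
  fixes f :: "real \<Rightarrow> real"
  assumes j: "j \<ge> 1" and \<Lambda>: "\<Lambda> \<ge> 0"
    and f: "\<And>x y. \<bar>x\<bar> \<le> 1 \<Longrightarrow> \<bar>y\<bar> \<le> 1 \<Longrightarrow> \<bar>f x - f y\<bar> \<le> \<Lambda> * \<bar>x - y\<bar>"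
  shows "\<exists>P. degree P \<le> 2 * (j - 1) \<and> (\<forall>x. \<bar>x\<bar> \<le> 1 \<longrightarrow> \<bar>f x - poly P x\<bar> \<le> 3 * \<Lambda> / real j)"
proof -
  define m where "m = 2 * j - 1"
  define N where "N = 2 * j"
  \<comment> \<open>The coefficients of \<open>(1 + z + ... + z ^ (j - 1))\<^sup>2\<close>: a hat of height \<open>j\<close>.\<close>
  define a :: "nat \<Rightarrow> real" where "a k = (if k < j then real (Suc k) else if k < m then real (m - k) else 0)" for k
  define A where "A t = (\<Sum>k<m. of_real (a k) * cis (real k * t))" for t
  define u where "u l = 2 * pi * real l / real N" for l
  define W where "W = real N * (\<Sum>k<m. (a k)\<^sup>2)"
  have N: "m \<le> N" "Suc m \<le> N" "N > 0" using j by (auto simp: N_def m_def)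
  have am: "a m = 0" using j by (auto simp: a_def m_def)
  have sq: "(\<Sum>k<i. (real (Suc k))\<^sup>2) \<ge> (real i) ^ 3 / 3" for i
    by (induction i) (auto simp: field_simps power2_eq_square power3_eq_cube)
  have a2: "(\<Sum>k<m. (a k)\<^sup>2) \<ge> (real j) ^ 3 / 3"
  proof -
    have "(\<Sum>k<j. (real (Suc k))\<^sup>2) = (\<Sum>k<j. (a k)\<^sup>2)" by (simp add: a_def)
    also have "\<dots> \<le> (\<Sum>k<m. (a k)\<^sup>2)" using j by (intro sum_mono2) (auto simp: m_def)
    finally show ?thesis using sq[of j] by simp
  qed
  have Wpos: "W > 0"
  proof -
    have "0 < (real j) ^ 3 / 3" using j by simp
    with a2 have "0 < (\<Sum>k<m. (a k)\<^sup>2)" by (rule less_le_trans[rotated])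
    then show ?thesis unfolding W_def using N by (intro mult_pos_pos) auto
  qed
  have total: "(\<Sum>l<N. (cmod (A (\<theta> + of_int s * u l)))\<^sup>2) = W" if "s = 1 \<or> s = - 1" for \<theta> and s :: int
    unfolding A_def u_def W_def by (rule discrete_parseval[OF N(1,3) that])
  \<comment> \<open>Multiplying by \<open>1 - z\<close> raises the degree to \<open>m\<close>, still below \<open>N = m + 1\<close>, so Parseval applies again.\<close>
  have moment: "(\<Sum>l<N. (cmod (1 - cis (\<theta> + of_int s * u l)) * cmod (A (\<theta> + of_int s * u l)))\<^sup>2)
      \<le> real N * real N" if s: "s = 1 \<or> s = - 1" for \<theta> and s :: int
  proof -
    let ?b = "\<lambda>k. a k - (if k = 0 then 0 else a (k - 1))"
    have "(\<Sum>l<N. (cmod (1 - cis (\<theta> + of_int s * u l)) * cmod (A (\<theta> + of_int s * u l)))\<^sup>2)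
        = real N * (\<Sum>k<Suc m. (?b k)\<^sup>2)"
      unfolding A_def u_def norm_mult[symmetric] one_minus_cis_times_trig_sum[of a m, OF am]
      by (rule discrete_parseval[OF N(2,3) s])
    also have "(\<Sum>k<Suc m. (?b k)\<^sup>2) \<le> (\<Sum>k<Suc m. 1)"
    proof (rule sum_mono)
      fix k assume "k \<in> {..<Suc m}"
      then have "\<bar>?b k\<bar> \<le> 1" by (auto simp: a_def m_def of_nat_diff)
      then show "(?b k)\<^sup>2 \<le> 1" by (simp add: abs_square_le_1)
    qed
    also have "\<dots> = real N" using j by (simp add: m_def N_def)
    finally show ?thesis using N by (simp add: mult_left_mono)
  qed
  have one_side: "\<bar>\<Sum>l<N. (cmod (A (\<theta> + of_int s * u l)))\<^sup>2 * (f (cos (u l)) - f (cos \<theta>))\<bar>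
      \<le> 3 * \<Lambda> / real j * W" if s: "s = 1 \<or> s = - 1" for \<theta> and s :: int
  proof -
    let ?D = "\<lambda>l. cmod (A (\<theta> + of_int s * u l))" and ?c = "\<lambda>l. cmod (1 - cis (\<theta> + of_int s * u l))"
    have chord: "\<bar>cos (u l) - cos \<theta>\<bar> \<le> ?c l" for l
    proof -
      have "cis (\<theta> + of_int s * u l) * cis (- of_int s * u l) = cis \<theta>"
        by (simp add: cis_mult)
      then have "cis (- of_int s * u l) - cis \<theta> = (1 - cis (\<theta> + of_int s * u l)) * cis (- of_int s * u l)"
        by (simp add: algebra_simps)
      then have "cmod (cis (- of_int s * u l) - cis \<theta>) = ?c l" by (simp add: norm_mult)
      moreover have "\<bar>Re (cis (- of_int s * u l) - cis \<theta>)\<bar> \<le> cmod (cis (- of_int s * u l) - cis \<theta>)"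
        by (rule abs_Re_le_cmod)
      ultimately show ?thesis using s by auto
    qed
    have "\<bar>\<Sum>l<N. (?D l)\<^sup>2 * (f (cos (u l)) - f (cos \<theta>))\<bar> \<le> (\<Sum>l<N. (?D l)\<^sup>2 * (\<Lambda> * ?c l))"
    proof (rule order_trans[OF sum_abs sum_mono])
      fix l
      have "\<bar>f (cos (u l)) - f (cos \<theta>)\<bar> \<le> \<Lambda> * \<bar>cos (u l) - cos \<theta>\<bar>"
        by (rule f) (simp_all add: abs_le_iff cos_ge_minus_one minus_le_iff)
      also have "\<dots> \<le> \<Lambda> * ?c l" using chord \<Lambda> by (rule mult_left_mono)
      finally show "\<bar>(?D l)\<^sup>2 * (f (cos (u l)) - f (cos \<theta>))\<bar> \<le> (?D l)\<^sup>2 * (\<Lambda> * ?c l)"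
        by (simp add: abs_mult mult_left_mono)
    qed
    also have "\<dots> = \<Lambda> * (\<Sum>l<N. ?D l * (?c l * ?D l))"
      by (simp add: sum_distrib_left power2_eq_square mult_ac)
    also have "\<dots> \<le> \<Lambda> * (3 / real j * W)"
    proof (rule mult_left_mono[OF _ \<Lambda>])
      have "(\<Sum>l<N. ?D l * (?c l * ?D l))\<^sup>2 \<le> (\<Sum>l<N. (?D l)\<^sup>2) * (\<Sum>l<N. (?c l * ?D l)\<^sup>2)"
        by (rule Cauchy_Schwarz_ineq_sum)
      also have "\<dots> \<le> W * (real N * real N)"
        unfolding total[OF s] using moment[OF s] Wpos by (intro mult_left_mono) auto
      also have "\<dots> \<le> W * (9 / (real j)\<^sup>2 * W)"
      proof (rule mult_left_mono)
        have "real N * ((real j) ^ 3 / 3) \<le> W"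
          unfolding W_def using a2 by (rule mult_left_mono) simp
        then have "9 / (real j)\<^sup>2 * (real N * ((real j) ^ 3 / 3)) \<le> 9 / (real j)\<^sup>2 * W"
          by (rule mult_left_mono) simp
        moreover have "9 / (real j)\<^sup>2 * (real N * ((real j) ^ 3 / 3)) = 3 * real j * real N"
          using j by (simp add: power2_eq_square power3_eq_cube)
        moreover have "real N * real N \<le> 3 * real j * real N"
          by (intro mult_right_mono) (auto simp: N_def)
        ultimately show "real N * real N \<le> 9 / (real j)\<^sup>2 * W" by linarith
      qed (use Wpos in simp)
      also have "\<dots> = (3 / real j * W)\<^sup>2" by (simp add: power2_eq_square)
      finally show "(\<Sum>l<N. ?D l * (?c l * ?D l)) \<le> 3 / real j * W"
        by (rule power2_le_imp_le) (use Wpos in simp)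
    qed
    finally show ?thesis by (simp add: mult_ac)
  qed
  obtain T :: "nat \<Rightarrow> real poly" where T: "\<And>d. degree (T d) \<le> d" "\<And>d t. poly (T d) (cos t) = cos (real d * t)"
    using chebyshev_poly_ex by metis
  define e where "e k k' = nat \<bar>int k - int k'\<bar>" for k k' :: nat
  have e: "cos (real (e k k') * t) = cos ((real k - real k') * t)" for k k' t
  proof -
    have "real (e k k') = \<bar>real k - real k'\<bar>" by (simp add: e_def)
    then have "real (e k k') = real k - real k' \<or> real (e k k') = - (real k - real k')" by linarith
    then show ?thesis by (metis cos_minus mult_minus_left)
  qed
  define P where "P = (\<Sum>l<N. \<Sum>k<m. \<Sum>k'<m.
    smult (f (cos (u l)) / W * (a k * a k' * cos ((real k - real k') * u l))) (T (e k k')))"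
  have "degree P \<le> 2 * (j - 1)"
    unfolding P_def
  proof (intro degree_sum_le finite_lessThan)
    fix k k' assume "k \<in> {..<m}" "k' \<in> {..<m}"
    then have "e k k' \<le> 2 * (j - 1)" by (auto simp: e_def m_def)
    then show "degree (smult c (T (e k k'))) \<le> 2 * (j - 1)" for c
      using T(1)[of "e k k'"] order_trans[OF degree_smult_le] by fastforce
  qed
  moreover have "\<bar>f x - poly P x\<bar> \<le> 3 * \<Lambda> / real j" if x: "\<bar>x\<bar> \<le> 1" for x
  proof -
    define \<theta> where "\<theta> = arccos x"
    have x\<theta>: "x = cos \<theta>" using x by (simp add: \<theta>_def cos_arccos_abs)
    let ?D = "\<lambda>s l. (cmod (A (\<theta> + of_int s * u l)))\<^sup>2"
    have sym: "(\<Sum>k<m. \<Sum>k'<m. a k * a k' * cos ((real k - real k') * u l) * cos ((real k - real k') * \<theta>))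
        = (?D 1 l + ?D (- 1) l) / 2" for l
    proof -
      have prod: "cos (\<kappa> * u l) * cos (\<kappa> * \<theta>)
          = (cos (\<kappa> * (\<theta> + of_int 1 * u l)) + cos (\<kappa> * (\<theta> + of_int (- 1) * u l))) / 2" for \<kappa>
        by (simp add: distrib_left right_diff_distrib cos_add cos_diff)
      show ?thesis
        unfolding A_def norm_square_trig_sum mult.assoc prod
        by (simp only: sum.distrib[symmetric] sum_divide_distrib distrib_left add_divide_distrib times_divide_eq_right)
    qed
    have "poly P x = (\<Sum>l<N. f (cos (u l)) / W * (\<Sum>k<m. \<Sum>k'<m.
        a k * a k' * cos ((real k - real k') * u l) * cos ((real k - real k') * \<theta>)))"
      unfolding P_def poly_sum x\<theta> poly_smult T e sum_distrib_left by (simp add: mult_ac)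
    also have "\<dots> = (\<Sum>l<N. f (cos (u l)) / W * ((?D 1 l + ?D (- 1) l) / 2))"
      by (simp only: sym)
    finally have Px: "poly P x = (\<Sum>l<N. f (cos (u l)) / W * ((?D 1 l + ?D (- 1) l) / 2))" .
    have "(\<Sum>l<N. ?D 1 l * (f (cos (u l)) - f (cos \<theta>))) + (\<Sum>l<N. ?D (- 1) l * (f (cos (u l)) - f (cos \<theta>)))
        = 2 * W * poly P x - (\<Sum>l<N. ?D 1 l) * f x - (\<Sum>l<N. ?D (- 1) l) * f x"
    proof -
      have "2 * W * poly P x = (\<Sum>l<N. f (cos (u l)) * (?D 1 l + ?D (- 1) l))"
        unfolding Px sum_distrib_left using Wpos by (intro sum.cong) simp_all
      also have "\<dots> = (\<Sum>l<N. ?D 1 l * f (cos (u l))) + (\<Sum>l<N. ?D (- 1) l * f (cos (u l)))"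
        unfolding sum.distrib[symmetric] by (intro sum.cong) (simp_all add: algebra_simps)
      finally show ?thesis
        unfolding right_diff_distrib sum_subtractf sum_distrib_right x\<theta> by simp
    qed
    also have "\<dots> = 2 * W * (poly P x - f x)"
      using total[of 1 \<theta>] total[of "- 1" \<theta>] by (simp add: algebra_simps)
    finally have "\<bar>2 * W * (poly P x - f x)\<bar> \<le> 2 * (3 * \<Lambda> / real j * W)"
      using one_side[of 1 \<theta>] one_side[of "- 1" \<theta>] by linarith
    then have "(2 * W) * \<bar>poly P x - f x\<bar> \<le> (2 * W) * (3 * \<Lambda> / real j)"
      using Wpos by (simp only: abs_mult) (simp add: mult_ac)
    then have "\<bar>poly P x - f x\<bar> \<le> 3 * \<Lambda> / real j"
      using Wpos by (subst (asm) mult_le_cancel_left_pos) auto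
    then show ?thesis by (simp only: abs_minus_commute)
  qed
  ultimately show ?thesis by blast
qed

section \<open>Approximating the absolute value; existence of best approximations\<close>

lemma even_part_poly:
  fixes P :: "real poly"
  assumes "degree P \<le> 2 * d + 1"
  shows "\<exists>Q. degree Q \<le> d \<and> (\<forall>x. poly Q (x\<^sup>2) = (poly P x + poly P (- x)) / 2)"
  using assms
proof (induction d arbitrary: P)
  case 0
  obtain a P1 where P: "P = pCons a P1" by (cases P)
  then have "degree P1 = 0" using 0 by (auto split: if_splits)
  then obtain b where "P1 = [:b:]" using degree_eq_zeroE by blast
  then show ?case using P by (intro exI[of _ "[:a:]"]) simp
next
  case (Suc d)
  obtain a P1 where P: "P = pCons a P1" by (cases P)
  obtain b P2 where P1: "P1 = pCons b P2" by (cases P1)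
  have "degree P2 \<le> 2 * d + 1"
    using Suc.prems P P1 by (auto split: if_splits)
  then obtain Q where Q: "degree Q \<le> d" "\<forall>x. poly Q (x\<^sup>2) = (poly P2 x + poly P2 (- x)) / 2"
    using Suc.IH by blast
  show ?case
  proof (intro exI[of _ "pCons a Q"] conjI allI)
    show "degree (pCons a Q) \<le> Suc d" using Q(1) by (auto intro: order_trans[OF degree_pCons_le])
    show "poly (pCons a Q) (x\<^sup>2) = (poly P x + poly P (- x)) / 2" for x
      using Q(2) by (simp add: P P1 field_simps power2_eq_square)
  qed
qed

lemma abs_approx_centered:
  fixes q r :: real
  assumes r: "r > 0" and K: "K \<ge> 1"
  shows "\<exists>P. degree P \<le> K \<and> (\<forall>z\<in>{q - r..q + r}. \<bar>\<bar>z - q\<bar> - poly P z\<bar> \<le> 6 * r / real K)"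
proof -
  define j where "j = K div 2 + 1"
  have j: "j \<ge> 1" "2 * (j - 1) \<le> K" "real K \<le> 2 * real j"
    by (auto simp: j_def)
  obtain P where P: "degree P \<le> 2 * (j - 1)" "\<And>x. \<bar>x\<bar> \<le> 1 \<Longrightarrow> \<bar>\<bar>x\<bar> - poly P x\<bar> \<le> 3 * 1 / real j"
    using jackson_lipschitz[of j 1 abs] j(1) by (force simp: abs_triangle_ineq3)
  define R where "R = smult r (P \<circ>\<^sub>p [:- q / r, 1 / r:])"
  have "degree R \<le> K"
    using P(1) j(2) r by (simp add: R_def degree_pcompose)
  moreover have "\<bar>\<bar>z - q\<bar> - poly R z\<bar> \<le> 6 * r / real K" if z: "z \<in> {q - r..q + r}" for z
  proof -
    define x where "x = (z - q) / r"
    have x: "\<bar>x\<bar> \<le> 1" using z r by (auto simp: x_def abs_le_iff field_simps)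
    have "poly R z = r * poly P x" by (simp add: R_def poly_pcompose x_def diff_divide_distrib)
    moreover have "\<bar>z - q\<bar> = r * \<bar>x\<bar>" using r by (simp add: x_def abs_mult abs_divide)
    ultimately have "\<bar>\<bar>z - q\<bar> - poly R z\<bar> = r * \<bar>\<bar>x\<bar> - poly P x\<bar>"
      using r by (simp add: right_diff_distrib[symmetric] abs_mult)
    also have "\<dots> \<le> r * (3 * 1 / real j)" using P(2)[OF x] r by (intro mult_left_mono) auto
    also have "\<dots> \<le> r * (6 / real K)"
      using j K r by (intro mult_left_mono) (auto simp: field_simps)
    finally show ?thesis by (simp add: mult.commute)
  qed
  ultimately show ?thesis by blast
qed

text \<open>
  On \<open>{0..L}\<close> put \<open>x = L * s\<^sup>2\<close> with \<open>\<bar>s\<bar> \<le> 1\<close>. The convex kink is the line \<open>z - q\<close> plus twice the positive part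
  of \<open>q - z\<close>, and the latter becomes \<open>L * (b\<^sup>2 - s\<^sup>2)\<close>, cut off at \<open>0\<close>, with \<open>b = sqrt (q / L)\<close>. Its slope is
  at most \<open>2 * L * b = 2 * sqrt (q * L)\<close>, small when \<open>q\<close> is close to \<open>0\<close>. The approximation in \<open>s\<close> may
  have degree \<open>2 * K\<close>, since its even part is a polynomial of degree \<open>K\<close> in \<open>s\<^sup>2\<close>.
\<close>

lemma abs_approx_boundary:
  fixes q L :: real
  assumes q: "0 \<le> q" "q \<le> L" and L: "L > 0" and K: "K \<ge> 1"
  shows "\<exists>P. degree P \<le> K \<and> (\<forall>z\<in>{0..L}. \<bar>\<bar>z - q\<bar> - poly P z\<bar> \<le> 12 * sqrt (q * L) / real K)"
proof -
  define b where "b = sqrt (q / L)"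
  define f where "f s = 2 * L * (b\<^sup>2 - (min \<bar>s\<bar> b)\<^sup>2)" for s :: real
  have b: "0 \<le> b" "b\<^sup>2 = q / L" using q L by (auto simp: b_def)
  have Lb: "L * b = sqrt (q * L)"
  proof (rule real_sqrt_unique[symmetric])
    show "(L * b)\<^sup>2 = q * L" unfolding power_mult_distrib b(2) using L by (simp add: power2_eq_square)
  qed (use b L in auto)
  have lip: "\<bar>f x - f y\<bar> \<le> 4 * (L * b) * \<bar>x - y\<bar>" for x y
  proof -
    let ?x = "min \<bar>x\<bar> b" and ?y = "min \<bar>y\<bar> b"
    have "f x - f y = 2 * L * ((?y - ?x) * (?y + ?x))"
      by (simp add: f_def power2_eq_square algebra_simps)
    then have "\<bar>f x - f y\<bar> = 2 * L * (\<bar>?y - ?x\<bar> * \<bar>?y + ?x\<bar>)"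
      using L by (simp add: abs_mult)
    also have "\<dots> \<le> 2 * L * (\<bar>x - y\<bar> * (2 * b))"
      using L b by (intro mult_left_mono mult_mono) auto
    finally show ?thesis by (simp add: mult_ac)
  qed
  obtain P where P: "degree P \<le> 2 * (K + 1 - 1)"
      "\<And>x. \<bar>x\<bar> \<le> 1 \<Longrightarrow> \<bar>f x - poly P x\<bar> \<le> 3 * (4 * (L * b)) / real (K + 1)"
    using jackson_lipschitz[of "K + 1" "4 * (L * b)" f] lip L b by auto
  obtain Q where Q: "degree Q \<le> K" "\<And>x. poly Q (x\<^sup>2) = (poly P x + poly P (- x)) / 2"
    using even_part_poly[of P K] P(1) by auto
  define R where "R = [:- q, 1:] + Q \<circ>\<^sub>p [:0, 1 / L:]"
  have "degree R \<le> K"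
    unfolding R_def using Q(1) K L by (intro degree_add_le) (auto simp: degree_pcompose)
  moreover have "\<bar>\<bar>z - q\<bar> - poly R z\<bar> \<le> 12 * sqrt (q * L) / real K" if z: "z \<in> {0..L}" for z
  proof -
    define s where "s = sqrt (z / L)"
    have s: "0 \<le> s" "s \<le> 1" "s\<^sup>2 = z / L" using z L by (auto simp: s_def)
    have "\<bar>z - q\<bar> = (z - q) + f s"
    proof (cases "z \<le> q")
      case True
      then have "s \<le> b" using L by (simp add: s_def b_def divide_right_mono)
      then have "f s = 2 * (q - z)" using s b L by (simp add: f_def right_diff_distrib)
      then show ?thesis using True by simp
    next
      case False
      then have "b \<le> s" using L by (simp add: s_def b_def divide_right_mono)
      then have "f s = 0" using s b by (simp add: f_def)
      then show ?thesis using False by simp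
    qed
    moreover have "poly R z = (z - q) + (poly P s + poly P (- s)) / 2"
      using Q(2)[of s] s(3) by (simp add: R_def poly_pcompose)
    moreover have "f (- s) = f s" by (simp add: f_def)
    moreover have "\<bar>f s - poly P s\<bar> \<le> 3 * (4 * (L * b)) / real (K + 1)"
      "\<bar>f (- s) - poly P (- s)\<bar> \<le> 3 * (4 * (L * b)) / real (K + 1)"
      using s by (intro P(2); simp)+
    ultimately have "\<bar>\<bar>z - q\<bar> - poly R z\<bar> \<le> 3 * (4 * (L * b)) / real (K + 1)"
      by (simp only:) argo
    also have "\<dots> \<le> 3 * (4 * (L * b)) / real K"
      using K L b by (intro divide_left_mono) auto
    finally show ?thesis by (simp add: Lb)
  qed
  ultimately show ?thesis by blast
qed

lemma bounded_coordinates_convergent_subseq: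
  fixes c :: "nat \<Rightarrow> nat \<Rightarrow> real"
  assumes "\<And>m k. k < d \<Longrightarrow> \<bar>c m k\<bar> \<le> B"
  shows "\<exists>\<rho>. strict_mono \<rho> \<and> (\<forall>k<d. convergent (\<lambda>m. c (\<rho> m) k))"
  using assms
proof (induction d)
  case 0
  show ?case by (intro exI[of _ id]) (simp add: strict_mono_id)
next
  case (Suc d)
  then obtain \<rho> where \<rho>: "strict_mono \<rho>" "\<forall>k<d. convergent (\<lambda>m. c (\<rho> m) k)" by fastforce
  have "bounded (range (\<lambda>m. c (\<rho> m) d))"
    using Suc.prems by (intro boundedI[where B = B]) auto
  then obtain l \<sigma> where \<sigma>: "strict_mono \<sigma>" "((\<lambda>m. c (\<rho> m) d) \<circ> \<sigma>) \<longlonglongrightarrow> l"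
    using bounded_imp_convergent_subsequence by blast
  show ?case
  proof (intro exI[of _ "\<rho> \<circ> \<sigma>"] conjI allI impI)
    show "strict_mono (\<rho> \<circ> \<sigma>)" using \<rho>(1) \<sigma>(1) by (rule strict_mono_o)
    fix k assume "k < Suc d"
    then consider "k < d" | "k = d" by linarith
    then show "convergent (\<lambda>m. c ((\<rho> \<circ> \<sigma>) m) k)"
    proof cases
      case 1
      then show ?thesis using \<rho>(2) convergent_subseq_convergent[OF _ \<sigma>(1), of "\<lambda>m. c (\<rho> m) k"]
        by (simp add: o_def)
    qed (use \<sigma>(2) in \<open>auto simp: o_def convergent_def\<close>)
  qed
qed

text \<open>
  The polynomials of a minimizing sequence are uniformly bounded on the interval, hence have
  bounded coefficients by \<open>abs_coeff_le_on_unit_interval\<close>. A subsequence converges coefficientwise, and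
  pointwise limits preserve the bound by the infimum. Existence is needed because \<open>best_poly\<close> is a
  choice among minimizers, which carries no information if there are none.
\<close>

lemma best_approximation_ex:
  fixes f :: "real \<Rightarrow> real"
  assumes uv: "u < v" and cont: "continuous_on {u..v} f"
  shows "\<exists>P. is_arg_min (\<lambda>P. SUP z\<in>{u..v}. \<bar>f z - poly P z\<bar>) (\<lambda>P. degree P \<le> d) P"
proof -
  define E where "E P = (SUP z\<in>{u..v}. \<bar>f z - poly P z\<bar>)" for P
  have bdd: "bdd_above ((\<lambda>z. \<bar>f z - poly P z\<bar>) ` {u..v})" for P
  proof -
    have "continuous_on {u..v} (\<lambda>z. \<bar>f z - poly P z\<bar>)" by (intro continuous_intros cont)
    then show ?thesis
      by (intro bounded_imp_bdd_above compact_imp_bounded compact_continuous_image) auto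
  qed
  have le_E: "\<bar>f z - poly P z\<bar> \<le> E P" if "z \<in> {u..v}" for P z
    unfolding E_def by (rule cSUP_upper[OF that bdd])
  have E0: "0 \<le> E P" for P using le_E[of u P] uv by (meson abs_ge_zero atLeastAtMost_iff less_imp_le order_refl order_trans)
  define I where "I = (INF P\<in>{P. degree P \<le> d}. E P)"
  have bddI: "bdd_below (E ` {P. degree P \<le> d})" using E0 by (intro bdd_belowI[of _ 0]) auto
  have "\<exists>P. degree P \<le> d \<and> E P < I + 1 / real (Suc m)" for m
  proof -
    have "I < I + 1 / real (Suc m)" by simp
    then show ?thesis unfolding I_def
      by (subst (asm) cINF_less_iff[OF _ bddI]) (auto intro: exI[of _ 0])
  qed
  then obtain P where P: "\<And>m. degree (P m) \<le> d" "\<And>m. E (P m) < I + 1 / real (Suc m)" by metis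
  define g where "g m = P m \<circ>\<^sub>p [:u, v - u:]" for m
  obtain F where F: "\<And>z. z \<in> {u..v} \<Longrightarrow> \<bar>f z\<bar> \<le> F"
    using compact_imp_bounded[OF compact_continuous_image[OF cont]] unfolding bounded_iff
    by (auto simp del: atLeastAtMost_iff)
  have "\<bar>coeff (g m) k\<bar> \<le> (F + I + 1) * 24 ^ d" for m k
  proof (rule abs_coeff_le_on_unit_interval)
    show "degree (g m) \<le> d" using P(1) by (simp add: g_def degree_pcompose)
    fix y :: real assume y: "0 \<le> y" "y \<le> 1"
    have "(v - u) * y \<le> v - u" "0 \<le> (v - u) * y" using uv y by (auto intro: mult_left_le)
    then have z: "u + (v - u) * y \<in> {u..v}" by auto
    have "1 / real (Suc m) \<le> 1" by simp
    then have "\<bar>poly (P m) (u + (v - u) * y)\<bar> \<le> F + I + 1"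
      using le_E[OF z, of "P m"] F[OF z] P(2)[of m] by linarith
    then show "\<bar>poly (g m) y\<bar> \<le> F + I + 1" by (simp add: g_def poly_pcompose mult.commute)
  qed
  then obtain \<rho> where \<rho>: "strict_mono \<rho>" "\<forall>k<Suc d. convergent (\<lambda>m. coeff (g (\<rho> m)) k)"
    using bounded_coordinates_convergent_subseq[of "Suc d" "\<lambda>m k. coeff (g m) k"] by blast
  then obtain l where l: "\<And>k. k \<le> d \<Longrightarrow> (\<lambda>m. coeff (g (\<rho> m)) k) \<longlonglongrightarrow> l k"
    unfolding convergent_def less_Suc_eq_le by metis
  define g0 where "g0 = (\<Sum>k\<le>d. monom (l k) k)"
  define P0 where "P0 = g0 \<circ>\<^sub>p [:- u / (v - u), 1 / (v - u):]"
  have "degree g0 \<le> d"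
    unfolding g0_def by (intro degree_sum_le) (auto intro: order_trans[OF degree_monom_le])
  then have deg0: "degree P0 \<le> d" by (simp add: P0_def degree_pcompose)
  have lim: "(\<lambda>m. poly (P (\<rho> m)) z) \<longlonglongrightarrow> poly P0 z" for z
  proof -
    define y where "y = (z - u) / (v - u)"
    have zy: "z = u + (v - u) * y" using uv by (simp add: y_def)
    have "(\<lambda>m. \<Sum>k\<le>d. coeff (g (\<rho> m)) k * y ^ k) \<longlonglongrightarrow> (\<Sum>k\<le>d. l k * y ^ k)"
      by (intro tendsto_intros l) auto
    moreover have "(\<Sum>k\<le>d. coeff (g (\<rho> m)) k * y ^ k) = poly (P (\<rho> m)) z" for m
    proof -
      have "degree (g (\<rho> m)) \<le> d" using P(1) by (simp add: g_def degree_pcompose)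
      then have "(\<Sum>k\<le>d. coeff (g (\<rho> m)) k * y ^ k) = poly (g (\<rho> m)) y"
        unfolding poly_altdef by (intro sum.mono_neutral_right) (auto simp: coeff_eq_0)
      also have "\<dots> = poly (P (\<rho> m)) z" by (simp add: g_def poly_pcompose zy mult.commute)
      finally show ?thesis .
    qed
    moreover have "(\<Sum>k\<le>d. l k * y ^ k) = poly P0 z"
      by (simp add: P0_def g0_def poly_pcompose poly_sum poly_monom y_def diff_divide_distrib)
    ultimately show ?thesis by simp
  qed
  have "E P0 \<le> I" unfolding E_def
  proof (rule cSUP_least)
    fix z assume z: "z \<in> {u..v}"
    show "\<bar>f z - poly P0 z\<bar> \<le> I"
    proof (rule LIMSEQ_le)
      show "(\<lambda>m. \<bar>f z - poly (P (\<rho> m)) z\<bar>) \<longlonglongrightarrow> \<bar>f z - poly P0 z\<bar>"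
        by (intro tendsto_intros lim)
      have "(\<lambda>m. I + 1 / real (Suc m)) \<longlonglongrightarrow> I + 0"
        by (intro tendsto_intros LIMSEQ_Suc[OF lim_1_over_n])
      then show "(\<lambda>m. I + 1 / real (Suc (\<rho> m))) \<longlonglongrightarrow> I"
        using LIMSEQ_subseq_LIMSEQ[OF _ \<rho>(1), of "\<lambda>m. I + 1 / real (Suc m)" I] by (simp add: o_def)
      show "\<exists>N. \<forall>m\<ge>N. \<bar>f z - poly (P (\<rho> m)) z\<bar> \<le> I + 1 / real (Suc (\<rho> m))"
        using le_E[OF z] P(2) by (meson less_imp_le order_trans)
    qed
  qed (use uv in auto)
  moreover have "I \<le> E R" if "degree R \<le> d" for R
    unfolding I_def using that by (intro cINF_lower[OF bddI]) auto
  ultimately show ?thesis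
    using deg0 unfolding is_arg_min_def E_def[symmetric] by (intro exI[of _ P0]) (auto simp: not_less intro: order_trans)
qed

section \<open>The best polynomial and the localization test\<close>

text \<open>
  Both cases of the definition have center \<open>a = max \<delta> q\<close> and half-width \<open>sqrt (\<delta> * a)\<close>: for
  \<open>q \<le> \<delta>\<close> these are both \<open>\<delta>\<close>. The two regimes can thus be treated alike.
\<close>

lemma U_int_eq:
  assumes "n > 1" "c1 > 0" "q \<ge> 0"
  defines "\<delta> \<equiv> c1 * ln n / n"
  defines "a \<equiv> max \<delta> q"
  shows "U_int n c1 q = {a - sqrt (\<delta> * a)..a + sqrt (\<delta> * a)}"
proof -
  have "\<delta> > 0" using assms by (simp add: \<delta>_def)
  moreover have "c1 * q * ln n / n = \<delta> * q" "2 * c1 * ln n / n = 2 * \<delta>" by (simp_all add: \<delta>_def)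
  ultimately show ?thesis
    by (simp add: U_int_def \<delta>_def[symmetric] a_def max_def)
qed

lemma real_degree_le_iff: "K \<ge> 0 \<Longrightarrow> real m \<le> K \<longleftrightarrow> m \<le> nat \<lfloor>K\<rfloor>"
  by (simp add: le_nat_iff le_floor_iff)

lemma best_poly_optimal:
  assumes n: "n > 1" "c1 > 0" "q \<ge> 0" and K: "K \<ge> 0"
  shows "degree (best_poly n c1 K q) \<le> nat \<lfloor>K\<rfloor>"
    and "\<lbrakk>degree R \<le> nat \<lfloor>K\<rfloor>; \<And>z. z \<in> U_int n c1 q \<Longrightarrow> \<bar>\<bar>z - q\<bar> - poly R z\<bar> \<le> e; z \<in> U_int n c1 q\<rbrakk>
      \<Longrightarrow> \<bar>\<bar>z - q\<bar> - poly (best_poly n c1 K q) z\<bar> \<le> e"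
proof -
  define \<delta> where "\<delta> = c1 * ln n / n"
  define a where "a = max \<delta> q"
  define u where "u = a - sqrt (\<delta> * a)"
  define v where "v = a + sqrt (\<delta> * a)"
  have \<delta>: "\<delta> > 0" using n by (simp add: \<delta>_def)
  then have "sqrt (\<delta> * a) > 0" by (simp add: a_def)
  then have uv: "u < v" by (simp add: u_def v_def)
  have U: "U_int n c1 q = {u..v}"
    using U_int_eq[OF n] by (simp add: u_def v_def a_def \<delta>_def)
  let ?E = "\<lambda>P. SUP z\<in>{u..v}. \<bar>\<bar>z - q\<bar> - poly P z\<bar>"
  have "\<exists>P. is_arg_min ?E (\<lambda>P. degree P \<le> nat \<lfloor>K\<rfloor>) P"
    by (rule best_approximation_ex[OF uv]) (intro continuous_intros)
  then have am: "is_arg_min ?E (\<lambda>P. degree P \<le> nat \<lfloor>K\<rfloor>) (best_poly n c1 K q)"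
    unfolding best_poly_def U real_degree_le_iff[OF K] arg_min_def by (rule someI_ex)
  then show "degree (best_poly n c1 K q) \<le> nat \<lfloor>K\<rfloor>" by (simp add: is_arg_min_def)
  assume R: "degree R \<le> nat \<lfloor>K\<rfloor>" and e: "\<And>z. z \<in> U_int n c1 q \<Longrightarrow> \<bar>\<bar>z - q\<bar> - poly R z\<bar> \<le> e"
    and z: "z \<in> U_int n c1 q"
  have bdd: "bdd_above ((\<lambda>z. \<bar>\<bar>z - q\<bar> - poly P z\<bar>) ` {u..v})" for P
    by (intro bounded_imp_bdd_above compact_imp_bounded compact_continuous_image continuous_intros) auto
  have "\<bar>\<bar>z - q\<bar> - poly (best_poly n c1 K q) z\<bar> \<le> ?E (best_poly n c1 K q)"
    using z unfolding U by (rule cSUP_upper[OF _ bdd])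
  also have "\<dots> \<le> ?E R" using am R by (auto simp: is_arg_min_def not_less)
  also have "\<dots> \<le> e" using e uv unfolding U by (intro cSUP_least) auto
  finally show "\<bar>\<bar>z - q\<bar> - poly (best_poly n c1 K q) z\<bar> \<le> e" .
qed

text \<open>
  The first bound compares with \<open>x - q\<close>, which is off by twice the positive part of \<open>q - z\<close>; it wins for tiny
  \<open>q\<close>. The third says that the best polynomial is close to
  \<open>x - q\<close>, which makes its estimator's variance proportional to \<open>q\<close> and summable over arbitrarily
  many symbols.
\<close>

lemma best_poly_error:
  assumes n: "n > 1" "c1 > 0" "q \<ge> 0" and K: "K \<ge> 1" and z: "z \<in> U_int n c1 q"
  defines "\<delta> \<equiv> c1 * ln n / n"
  shows "\<bar>\<bar>z - q\<bar> - poly (best_poly n c1 K q) z\<bar> \<le> 2 * min q (sqrt (\<delta> * q))" (is ?linear)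
    and "\<bar>\<bar>z - q\<bar> - poly (best_poly n c1 K q) z\<bar> \<le> 48 * sqrt (\<delta> * q) / K" (is ?jackson)
    and "\<bar>poly (best_poly n c1 K q - [:- q, 1:]) z\<bar> \<le> 4 * min q (sqrt (\<delta> * q))" (is ?diff)
proof -
  define a where "a = max \<delta> q"
  define d where "d = nat \<lfloor>K\<rfloor>"
  have \<delta>: "\<delta> > 0" using n by (simp add: \<delta>_def)
  have "1 \<le> \<lfloor>K\<rfloor>" using K by (simp add: le_floor_iff)
  then have d: "d \<ge> 1" "K \<le> 2 * real d" unfolding d_def by linarith+
  have U: "U_int n c1 q = {a - sqrt (\<delta> * a)..a + sqrt (\<delta> * a)}"
    using U_int_eq[OF n] by (simp add: a_def \<delta>_def)
  have lin: "\<bar>\<bar>z - q\<bar> - poly [:- q, 1:] z\<bar> \<le> 2 * min q (sqrt (\<delta> * q))" if "z \<in> U_int n c1 q" for z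
  proof (cases "q \<le> \<delta>")
    case True
    then have "a = \<delta>" "q \<le> sqrt (\<delta> * q)"
      using n \<delta> by (auto simp: a_def intro!: real_le_rsqrt simp: power2_eq_square mult_right_mono)
    then show ?thesis using that \<delta> n by (auto simp: U)
  next
    case False
    then have "a = q" "sqrt (\<delta> * q) \<le> q"
      using n \<delta> by (auto simp: a_def intro!: real_le_lsqrt simp: power2_eq_square mult_right_mono)
    then show ?thesis using that \<delta> n by (auto simp: U)
  qed
  show linear: ?linear
    by (rule best_poly_optimal(2)[OF n _ _ lin z]) (use K d in \<open>auto simp: d_def\<close>)
  show ?diff
    using linear lin[OF z] by simp
  have "\<exists>R. degree R \<le> d \<and> (\<forall>z\<in>U_int n c1 q. \<bar>\<bar>z - q\<bar> - poly R z\<bar> \<le> 24 * sqrt (\<delta> * q) / real d)"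
  proof (cases "q \<le> \<delta>")
    case True
    then have "U_int n c1 q = {0..2 * \<delta>}" using \<delta> by (simp add: U a_def max_def)
    moreover have "12 * sqrt (q * (2 * \<delta>)) / real d \<le> 24 * sqrt (\<delta> * q) / real d"
    proof (rule divide_right_mono)
      have "sqrt (q * (2 * \<delta>)) \<le> sqrt (4 * (\<delta> * q))" using n \<delta> by simp
      also have "\<dots> = 2 * sqrt (\<delta> * q)" by (simp add: real_sqrt_mult)
      finally show "12 * sqrt (q * (2 * \<delta>)) \<le> 24 * sqrt (\<delta> * q)" by simp
    qed simp
    ultimately show ?thesis
      using abs_approx_boundary[of q "2 * \<delta>" d] True n \<delta> d(1) by (auto intro: order_trans)
  next
    case False
    then have "a = q" "sqrt (\<delta> * q) > 0" using \<delta> by (auto simp: a_def)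
    moreover have "6 * sqrt (\<delta> * q) / real d \<le> 24 * sqrt (\<delta> * q) / real d"
      using n \<delta> by (intro divide_right_mono) auto
    ultimately show ?thesis
      using abs_approx_centered[of "sqrt (\<delta> * q)" d q] d(1) unfolding U by (auto intro: order_trans)
  qed
  then obtain R where R: "degree R \<le> d" "\<And>z. z \<in> U_int n c1 q \<Longrightarrow> \<bar>\<bar>z - q\<bar> - poly R z\<bar> \<le> 24 * sqrt (\<delta> * q) / real d"
    by blast
  have "\<bar>\<bar>z - q\<bar> - poly (best_poly n c1 K q) z\<bar> \<le> 24 * sqrt (\<delta> * q) / real d"
    by (rule best_poly_optimal(2)[OF n _ _ R(2) z]) (use K R(1) in \<open>auto simp: d_def\<close>)
  also have "\<dots> = 48 * sqrt (\<delta> * q) / (2 * real d)" by simp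
  also have "\<dots> \<le> 48 * sqrt (\<delta> * q) / K"
    using d K n \<delta> by (intro divide_left_mono) auto
  finally show ?jackson .
qed

lemma above_set_interval: "lo \<le> hi \<Longrightarrow> above_set x {lo..hi} \<longleftrightarrow> hi < x"
  and below_set_interval: "lo \<le> hi \<Longrightarrow> below_set x {lo..hi} \<longleftrightarrow> x < lo"
  by (auto simp: above_set_def below_set_def)

text \<open>
  With \<open>c3 = b\<close> and \<open>c1 = 16 * b\<close> the half-widths of \<open>U\<close> and \<open>U1\<close> are in ratio \<open>4\<close> for large \<open>q\<close>, so both the
  margin from \<open>q\<close> to the boundary of \<open>U1\<close> and that from \<open>U1\<close> to the boundary of \<open>U\<close> are of the order of
  \<open>sqrt (b * ln n)\<close> standard deviations. The smallest exponent, \<open>b / 64\<close>, arises for \<open>q\<close> at most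
  \<open>16 * b * ln n / n\<close>, where the upper margin of \<open>U1\<close> is only \<open>b * ln n\<close> counts against a rate of up to
  \<open>16 * b * ln n\<close>.
\<close>

lemma poisson_tails:
  fixes b n q p :: real
  assumes n: "n > 1" and b: "b > 0" and q: "q \<ge> 0" and p: "p \<ge> 0"
  defines "A \<equiv> poisson0_pmf (n * p)" and "U1 \<equiv> U1_int n (16 * b) b q" and "\<kappa> \<equiv> exp (- (b * ln n / 64))"
  shows "p \<le> q \<Longrightarrow> measure_pmf.prob A {k. above_set (real k / n) U1} \<le> \<kappa>" (is "_ \<Longrightarrow> ?T1")
    and "q \<le> p \<Longrightarrow> measure_pmf.prob A {k. below_set (real k / n) U1} \<le> \<kappa>" (is "_ \<Longrightarrow> ?T2")
    and "above_set p (U_int n (16 * b) q) \<Longrightarrow> measure_pmf.prob A {k. \<not> above_set (real k / n) U1} \<le> \<kappa>" (is "_ \<Longrightarrow> ?T3")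
    and "below_set p (U_int n (16 * b) q) \<Longrightarrow> measure_pmf.prob A {k. \<not> below_set (real k / n) U1} \<le> \<kappa>" (is "_ \<Longrightarrow> ?T4")
proof -
  define l where "l = ln n"
  define \<sigma> where "\<sigma> = sqrt (b * q * l * n)"
  have l: "l > 0" and n0: "n > 0" using n by (auto simp: l_def)
  have bl: "b * l > 0" using b l by simp
  have np: "n * p \<ge> 0" using n0 p by simp
  have \<sigma>2: "\<sigma>\<^sup>2 = b * l * (n * q)" "\<sigma> \<ge> 0" using b q l n0 by (auto simp: \<sigma>_def)
  have sqrt1: "sqrt (b * q * ln n / n) = \<sigma> / n"
  proof -
    have "b * q * ln n / n = b * q * l * n / n\<^sup>2" using n0 by (simp add: l_def power2_eq_square)
    then show ?thesis using n0 by (simp add: \<sigma>_def real_sqrt_divide)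
  qed
  have sqrt16: "sqrt (16 * b * q * ln n / n) = 4 * \<sigma> / n"
  proof -
    have "16 * b * q * ln n / n = 16 * (b * q * ln n / n)" by simp
    then show ?thesis using sqrt1 by (simp only: real_sqrt_mult) simp
  qed
  have big: "4 * \<sigma> \<le> n * q" "n * q > 0" if "\<not> q \<le> 16 * b * ln n / n"
  proof -
    have *: "16 * b * l < n * q" using that n0 by (simp add: l_def field_simps)
    then show "n * q > 0" using bl by simp
    then have "16 * (b * l) * (n * q) \<le> (n * q) * (n * q)" using * by (intro mult_right_mono) auto
    then have "(4 * \<sigma>)\<^sup>2 \<le> (n * q)\<^sup>2"
      unfolding power_mult_distrib \<sigma>2(1) by (simp add: power2_eq_square mult_ac)
    then show "4 * \<sigma> \<le> n * q" by (rule power2_le_imp_le) (use n0 q in simp)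
  qed
  have big_exp: "exp (- (c * \<sigma>\<^sup>2 / (4 * (n * q)))) \<le> \<kappa>" if "\<not> q \<le> 16 * b * ln n / n" "c \<ge> 1" for c
  proof -
    have "c * (b * l * x) / (4 * x) = c * (b * l / 4)" if "x > 0" for x using that by simp
    then have "c * \<sigma>\<^sup>2 / (4 * (n * q)) = c * (b * l / 4)"
      unfolding \<sigma>2(1) using big(2)[OF that(1)] by blast
    moreover have "1 * (b * l / 4) \<le> c * (b * l / 4)" using that(2) bl by (intro mult_right_mono) auto
    ultimately show ?thesis using bl by (simp add: \<kappa>_def l_def)
  qed
  have mono: "measure_pmf.prob A B \<le> \<kappa>" if "B \<subseteq> B'" "measure_pmf.prob A B' \<le> e" "e \<le> \<kappa>" for B B' e
    using measure_pmf.finite_measure_mono[of B B' A] that by simp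
  have U1_small: "above_set (real k / n) U1 \<longleftrightarrow> 17 * (b * l) < real k" "\<not> below_set (real k / n) U1"
    if "q \<le> 16 * b * ln n / n" for k
  proof -
    have "0 \<le> (16 * b + b) * ln n / n" using n0 b l by (simp add: l_def)
    moreover have "U1 = {0..(16 * b + b) * ln n / n}" using that by (simp add: U1_def U1_int_def)
    ultimately show "above_set (real k / n) U1 \<longleftrightarrow> 17 * (b * l) < real k" "\<not> below_set (real k / n) U1"
      using n0 by (auto simp: above_set_interval below_set_interval l_def field_simps)
  qed
  have U1_large: "above_set (real k / n) U1 \<longleftrightarrow> n * q + \<sigma> < real k" "below_set (real k / n) U1 \<longleftrightarrow> real k < n * q - \<sigma>"
    if "\<not> q \<le> 16 * b * ln n / n" for k
  proof -
    have e: "q - \<sigma> / n = (n * q - \<sigma>) / n" "q + \<sigma> / n = (n * q + \<sigma>) / n"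
      using n0 by (simp_all add: diff_divide_distrib add_divide_distrib)
    have "(n * q - \<sigma>) / n \<le> (n * q + \<sigma>) / n" using n0 \<sigma>2(2) by (intro divide_right_mono) auto
    moreover have "U1 = {(n * q - \<sigma>) / n..(n * q + \<sigma>) / n}"
      using that by (simp only: U1_def U1_int_def sqrt1 e if_False)
    ultimately show "above_set (real k / n) U1 \<longleftrightarrow> n * q + \<sigma> < real k" "below_set (real k / n) U1 \<longleftrightarrow> real k < n * q - \<sigma>"
      using n0 by (simp_all add: above_set_interval below_set_interval divide_less_cancel)
  qed
  show ?T1 if pq: "p \<le> q"
  proof (cases "q \<le> 16 * b * ln n / n")
    case True
    then have "n * q \<le> 16 * (b * l)" using n0 by (simp add: l_def field_simps)
    moreover have "n * p \<le> n * q" using pq n0 by simp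
    ultimately have nq: "n * p \<le> 16 * (b * l)" by linarith
    show ?thesis
    proof (rule mono)
      show "{k. above_set (real k / n) U1} \<subseteq> {k. real k \<ge> 17 * (b * l)}"
        using U1_small[OF True] by auto
      show "measure_pmf.prob A {k. real k \<ge> 17 * (b * l)} \<le> exp (- ((b * l)\<^sup>2 / (4 * (16 * (b * l)))))"
        unfolding A_def using nq bl by (intro poisson_upper_tail np) auto
      show "exp (- ((b * l)\<^sup>2 / (4 * (16 * (b * l))))) \<le> \<kappa>"
        using bl by (simp add: \<kappa>_def power2_eq_square l_def)
    qed
  next
    case False
    show ?thesis
    proof (rule mono)
      show "{k. above_set (real k / n) U1} \<subseteq> {k. real k \<ge> n * q + \<sigma>}"
        using U1_large[OF False] by auto
      show "measure_pmf.prob A {k. real k \<ge> n * q + \<sigma>} \<le> exp (- (\<sigma>\<^sup>2 / (4 * (n * q))))"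
        unfolding A_def using big[OF False] \<sigma>2(2) pq n0 by (intro poisson_upper_tail np) auto
      show "exp (- (\<sigma>\<^sup>2 / (4 * (n * q)))) \<le> \<kappa>" using big_exp[OF False, of 1] by simp
    qed
  qed
  show ?T2 if pq: "q \<le> p"
  proof (cases "q \<le> 16 * b * ln n / n")
    case True
    then have "{k. below_set (real k / n) U1} = {}"
      using U1_small[OF True] by auto
    then show ?thesis by (simp add: \<kappa>_def)
  next
    case False
    show ?thesis
    proof (rule mono)
      show "{k. below_set (real k / n) U1} \<subseteq> {k. real k \<le> n * q - \<sigma>}"
        using U1_large[OF False] by auto
      show "measure_pmf.prob A {k. real k \<le> n * q - \<sigma>} \<le> exp (- (\<sigma>\<^sup>2 / (4 * (n * q))))"
        unfolding A_def using big[OF False] \<sigma>2(2) pq n0 by (intro poisson_lower_tail) auto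
      show "exp (- (\<sigma>\<^sup>2 / (4 * (n * q)))) \<le> \<kappa>" using big_exp[OF False, of 1] by simp
    qed
  qed
  show ?T3 if ab: "above_set p (U_int n (16 * b) q)"
  proof (cases "q \<le> 16 * b * ln n / n")
    case True
    have "2 * (16 * b) * ln n / n \<in> U_int n (16 * b) q" using True n0 bl by (simp add: U_int_def l_def)
    then have "32 * b * l / n < p" using ab by (simp add: above_set_def l_def)
    then have nq: "32 * (b * l) \<le> n * p" using n0 by (simp add: field_simps)
    show ?thesis
    proof (rule mono)
      show "{k. \<not> above_set (real k / n) U1} \<subseteq> {k. real k \<le> 17 * (b * l)}"
        using U1_small[OF True] by auto
      show "measure_pmf.prob A {k. real k \<le> 17 * (b * l)} \<le> exp (- ((15 * (b * l))\<^sup>2 / (4 * (32 * (b * l)))))"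
        unfolding A_def using nq bl by (intro poisson_lower_tail) auto
      show "exp (- ((15 * (b * l))\<^sup>2 / (4 * (32 * (b * l))))) \<le> \<kappa>"
        using bl by (simp add: \<kappa>_def power2_eq_square l_def)
    qed
  next
    case False
    have "q + 4 * \<sigma> / n \<in> U_int n (16 * b) q" using False n0 \<sigma>2(2) by (simp add: U_int_def sqrt16)
    then have "q + 4 * \<sigma> / n < p" using ab by (simp add: above_set_def)
    then have nq: "n * q + 4 * \<sigma> \<le> n * p" using n0 by (simp add: field_simps)
    show ?thesis
    proof (rule mono)
      show "{k. \<not> above_set (real k / n) U1} \<subseteq> {k. real k \<le> n * q + \<sigma>}"
        using U1_large[OF False] by auto
      show "measure_pmf.prob A {k. real k \<le> n * q + \<sigma>} \<le> exp (- ((3 * \<sigma>)\<^sup>2 / (4 * (n * q + 4 * \<sigma>))))"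
        unfolding A_def using nq big[OF False] \<sigma>2(2) by (intro poisson_lower_tail) auto
      have "2 * \<sigma>\<^sup>2 / (4 * (n * q)) \<le> (3 * \<sigma>)\<^sup>2 / (4 * (n * q + 4 * \<sigma>))"
      proof -
        have "2 * \<sigma>\<^sup>2 / (4 * (n * q)) = 4 * \<sigma>\<^sup>2 / (4 * (2 * (n * q)))" by simp
        also have "\<dots> \<le> (3 * \<sigma>)\<^sup>2 / (4 * (n * q + 4 * \<sigma>))"
          using big[OF False] \<sigma>2(2) by (intro frac_le) (auto simp: power_mult_distrib)
        finally show ?thesis .
      qed
      then show "exp (- ((3 * \<sigma>)\<^sup>2 / (4 * (n * q + 4 * \<sigma>)))) \<le> \<kappa>"
        using big_exp[OF False, of 2] by (intro order_trans[OF _ big_exp[OF False, of 2]]) auto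
    qed
  qed
  show ?T4 if be: "below_set p (U_int n (16 * b) q)"
  proof (cases "q \<le> 16 * b * ln n / n")
    case True
    have "0 \<in> U_int n (16 * b) q" using True n0 bl by (simp add: U_int_def l_def)
    then show ?thesis using be p by (auto simp: below_set_def)
  next
    case False
    have "q - 4 * \<sigma> / n \<in> U_int n (16 * b) q" using False n0 \<sigma>2(2) by (simp add: U_int_def sqrt16)
    then have "p < q - 4 * \<sigma> / n" using be by (simp add: below_set_def)
    then have nq: "n * p \<le> n * q - 4 * \<sigma>" using n0 by (simp add: field_simps)
    show ?thesis
    proof (rule mono)
      show "{k. \<not> below_set (real k / n) U1} \<subseteq> {k. real k \<ge> n * q - \<sigma>}"
        using U1_large[OF False] by auto
      show "measure_pmf.prob A {k. real k \<ge> n * q - \<sigma>} \<le> exp (- ((3 * \<sigma>)\<^sup>2 / (4 * (n * q))))"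
        unfolding A_def using nq big[OF False] \<sigma>2(2) by (intro poisson_upper_tail np) auto
      show "exp (- ((3 * \<sigma>)\<^sup>2 / (4 * (n * q)))) \<le> \<kappa>"
        using big_exp[OF False, of 9] by (simp add: power_mult_distrib)
    qed
  qed
qed

section \<open>Independence of the symbols\<close>

text \<open>
  Bias and variance are supplied per summand. The variance is bounded through the second moment about an arbitrary point
  \<open>m i\<close>, so that any convenient centering will do.
\<close>

lemma (in prob_space) second_moment_indep_sum:
  fixes Z :: "'i \<Rightarrow> 'a \<Rightarrow> real"
  assumes fin: "finite I" and ind: "indep_vars (\<lambda>_. borel) Z I"
    and int: "\<And>i. i \<in> I \<Longrightarrow> integrable M (Z i)" and int2: "\<And>i. i \<in> I \<Longrightarrow> integrable M (\<lambda>\<omega>. (Z i \<omega>)\<^sup>2)"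
    and bias: "\<And>i. i \<in> I \<Longrightarrow> \<bar>expectation (Z i) - l i\<bar> \<le> \<beta> i"
    and var: "\<And>i. i \<in> I \<Longrightarrow> expectation (\<lambda>\<omega>. (Z i \<omega> - m i)\<^sup>2) \<le> v i"
  shows "integrable M (\<lambda>\<omega>. ((\<Sum>i\<in>I. Z i \<omega>) - (\<Sum>i\<in>I. l i))\<^sup>2)"
    and "expectation (\<lambda>\<omega>. ((\<Sum>i\<in>I. Z i \<omega>) - (\<Sum>i\<in>I. l i))\<^sup>2) \<le> (\<Sum>i\<in>I. v i) + (\<Sum>i\<in>I. \<beta> i)\<^sup>2"
proof -
  define W where "W i \<omega> = Z i \<omega> - expectation (Z i)" for i \<omega>
  define B where "B = (\<Sum>i\<in>I. expectation (Z i) - l i)"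
  have intW: "integrable M (W i)" and EW: "expectation (W i) = 0" if "i \<in> I" for i
    unfolding W_def using int[OF that] by (auto simp: prob_space)
  have sq: "integrable M (\<lambda>\<omega>. (Z i \<omega> - c)\<^sup>2)" if "i \<in> I" for i c
    unfolding power2_diff using int[OF that] int2[OF that] by auto
  have WW: "integrable M (\<lambda>\<omega>. W i \<omega> * W j \<omega>)"
      "expectation (\<lambda>\<omega>. W i \<omega> * W j \<omega>) \<le> (if i = j then v i else 0)" if ij: "i \<in> I" "j \<in> I" for i j
  proof -
    have "integrable M (\<lambda>\<omega>. W i \<omega> * W j \<omega>) \<and> expectation (\<lambda>\<omega>. W i \<omega> * W j \<omega>) \<le> (if i = j then v i else 0)"
    proof (cases "i = j")
      case True
      have "expectation (\<lambda>\<omega>. (W i \<omega>)\<^sup>2) = expectation (\<lambda>\<omega>. (Z i \<omega> - m i)\<^sup>2) - (expectation (Z i) - m i)\<^sup>2"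
        using int[OF ij(1)] int2[OF ij(1)]
        by (simp add: W_def power2_diff prob_space power2_eq_square algebra_simps)
      also have "\<dots> \<le> v i" using var[OF ij(1)] by (smt (verit) zero_le_power2)
      finally show ?thesis using sq[OF ij(1)] True by (simp add: W_def power2_eq_square)
    next
      case False
      have "indep_vars (\<lambda>_. borel) (\<lambda>i \<omega>. (\<lambda>x. x - expectation (Z i)) (Z i \<omega>)) {i, j}"
        by (rule indep_vars_compose2[OF indep_vars_subset[OF ind]]) (use ij in auto)
      then have ind': "indep_vars (\<lambda>_. borel) W {i, j}" by (simp add: W_def[abs_def])
      have "expectation (\<lambda>\<omega>. \<Prod>k\<in>{i, j}. W k \<omega>) = (\<Prod>k\<in>{i, j}. expectation (W k))"
        by (rule indep_vars_lebesgue_integral[OF _ ind']) (use ij intW in auto)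
      moreover have "integrable M (\<lambda>\<omega>. \<Prod>k\<in>{i, j}. W k \<omega>)"
        by (rule indep_vars_integrable[OF _ ind']) (use ij intW in auto)
      ultimately show ?thesis using False EW ij by simp
    qed
    then show "integrable M (\<lambda>\<omega>. W i \<omega> * W j \<omega>)"
      "expectation (\<lambda>\<omega>. W i \<omega> * W j \<omega>) \<le> (if i = j then v i else 0)" by auto
  qed
  have eq: "((\<Sum>i\<in>I. Z i \<omega>) - (\<Sum>i\<in>I. l i))\<^sup>2
      = (\<Sum>i\<in>I. \<Sum>j\<in>I. W i \<omega> * W j \<omega>) + 2 * B * (\<Sum>i\<in>I. W i \<omega>) + B\<^sup>2" for \<omega>
  proof -
    have "(\<Sum>i\<in>I. Z i \<omega>) - (\<Sum>i\<in>I. l i) = (\<Sum>i\<in>I. W i \<omega>) + B"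
      by (simp add: W_def B_def sum_subtractf)
    then show ?thesis by (simp add: power2_sum sum_product[symmetric] power2_eq_square algebra_simps)
  qed
  have i1: "integrable M (\<lambda>\<omega>. \<Sum>i\<in>I. \<Sum>j\<in>I. W i \<omega> * W j \<omega>)"
    by (intro Bochner_Integration.integrable_sum WW)
  have i2: "integrable M (\<lambda>\<omega>. 2 * B * (\<Sum>i\<in>I. W i \<omega>))"
    by (intro integrable_mult_right Bochner_Integration.integrable_sum intW)
  show "integrable M (\<lambda>\<omega>. ((\<Sum>i\<in>I. Z i \<omega>) - (\<Sum>i\<in>I. l i))\<^sup>2)"
    unfolding eq using i1 i2 by auto
  have "expectation (\<lambda>\<omega>. ((\<Sum>i\<in>I. Z i \<omega>) - (\<Sum>i\<in>I. l i))\<^sup>2)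
      = expectation (\<lambda>\<omega>. \<Sum>i\<in>I. \<Sum>j\<in>I. W i \<omega> * W j \<omega>) + 2 * B * expectation (\<lambda>\<omega>. \<Sum>i\<in>I. W i \<omega>) + B\<^sup>2"
    unfolding eq using i1 i2 by (simp add: prob_space)
  also have "expectation (\<lambda>\<omega>. \<Sum>i\<in>I. W i \<omega>) = 0"
    using intW EW by (subst Bochner_Integration.integral_sum) auto
  also have "expectation (\<lambda>\<omega>. \<Sum>i\<in>I. \<Sum>j\<in>I. W i \<omega> * W j \<omega>)
      = (\<Sum>i\<in>I. \<Sum>j\<in>I. expectation (\<lambda>\<omega>. W i \<omega> * W j \<omega>))"
    using WW by (simp add: Bochner_Integration.integral_sum)
  also have "\<dots> \<le> (\<Sum>i\<in>I. \<Sum>j\<in>I. if i = j then v i else 0)"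
    by (intro sum_mono WW)
  also have "\<dots> = (\<Sum>i\<in>I. v i)" using fin by simp
  finally have "expectation (\<lambda>\<omega>. ((\<Sum>i\<in>I. Z i \<omega>) - (\<Sum>i\<in>I. l i))\<^sup>2) \<le> (\<Sum>i\<in>I. v i) + B\<^sup>2" by simp
  moreover have "B\<^sup>2 \<le> (\<Sum>i\<in>I. \<beta> i)\<^sup>2"
  proof -
    have "\<bar>B\<bar> \<le> (\<Sum>i\<in>I. \<beta> i)"
      unfolding B_def by (rule order_trans[OF sum_abs sum_mono]) (rule bias)
    then have "\<bar>B\<bar>\<^sup>2 \<le> (\<Sum>i\<in>I. \<beta> i)\<^sup>2" by (intro power_mono) auto
    then show ?thesis by simp
  qed
  ultimately show "expectation (\<lambda>\<omega>. ((\<Sum>i\<in>I. Z i \<omega>) - (\<Sum>i\<in>I. l i))\<^sup>2) \<le> (\<Sum>i\<in>I. v i) + (\<Sum>i\<in>I. \<beta> i)\<^sup>2"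
    by simp
qed

text \<open>
  The two half-samples of a symbol are independent: the first decides on the regime, the second estimates.
\<close>

lemma counts_product:
  fixes g h :: "nat \<Rightarrow> real"
  assumes i: "i \<in> {1..S}"
    and g: "integrable (measure_pmf (poisson0_pmf (n * p i))) g"
    and h: "integrable (measure_pmf (poisson0_pmf (n * p i))) h"
  shows "integrable (measure_pmf (counts_pmf n S p)) (\<lambda>N. g (N (i, 1)) * h (N (i, 2)))"
    and "measure_pmf.expectation (counts_pmf n S p) (\<lambda>N. g (N (i, 1)) * h (N (i, 2)))
      = measure_pmf.expectation (poisson0_pmf (n * p i)) g * measure_pmf.expectation (poisson0_pmf (n * p i)) h"
proof -
  let ?I = "{1..S} \<times> {1, 2 :: nat}"
  let ?D = "counts_pmf n S p"
  note D = measure_pmf.prob_space_axioms[of ?D]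
  let ?A = "poisson0_pmf (n * p i)"
  define f where "f x = (if snd x = (1 :: nat) then g else h)" for x :: "nat \<times> nat"
  have marg: "map_pmf (\<lambda>N. N (i, j)) ?D = ?A" if "j \<in> {1, 2}" for j
    unfolding counts_pmf_def using i that by (subst Pi_pmf_component) auto
  have int: "integrable ?D (\<lambda>N. f x (N x))" and ex: "measure_pmf.expectation ?D (\<lambda>N. f x (N x)) = measure_pmf.expectation ?A (f x)"
    if "x \<in> {(i, 1), (i, 2)}" for x
  proof -
    have m: "map_pmf (\<lambda>N. N x) ?D = ?A" using marg that by auto
    have "integrable (measure_pmf ?A) (f x)" using g h by (simp add: f_def)
    then show "integrable ?D (\<lambda>N. f x (N x))" unfolding m[symmetric] by simp
    show "measure_pmf.expectation ?D (\<lambda>N. f x (N x)) = measure_pmf.expectation ?A (f x)"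
      unfolding m[symmetric] by simp
  qed
  have "prob_space.indep_vars (measure_pmf ?D) (\<lambda>_. count_space UNIV) (\<lambda>x N. N x) ?I"
    unfolding counts_pmf_def by (rule indep_vars_Pi_pmf) simp
  then have ind: "prob_space.indep_vars (measure_pmf ?D) (\<lambda>_. borel) (\<lambda>x N. f x (N x)) {(i, 1), (i, 2)}"
    by (rule prob_space.indep_vars_compose2[OF D prob_space.indep_vars_subset[OF D]]) (use i in auto)
  have "integrable ?D (\<lambda>N. \<Prod>x\<in>{(i, 1), (i, 2)}. f x (N x))"
    by (rule prob_space.indep_vars_integrable[OF D _ ind]) (use int in auto)
  then show "integrable ?D (\<lambda>N. g (N (i, 1)) * h (N (i, 2)))" by (simp add: f_def)
  have "measure_pmf.expectation ?D (\<lambda>N. \<Prod>x\<in>{(i, 1), (i, 2)}. f x (N x))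
      = (\<Prod>x\<in>{(i, 1), (i, 2)}. measure_pmf.expectation ?D (\<lambda>N. f x (N x)))"
    by (rule prob_space.indep_vars_lebesgue_integral[OF D _ ind]) (use int in auto)
  then show "measure_pmf.expectation ?D (\<lambda>N. g (N (i, 1)) * h (N (i, 2)))
      = measure_pmf.expectation ?A g * measure_pmf.expectation ?A h"
    using ex[of "(i, 1)"] ex[of "(i, 2)"] by (simp add: f_def)
qed

lemma indep_vars_counts_pairs:
  fixes Z :: "nat \<Rightarrow> nat \<Rightarrow> nat \<Rightarrow> real"
  shows "prob_space.indep_vars (measure_pmf (counts_pmf n S p)) (\<lambda>_. borel)
    (\<lambda>i N. Z i (N (i, 1)) (N (i, 2))) {1..S}"
proof -
  let ?I = "{1..S} \<times> {1, 2 :: nat}"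
  let ?D = "counts_pmf n S p"
  note D = measure_pmf.prob_space_axioms[of ?D]
  let ?K = "\<lambda>i. {(i, 1), (i, 2 :: nat)}"
  have "prob_space.indep_vars (measure_pmf ?D) (\<lambda>_. count_space UNIV) (\<lambda>x N. N x) ?I"
    unfolding counts_pmf_def by (rule indep_vars_Pi_pmf) simp
  then have "prob_space.indep_vars (measure_pmf ?D) (\<lambda>i. PiM (?K i) (\<lambda>_. count_space UNIV))
      (\<lambda>i N. restrict (\<lambda>x. N x) (?K i)) {1..S}"
    by (rule prob_space.indep_vars_restrict[OF D]) (auto simp: disjoint_family_on_def)
  then have "prob_space.indep_vars (measure_pmf ?D) (\<lambda>_. borel)
      (\<lambda>i N. (\<lambda>\<omega>. Z i (\<omega> (i, 1)) (\<omega> (i, 2))) (restrict (\<lambda>x. N x) (?K i))) {1..S}"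
  proof (rule prob_space.indep_vars_compose2[OF D])
    fix i :: nat
    have c: "(\<lambda>\<omega>. \<omega> x) \<in> measurable (PiM (?K i) (\<lambda>_. count_space UNIV)) (count_space (UNIV :: nat set))"
      if "x \<in> ?K i" for x
      using that by (rule measurable_component_singleton)
    show "(\<lambda>\<omega>. Z i (\<omega> (i, 1)) (\<omega> (i, 2))) \<in> measurable (PiM (?K i) (\<lambda>_. count_space UNIV)) borel"
    proof (rule measurable_compose_countable[where f = "\<lambda>a \<omega>. Z i a (\<omega> (i, 2))" and g = "\<lambda>\<omega>. \<omega> (i, 1)", OF _ c])
      fix a :: nat
      show "(\<lambda>\<omega>. Z i a (\<omega> (i, 2))) \<in> measurable (PiM (?K i) (\<lambda>_. count_space UNIV)) borel"
        by (rule measurable_compose[OF c[of "(i, 2)"]]) auto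
    qed simp
  qed
  then show ?thesis by simp
qed

section \<open>Bias and variance of one symbol\<close>

text \<open>
  The counts \<open>x\<close> and \<open>y\<close> of the symbol come from the first and the second half-sample.
\<close>

definition cell_stat :: "real \<Rightarrow> real \<Rightarrow> real \<Rightarrow> real \<Rightarrow> real \<Rightarrow> nat \<Rightarrow> nat \<Rightarrow> real" where
  "cell_stat n c1 K c3 q x y =
    (real y / n - q) * of_bool (above_set (real x / n) (U1_int n c1 c3 q))
    + (q - real y / n) * of_bool (below_set (real x / n) (U1_int n c1 c3 q))
    + unbiased_poly n (best_poly n c1 K q) (real y / n) * of_bool (real x / n \<in> U1_int n c1 c3 q)"

text \<open>
  The statistic that is told when \<open>p\<close> lies outside the wide interval. It differs from \<open>cell_stat\<close> only on a rare
  event, and the polynomial estimator is used only where \<open>p\<close> belongs to the interval of approximation.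
\<close>

definition idealized_cell_stat :: "real \<Rightarrow> real \<Rightarrow> real \<Rightarrow> real \<Rightarrow> real \<Rightarrow> real \<Rightarrow> nat \<Rightarrow> nat \<Rightarrow> real" where
  "idealized_cell_stat n c1 K c3 p q x y =
    (if above_set p (U_int n c1 q) then real y / n - q
     else if below_set p (U_int n c1 q) then q - real y / n
     else cell_stat n c1 K c3 q x y)"

lemma poisson_centered_moments:
  assumes n: "n > 0" and p: "p \<ge> 0"
  defines "A \<equiv> poisson0_pmf (n * p)"
  shows "integrable (measure_pmf A) (\<lambda>k. real k / n - q)"
    and "measure_pmf.expectation A (\<lambda>k. real k / n - q) = p - q"
    and "integrable (measure_pmf A) (\<lambda>k. (real k / n - q)\<^sup>2)"
    and "measure_pmf.expectation A (\<lambda>k. (real k / n - q)\<^sup>2) = p / n + (p - q)\<^sup>2"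
proof -
  have r: "n * p \<ge> 0" using n p by simp
  have T: "unbiased_poly n [:- q, 1:] x = x - q" for x q by simp
  show i: "integrable (measure_pmf A) (\<lambda>k. real k / n - q)" for q
    using integrable_poisson_unbiased[OF r, of n "[:- q, 1:]"] by (simp add: A_def)
  show m: "measure_pmf.expectation A (\<lambda>k. real k / n - q) = p - q" for q
    using expectation_unbiased_poly[OF n p, of "[:- q, 1:]"] by (simp add: A_def)
  show i2: "integrable (measure_pmf A) (\<lambda>k. (real k / n - q)\<^sup>2)" for q
    using integrable_poisson_unbiased_mult[OF r, of n "[:- q, 1:]" 0 "[:- q, 1:]" 0]
    by (simp add: A_def power2_eq_square)
  have v: "measure_pmf.expectation A (\<lambda>k. (real k / n - p)\<^sup>2) = p / n"
    using expectation_charlier_square[OF n p, of 1] by (simp add: A_def)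
  have eq: "(real k / n - q)\<^sup>2 = (real k / n - p)\<^sup>2 + 2 * (p - q) * (real k / n - p) + (p - q)\<^sup>2" for k
    by (simp add: power2_eq_square algebra_simps)
  have "measure_pmf.expectation A (\<lambda>k. (real k / n - q)\<^sup>2)
      = measure_pmf.expectation A (\<lambda>k. (real k / n - p)\<^sup>2)
        + 2 * (p - q) * measure_pmf.expectation A (\<lambda>k. real k / n - p) + (p - q)\<^sup>2"
    unfolding eq using i2[of p] i[of p]
    by (subst Bochner_Integration.integral_add, simp, simp, subst Bochner_Integration.integral_add) auto
  then show "measure_pmf.expectation A (\<lambda>k. (real k / n - q)\<^sup>2) = p / n + (p - q)\<^sup>2"
    by (simp add: v m)
qed

text \<open>
  Splitting off \<open>x - q\<close> leaves a remainder of size \<open>4 * min q (sqrt (\<delta> * q))\<close>, whose square is at most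
  \<open>16 * \<delta> * q\<close>. The condition \<open>2 * c2 \<le> c1\<close> keeps the degree small enough for
  \<open>second_moment_unbiased_poly\<close>: since \<open>p \<le> 2 * a\<close>, degree times \<open>p / n\<close> is at most the squared half-width.
\<close>

lemma second_moment_unbiased_best_poly:
  assumes n: "n > 1" and c1: "c1 > 0" and c2: "c2 > 0" "2 * c2 \<le> c1" and K: "c2 * ln n \<ge> 1"
    and q: "q \<ge> 0" and p: "p \<ge> 0" "p \<in> U_int n c1 q"
  defines "\<delta> \<equiv> c1 * ln n / n" and "d \<equiv> nat \<lfloor>c2 * ln n\<rfloor>"
  shows "measure_pmf.expectation (poisson0_pmf (n * p))
      (\<lambda>k. (unbiased_poly n (best_poly n c1 (c2 * ln n) q) (real k / n))\<^sup>2)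
    \<le> 2 * (p / n + (p - q)\<^sup>2) + 32 * (real (d + 1) * 24 ^ d)\<^sup>2 * (\<delta> * q)"
proof -
  let ?E = "measure_pmf.expectation (poisson0_pmf (n * p))"
  define P where "P = best_poly n c1 (c2 * ln n) q"
  define R where "R = P - [:- q, 1:]"
  define a where "a = max \<delta> q"
  define r where "r = sqrt (\<delta> * a)"
  define M where "M = 4 * min q (sqrt (\<delta> * q))"
  define B where "B = real (d + 1) * 24 ^ d"
  define \<sigma> where "\<sigma> = (if p \<le> a then 1 else - 1 :: real)"
  have \<delta>: "\<delta> > 0" using n c1 by (simp add: \<delta>_def)
  have n0: "n > 0" using n by simp
  have np: "n * p \<ge> 0" using n0 p by simp
  have U: "U_int n c1 q = {a - r..a + r}"
    using U_int_eq[OF n c1 q] by (simp add: a_def r_def \<delta>_def)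
  have r: "r > 0" "r \<le> a" "r\<^sup>2 = \<delta> * a"
    using \<delta> by (auto simp: r_def a_def intro!: real_le_lsqrt simp: power2_eq_square mult_right_mono)
  have d: "real d \<le> c2 * ln n" using K by (simp add: d_def)
  have degR: "degree R \<le> d"
  proof -
    have "degree P \<le> d" unfolding P_def d_def using K by (intro best_poly_optimal(1)[OF n c1 q]) simp
    moreover have "1 \<le> d" using K by (simp add: d_def le_nat_iff le_floor_iff)
    ultimately show ?thesis unfolding R_def by (intro degree_diff_le) auto
  qed
  have "?E (\<lambda>k. (unbiased_poly n R (real k / n))\<^sup>2) \<le> (B * M)\<^sup>2"
    unfolding B_def
  proof (rule second_moment_unbiased_poly[OF n0 p(1) r(1) degR])
    show "\<sigma> = 1 \<or> \<sigma> = - 1" by (simp add: \<sigma>_def)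
    fix y :: real assume y: "0 \<le> y" "y \<le> 1"
    have "r * y \<le> r" "0 \<le> r * y" using y r(1) by (auto intro: mult_left_le)
    then have "p + \<sigma> * r * y \<in> U_int n c1 q" using p(2) unfolding U \<sigma>_def by auto
    then show "\<bar>poly R (p + \<sigma> * r * y)\<bar> \<le> M"
      unfolding R_def P_def M_def \<delta>_def by (rule best_poly_error(3)[OF n c1 q K])
  next
    have "real d * p \<le> (c2 * ln n) * (2 * a)"
      using d p r c2 n unfolding U by (intro mult_mono) auto
    also have "\<dots> = (2 * c2) * (ln n * a)" by simp
    also have "\<dots> \<le> c1 * (ln n * a)"
      using c2 n \<delta> by (intro mult_right_mono) (auto simp: a_def)
    finally have "real d * p / n \<le> c1 * (ln n * a) / n" using n0 by (intro divide_right_mono) auto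
    then show "real d * p / n \<le> r\<^sup>2" by (simp add: r(3) \<delta>_def)
  qed
  also have "(B * M)\<^sup>2 \<le> B\<^sup>2 * (16 * (\<delta> * q))"
  proof -
    have "(min q (sqrt (\<delta> * q)))\<^sup>2 \<le> (sqrt (\<delta> * q))\<^sup>2" using q \<delta> by (intro power_mono) auto
    then have "M\<^sup>2 \<le> 16 * (\<delta> * q)" using q \<delta> by (simp add: M_def power_mult_distrib)
    then show ?thesis by (simp add: power_mult_distrib mult_left_mono)
  qed
  finally have ER: "?E (\<lambda>k. (unbiased_poly n R (real k / n))\<^sup>2) \<le> B\<^sup>2 * (16 * (\<delta> * q))" .
  have iR: "integrable (measure_pmf (poisson0_pmf (n * p))) (\<lambda>k. (unbiased_poly n R (real k / n))\<^sup>2)" for R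
    using integrable_poisson_unbiased_mult[OF np, of n R 0 R 0] by (simp add: power2_eq_square)
  note c = poisson_centered_moments[OF n0 p(1)]
  have "?E (\<lambda>k. (unbiased_poly n P (real k / n))\<^sup>2)
      \<le> ?E (\<lambda>k. 2 * (real k / n - q)\<^sup>2 + 2 * (unbiased_poly n R (real k / n))\<^sup>2)"
  proof (rule integral_mono)
    show "integrable (measure_pmf (poisson0_pmf (n * p)))
        (\<lambda>k. 2 * (real k / n - q)\<^sup>2 + 2 * (unbiased_poly n R (real k / n))\<^sup>2)"
      using c(3) iR by auto
    fix k
    have "P = [:- q, 1:] + R" by (simp add: R_def)
    then have "unbiased_poly n P (real k / n) = (real k / n - q) + unbiased_poly n R (real k / n)"
      by (simp only: unbiased_poly_add) simp
    then show "(unbiased_poly n P (real k / n))\<^sup>2 \<le> 2 * (real k / n - q)\<^sup>2 + 2 * (unbiased_poly n R (real k / n))\<^sup>2"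
      using sum_squares_bound[of "real k / n - q" "unbiased_poly n R (real k / n)"]
      by (simp add: power2_sum)
  qed (rule iR)
  also have "\<dots> = 2 * (p / n + (p - q)\<^sup>2) + 2 * ?E (\<lambda>k. (unbiased_poly n R (real k / n))\<^sup>2)"
    using c(3,4) iR by simp
  also have "\<dots> \<le> 2 * (p / n + (p - q)\<^sup>2) + 32 * B\<^sup>2 * (\<delta> * q)"
    using ER by (simp add: mult_ac)
  finally show ?thesis by (simp add: P_def B_def)
qed

lemma U1_int_trichotomy:
  assumes "n > 1" "c1 > 0" "c3 > 0" "q \<ge> 0"
  shows "of_bool (above_set x (U1_int n c1 c3 q)) + of_bool (below_set x (U1_int n c1 c3 q))
    + of_bool (x \<in> U1_int n c1 c3 q) = (1 :: real)"
proof -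
  obtain lo hi where le: "lo \<le> hi" and eq: "U1_int n c1 c3 q = {lo..hi}"
  proof (cases "q \<le> c1 * ln n / n")
    case True
    have "0 \<le> (c1 + c3) * ln n / n" using assms by simp
    then show ?thesis using that[of 0 "(c1 + c3) * ln n / n"] True by (simp add: U1_int_def)
  next
    case False
    define r where "r = sqrt (c3 * q * ln n / n)"
    have "0 \<le> r" using assms by (simp add: r_def)
    then show ?thesis using that[of "q - r" "q + r"] False by (simp add: U1_int_def r_def)
  qed
  show ?thesis
    unfolding eq above_set_interval[OF le] below_set_interval[OF le] using le by auto
qed

text \<open>
  Outside the wide interval the statistic is a signed centered count, unbiased for the absolute difference. Inside, the three regimes
  have probabilities summing to one; in the regime matching the sign of \<open>p - q\<close> there is no bias,
  in the opposite regime the bias is \<open>2 * \<bar>p - q\<bar>\<close> but its probability is at most \<open>\<kappa>\<close>, and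
  in the middle regime the bias is the approximation error.
\<close>

lemma idealized_cell_moments:
  fixes P :: "nat \<Rightarrow> real"
  assumes n: "n > 1" and b: "b > 0" and c2: "c2 > 0" "c2 \<le> 8 * b" and K: "c2 * ln n \<ge> 1"
    and q: "q \<ge> 0" and i: "i \<in> {1..S}" and p: "P i \<ge> 0"
  defines "D \<equiv> counts_pmf n S P" and "p \<equiv> P i"
    and "Z \<equiv> \<lambda>N. idealized_cell_stat n (16 * b) (c2 * ln n) b (P i) q (N (i, 1)) (N (i, 2))"
    and "Z0 \<equiv> \<lambda>N. cell_stat n (16 * b) (c2 * ln n) b q (N (i, 1)) (N (i, 2))"
    and "\<delta> \<equiv> 16 * b * ln n / n" and "\<kappa> \<equiv> exp (- (b * ln n / 64))"
    and "B \<equiv> real (nat \<lfloor>c2 * ln n\<rfloor> + 1) * 24 ^ nat \<lfloor>c2 * ln n\<rfloor>"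
  shows "integrable (measure_pmf D) Z" and "integrable (measure_pmf D) (\<lambda>N. (Z N)\<^sup>2)"
    and "\<bar>measure_pmf.expectation D Z - \<bar>p - q\<bar>\<bar> \<le> 2 * \<bar>p - q\<bar> * \<kappa> + min (2 * q) (48 * sqrt (\<delta> * q) / (c2 * ln n))"
    and "\<exists>m. measure_pmf.expectation D (\<lambda>N. (Z N - m)\<^sup>2) \<le> 3 * (p / n + 2 * \<delta> * (p + q)) + 32 * B\<^sup>2 * (\<delta> * q)"
    and "measure_pmf.prob D {N. Z N \<noteq> Z0 N} \<le> \<kappa>"
proof -
  let ?A = "poisson0_pmf (n * p)"
  let ?E = "measure_pmf.expectation ?A"
  let ?ED = "measure_pmf.expectation D"
  let ?U = "U_int n (16 * b) q" and ?U1 = "U1_int n (16 * b) b q"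
  define h1 where "h1 k = real k / n - q" for k :: nat
  define h3 where "h3 k = unbiased_poly n (best_poly n (16 * b) (c2 * ln n) q) (real k / n)" for k :: nat
  define g1 :: "nat \<Rightarrow> real" where "g1 k = of_bool (above_set (real k / n) ?U1)" for k
  define g2 :: "nat \<Rightarrow> real" where "g2 k = of_bool (below_set (real k / n) ?U1)" for k
  define g3 :: "nat \<Rightarrow> real" where "g3 k = of_bool (real k / n \<in> ?U1)" for k
  have n0: "n > 0" and c1: "16 * b > 0" using n b by auto
  have p0: "p \<ge> 0" using p by (simp add: p_def)
  have np: "n * p \<ge> 0" using n0 p0 by simp
  have \<delta>: "\<delta> > 0" using n b by (simp add: \<delta>_def)
  have \<kappa>: "\<kappa> > 0" by (simp add: \<kappa>_def)
  have err0: "0 \<le> min (2 * q) (48 * sqrt (\<delta> * q) / (c2 * ln n))" using q \<delta> K by simp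
  note prod = counts_product[OF i, of n P, folded D_def p_def]
  have one: "integrable (measure_pmf ?A) (\<lambda>_. 1 :: real)" by simp
  have marg1: "integrable (measure_pmf D) (\<lambda>N. g (N (i, 1)))" "?ED (\<lambda>N. g (N (i, 1))) = ?E g"
    and marg2: "integrable (measure_pmf D) (\<lambda>N. g (N (i, 2)))" "?ED (\<lambda>N. g (N (i, 2))) = ?E g"
    if "integrable (measure_pmf ?A) g" for g :: "nat \<Rightarrow> real"
    using prod[OF that one] prod[OF one that] by simp_all
  note c = poisson_centered_moments[OF n0 p0, of q, folded h1_def]
  have ig: "integrable (measure_pmf ?A) g1" "integrable (measure_pmf ?A) g2" "integrable (measure_pmf ?A) g3"
    by (intro measure_pmf.integrable_const_bound[where B = 1] AE_I2; simp add: g1_def g2_def g3_def)+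
  have tri: "g1 k + g2 k + g3 k = 1" for k
    unfolding g1_def g2_def g3_def by (rule U1_int_trichotomy[OF n c1 b q])
  have g01: "g1 k \<in> {0, 1}" "g2 k \<in> {0, 1}" "g3 k \<in> {0, 1}" for k by (auto simp: g1_def g2_def g3_def)
  have Z0: "Z0 N = g1 (N (i, 1)) * h1 (N (i, 2)) + g2 (N (i, 1)) * (- h1 (N (i, 2))) + g3 (N (i, 1)) * h3 (N (i, 2))" for N
    by (simp add: Z0_def cell_stat_def g1_def g2_def g3_def h1_def h3_def)
  note tails = poisson_tails[OF n b q p0, folded \<kappa>_def]
  have prob: "measure_pmf.prob D {N. Q (N (i, 1))} = measure_pmf.prob ?A {k. Q k}" for Q
  proof -
    have "?ED (\<lambda>N. indicator {k. Q k} (N (i, 1))) = ?E (indicator {k. Q k} :: nat \<Rightarrow> real)"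
      by (rule marg1(2)) (simp add: integrable_indicator_iff less_top[symmetric])
    moreover have "(\<lambda>N. indicator {k. Q k} (N (i, 1))) = (indicator {N. Q (N (i, 1))} :: (nat \<times> nat \<Rightarrow> nat) \<Rightarrow> real)"
      by (auto simp: indicator_def)
    ultimately have "?ED (indicator {N. Q (N (i, 1))} :: (nat \<times> nat \<Rightarrow> nat) \<Rightarrow> real) = ?E (indicator {k. Q k} :: _ \<Rightarrow> real)"
      by (simp only:)
    then show ?thesis by simp
  qed
  show "measure_pmf.prob D {N. Z N \<noteq> Z0 N} \<le> \<kappa>"
  proof -
    consider (above) "above_set p ?U" | (below) "\<not> above_set p ?U" "below_set p ?U" | (inside) "\<not> above_set p ?U" "\<not> below_set p ?U"
      by blast
    then show ?thesis
    proof cases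
      case above
      have "{N. Z N \<noteq> Z0 N} \<subseteq> {N. \<not> above_set (real (N (i, 1)) / n) ?U1}"
      proof (rule subsetI, rule CollectI, rule notI)
        fix N assume "N \<in> {N. Z N \<noteq> Z0 N}" "above_set (real (N (i, 1)) / n) ?U1"
        moreover from this have "g1 (N (i, 1)) = 1" "g2 (N (i, 1)) = 0" "g3 (N (i, 1)) = 0"
          using tri[of "N (i, 1)"] g01[of "N (i, 1)"] by (auto simp: g1_def)
        ultimately show False using above
          by (simp add: Z0) (simp add: Z_def idealized_cell_stat_def p_def h1_def)
      qed
      then have "measure_pmf.prob D {N. Z N \<noteq> Z0 N} \<le> measure_pmf.prob D {N. \<not> above_set (real (N (i, 1)) / n) ?U1}"
        by (intro measure_pmf.finite_measure_mono) auto
      also have "\<dots> \<le> \<kappa>" using tails(3)[OF above] prob[of "\<lambda>k. \<not> above_set (real k / n) ?U1"] by simp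
      finally show ?thesis .
    next
      case below
      have "{N. Z N \<noteq> Z0 N} \<subseteq> {N. \<not> below_set (real (N (i, 1)) / n) ?U1}"
      proof (rule subsetI, rule CollectI, rule notI)
        fix N assume "N \<in> {N. Z N \<noteq> Z0 N}" "below_set (real (N (i, 1)) / n) ?U1"
        moreover from this have "g2 (N (i, 1)) = 1" "g1 (N (i, 1)) = 0" "g3 (N (i, 1)) = 0"
          using tri[of "N (i, 1)"] g01[of "N (i, 1)"] by (auto simp: g2_def)
        ultimately show False using below
          by (simp add: Z0) (simp add: Z_def idealized_cell_stat_def p_def h1_def)
      qed
      then have "measure_pmf.prob D {N. Z N \<noteq> Z0 N} \<le> measure_pmf.prob D {N. \<not> below_set (real (N (i, 1)) / n) ?U1}"
        by (intro measure_pmf.finite_measure_mono) auto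
      also have "\<dots> \<le> \<kappa>" using tails(4)[OF below(2)] prob[of "\<lambda>k. \<not> below_set (real k / n) ?U1"] by simp
      finally show ?thesis .
    next
      case inside
      then have "{N. Z N \<noteq> Z0 N} = {}" by (simp add: Z_def Z0_def idealized_cell_stat_def p_def)
      then show ?thesis using \<kappa> by simp
    qed
  qed
  show "integrable (measure_pmf D) Z" "integrable (measure_pmf D) (\<lambda>N. (Z N)\<^sup>2)"
    "\<bar>?ED Z - \<bar>p - q\<bar>\<bar> \<le> 2 * \<bar>p - q\<bar> * \<kappa> + min (2 * q) (48 * sqrt (\<delta> * q) / (c2 * ln n))"
    "\<exists>m. ?ED (\<lambda>N. (Z N - m)\<^sup>2) \<le> 3 * (p / n + 2 * \<delta> * (p + q)) + 32 * B\<^sup>2 * (\<delta> * q)"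
  proof -
    define a where "a = max \<delta> q"
    have U: "?U = {a - sqrt (\<delta> * a)..a + sqrt (\<delta> * a)}"
      using U_int_eq[OF n c1 q] by (simp add: a_def \<delta>_def)
    have r: "0 < sqrt (\<delta> * a)" "sqrt (\<delta> * a) \<le> a"
      using \<delta> by (auto simp: a_def intro!: real_le_lsqrt simp: power2_eq_square mult_right_mono)
    consider (outside) s where "s = 1 \<or> s = - 1" "\<And>N. Z N = s * h1 (N (i, 2))" "\<bar>p - q\<bar> = s * (p - q)"
      | (inside) "p \<in> ?U" "Z = Z0"
    proof -
      have qU: "q \<in> ?U"
      proof (cases "q \<le> \<delta>")
        case True
        then have "a = \<delta>" by (simp add: a_def)
        then show ?thesis using True q \<delta> by (simp add: U)
      next
        case False
        then show ?thesis using r by (simp add: U a_def)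
      qed
      consider "above_set p ?U" | "\<not> above_set p ?U" "below_set p ?U" | "\<not> above_set p ?U" "\<not> below_set p ?U"
        by blast
      then show ?thesis
      proof cases
        case 1
        show ?thesis
        proof (rule outside[of 1])
          show "Z N = 1 * h1 (N (i, 2))" for N
            using 1 by (simp add: Z_def idealized_cell_stat_def p_def h1_def)
          show "\<bar>p - q\<bar> = 1 * (p - q)" using 1 qU by (auto simp: above_set_def)
        qed simp
      next
        case 2
        show ?thesis
        proof (rule outside[of "- 1"])
          show "Z N = - 1 * h1 (N (i, 2))" for N
            using 2 by (simp add: Z_def idealized_cell_stat_def p_def h1_def)
          show "\<bar>p - q\<bar> = - 1 * (p - q)" using 2 qU by (auto simp: below_set_def)
        qed simp
      next
        case 3
        have "a - sqrt (\<delta> * a) \<le> a + sqrt (\<delta> * a)" using r by simp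
        then have "p \<in> ?U" using 3 unfolding U by (simp add: above_set_interval below_set_interval)
        moreover have "Z = Z0" using 3 by (simp add: Z_def Z0_def idealized_cell_stat_def p_def)
        ultimately show ?thesis by (rule inside)
      qed
    qed
    then have "integrable (measure_pmf D) Z \<and> integrable (measure_pmf D) (\<lambda>N. (Z N)\<^sup>2)
      \<and> \<bar>?ED Z - \<bar>p - q\<bar>\<bar> \<le> 2 * \<bar>p - q\<bar> * \<kappa> + min (2 * q) (48 * sqrt (\<delta> * q) / (c2 * ln n))
      \<and> (\<exists>m. ?ED (\<lambda>N. (Z N - m)\<^sup>2) \<le> 3 * (p / n + 2 * \<delta> * (p + q)) + 32 * B\<^sup>2 * (\<delta> * q))"
    proof cases
      case outside
      have Zf: "Z = (\<lambda>N. s * h1 (N (i, 2)))" by (rule ext) (rule outside(2))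
      have ss: "s * s = 1" using outside(1) by auto
      have Z2: "(Z N)\<^sup>2 = (h1 (N (i, 2)))\<^sup>2" for N
        using ss by (simp add: Zf power_mult_distrib power2_eq_square)
      have i1: "integrable (measure_pmf D) (\<lambda>N. h1 (N (i, 2)))" by (rule marg2(1)[OF c(1)])
      have mean: "?ED Z = \<bar>p - q\<bar>"
        unfolding Zf outside(3) using marg2(2)[OF c(1)] c(2) by simp
      \<comment> \<open>Centering at the true mean removes the distance and leaves the Poisson variance.\<close>
      have shift: "(Z N - s * (p - q))\<^sup>2 = (real (N (i, 2)) / n - p)\<^sup>2" for N
      proof -
        have "Z N - s * (p - q) = s * (real (N (i, 2)) / n - p)"
          by (simp add: Zf h1_def algebra_simps)
        then show ?thesis using ss by (simp add: power_mult_distrib power2_eq_square)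
      qed
      have "?ED (\<lambda>N. (Z N - s * (p - q))\<^sup>2) = p / n"
        unfolding shift
        using marg2(2)[OF poisson_centered_moments(3)[OF n0 p0, of p]] poisson_centered_moments(4)[OF n0 p0, of p] by simp
      moreover have "p / n \<le> 3 * (p / n + 2 * \<delta> * (p + q)) + 32 * B\<^sup>2 * (\<delta> * q)"
      proof -
        have "x \<le> 3 * (x + y) + z" if "0 \<le> x" "0 \<le> y" "0 \<le> z" for x y z :: real
          using that by simp
        moreover have "0 \<le> p / n" "0 \<le> 2 * \<delta> * (p + q)" "0 \<le> 32 * B\<^sup>2 * (\<delta> * q)"
          using \<delta> p0 q n0 by simp_all
        ultimately show ?thesis by blast
      qed
      ultimately have "\<exists>m. ?ED (\<lambda>N. (Z N - m)\<^sup>2) \<le> 3 * (p / n + 2 * \<delta> * (p + q)) + 32 * B\<^sup>2 * (\<delta> * q)"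
        by (intro exI[of _ "s * (p - q)"]) simp
      moreover have "integrable (measure_pmf D) Z" unfolding Zf using i1 by simp
      moreover have "integrable (measure_pmf D) (\<lambda>N. (Z N)\<^sup>2)" unfolding Z2 by (rule marg2(1)[OF c(3)])
      moreover have "\<bar>?ED Z - \<bar>p - q\<bar>\<bar> \<le> 2 * \<bar>p - q\<bar> * \<kappa> + min (2 * q) (48 * sqrt (\<delta> * q) / (c2 * ln n))"
        using mean err0 \<kappa> by (simp add: add_nonneg_nonneg)
      ultimately show ?thesis by blast
    next
      case inside
      have ih3: "integrable (measure_pmf ?A) h3" unfolding h3_def by (rule integrable_poisson_unbiased[OF np])
      have ih3sq: "integrable (measure_pmf ?A) (\<lambda>k. (h3 k)\<^sup>2)"
        using integrable_poisson_unbiased_mult[OF np, of n _ 0 _ 0] unfolding h3_def by (simp add: power2_eq_square)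
      have Eh3: "?E h3 = poly (best_poly n (16 * b) (c2 * ln n) q) p"
        unfolding h3_def by (rule expectation_unbiased_poly[OF n0 p0])
      have mh1: "integrable (measure_pmf ?A) (\<lambda>k. - h1 k)" "?E (\<lambda>k. - h1 k) = - (p - q)"
        using c(1,2) by simp_all
      note pr = prod[OF ig(1) c(1)] prod[OF ig(2) mh1(1)] prod[OF ig(3) ih3]
      have intZ: "integrable (measure_pmf D) Z" 
        unfolding inside(2) Z0[abs_def] by (intro Bochner_Integration.integrable_add pr)
      define e where "e = poly (best_poly n (16 * b) (c2 * ln n) q) p - \<bar>p - q\<bar>"
      have EZ: "?ED Z = ?E g1 * (p - q) + ?E g2 * (- (p - q)) + ?E g3 * (\<bar>p - q\<bar> + e)"
        unfolding inside(2) Z0[abs_def] using pr c(2) mh1(2) Eh3 by (simp add: e_def)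
      have sum1: "?E g1 + ?E g2 + ?E g3 = 1"
        using ig by (simp add: Bochner_Integration.integral_add[symmetric] tri del: Bochner_Integration.integral_add)
      have g1k: "?E g1 \<le> \<kappa>" if "p \<le> q"
      proof -
        have "g1 = indicator {k. above_set (real k / n) ?U1}" by (auto simp: g1_def indicator_def)
        then show ?thesis using tails(1)[OF that] by simp
      qed
      have g2k: "?E g2 \<le> \<kappa>" if "q \<le> p"
      proof -
        have "g2 = indicator {k. below_set (real k / n) ?U1}" by (auto simp: g2_def indicator_def)
        then show ?thesis using tails(2)[OF that] by simp
      qed
      have gpos: "0 \<le> ?E g1" "0 \<le> ?E g2" "0 \<le> ?E g3"
        by (intro integral_nonneg_AE AE_I2; simp add: g1_def g2_def g3_def)+
      have e: "\<bar>e\<bar> \<le> min (2 * q) (48 * sqrt (\<delta> * q) / (c2 * ln n))"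
        using best_poly_error(1,2)[OF n c1 q K inside(1)] by (auto simp: e_def \<delta>_def abs_minus_commute)
      \<comment> \<open>The middle regime has probability at most one.\<close>
      have ge: "\<bar>?E g3 * e\<bar> \<le> min (2 * q) (48 * sqrt (\<delta> * q) / (c2 * ln n))"
      proof -
        have "\<bar>?E g3 * e\<bar> \<le> 1 * \<bar>e\<bar>"
          unfolding abs_mult using gpos sum1 by (intro mult_right_mono) auto
        then show ?thesis using e by linarith
      qed
      have bias: "\<bar>?ED Z - \<bar>p - q\<bar>\<bar> \<le> 2 * \<bar>p - q\<bar> * \<kappa> + min (2 * q) (48 * sqrt (\<delta> * q) / (c2 * ln n))"
      proof (cases "q \<le> p")
        case True
        have "?ED Z - \<bar>p - q\<bar> = (?E g1 + ?E g2 + ?E g3 - 1) * (p - q) - 2 * (?E g2 * (p - q)) + ?E g3 * e"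
          unfolding EZ using True by (simp add: algebra_simps)
        also have "\<dots> = - 2 * (?E g2 * (p - q)) + ?E g3 * e" unfolding sum1 by simp
        finally have "\<bar>?ED Z - \<bar>p - q\<bar>\<bar> \<le> 2 * (?E g2 * (p - q)) + \<bar>?E g3 * e\<bar>"
          using gpos True by (smt (verit) mult_nonneg_nonneg)
        moreover have "?E g2 * (p - q) \<le> \<kappa> * \<bar>p - q\<bar>" using True g2k gpos by (intro mult_mono) auto
        moreover have "2 * \<bar>p - q\<bar> * \<kappa> = 2 * (\<kappa> * \<bar>p - q\<bar>)" by simp
        ultimately show ?thesis using ge by linarith
      next
        case False
        have "?ED Z - \<bar>p - q\<bar> = (?E g1 + ?E g2 + ?E g3 - 1) * (q - p) - 2 * (?E g1 * (q - p)) + ?E g3 * e"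
          unfolding EZ using False by (simp add: algebra_simps)
        also have "\<dots> = - 2 * (?E g1 * (q - p)) + ?E g3 * e" unfolding sum1 by simp
        finally have "\<bar>?ED Z - \<bar>p - q\<bar>\<bar> \<le> 2 * (?E g1 * (q - p)) + \<bar>?E g3 * e\<bar>"
          using gpos False by (smt (verit) mult_nonneg_nonneg)
        moreover have "?E g1 * (q - p) \<le> \<kappa> * \<bar>p - q\<bar>" using False g1k gpos by (intro mult_mono) auto
        moreover have "2 * \<bar>p - q\<bar> * \<kappa> = 2 * (\<kappa> * \<bar>p - q\<bar>)" by simp
        ultimately show ?thesis using ge by linarith
      qed
      have Zle: "(Z N)\<^sup>2 \<le> (h1 (N (i, 2)))\<^sup>2 + (h3 (N (i, 2)))\<^sup>2" for N
      proof -
        have "g1 (N (i, 1)) = 1 \<and> g2 (N (i, 1)) = 0 \<and> g3 (N (i, 1)) = 0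
            \<or> g1 (N (i, 1)) = 0 \<and> g2 (N (i, 1)) = 1 \<and> g3 (N (i, 1)) = 0
            \<or> g1 (N (i, 1)) = 0 \<and> g2 (N (i, 1)) = 0 \<and> g3 (N (i, 1)) = 1"
          using tri[of "N (i, 1)"] g01[of "N (i, 1)"] by auto
        then show ?thesis unfolding inside(2) Z0 by auto
      qed
      have isum: "integrable (measure_pmf D) (\<lambda>N. (h1 (N (i, 2)))\<^sup>2 + (h3 (N (i, 2)))\<^sup>2)"
        using marg2(1)[OF c(3)] marg2(1)[OF ih3sq] by simp
      have intZ2: "integrable (measure_pmf D) (\<lambda>N. (Z N)\<^sup>2)"
        by (rule Bochner_Integration.integrable_bound[OF isum]) (auto intro!: AE_I2 Zle)
      \<comment> \<open>A bound linear in \<open>p + q\<close> is needed for the sum over the symbols to cost no factor \<open>S\<close>; for small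
        \<open>q\<close> only one of the two factors of the square may be bounded by \<open>2 * \<delta>\<close>.\<close>
      have pq2: "(p - q)\<^sup>2 \<le> 2 * \<delta> * (p + q)"
      proof (cases "q \<le> \<delta>")
        case True
        then have "a = \<delta>" by (simp add: a_def)
        then have "p \<le> 2 * \<delta>" using inside(1) \<delta> by (simp add: U)
        then have "\<bar>p - q\<bar> \<le> 2 * \<delta>" "\<bar>p - q\<bar> \<le> p + q" using True p0 q \<delta> by auto
        then have "\<bar>p - q\<bar> * \<bar>p - q\<bar> \<le> (2 * \<delta>) * (p + q)" by (intro mult_mono) auto
        then show ?thesis by (simp add: power2_eq_square)
      next
        case False
        then have "a = q" by (simp add: a_def)
        then have "\<bar>p - q\<bar> \<le> sqrt (\<delta> * q)" using inside(1) by (auto simp: U)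
        then have "\<bar>p - q\<bar>\<^sup>2 \<le> (sqrt (\<delta> * q))\<^sup>2" by (intro power_mono) auto
        also have "\<dots> = \<delta> * q" using \<delta> q by simp
        also have "\<dots> \<le> 2 * \<delta> * (p + q)"
          using mult_nonneg_nonneg[of \<delta> q] mult_nonneg_nonneg[of \<delta> p] \<delta> p0 q by (simp add: algebra_simps)
        finally show ?thesis by simp
      qed
      have "?ED (\<lambda>N. (Z N)\<^sup>2) \<le> ?ED (\<lambda>N. (h1 (N (i, 2)))\<^sup>2 + (h3 (N (i, 2)))\<^sup>2)"
        by (rule integral_mono[OF intZ2 isum Zle])
      also have "\<dots> = (p / n + (p - q)\<^sup>2) + ?E (\<lambda>k. (h3 k)\<^sup>2)"
        using marg2[OF c(3)] marg2[OF ih3sq] c(4) by simp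
      also have "?E (\<lambda>k. (h3 k)\<^sup>2) \<le> 2 * (p / n + (p - q)\<^sup>2) + 32 * B\<^sup>2 * (\<delta> * q)"
        unfolding h3_def B_def \<delta>_def
        by (rule second_moment_unbiased_best_poly[OF n c1 c2(1) _ K q p0 inside(1)]) (use c2 in simp)
      also have "p / n + (p - q)\<^sup>2 + (2 * (p / n + (p - q)\<^sup>2) + 32 * B\<^sup>2 * (\<delta> * q))
          \<le> 3 * (p / n + 2 * \<delta> * (p + q)) + 32 * B\<^sup>2 * (\<delta> * q)"
        using pq2 by simp
      finally have "\<exists>m. ?ED (\<lambda>N. (Z N - m)\<^sup>2) \<le> 3 * (p / n + 2 * \<delta> * (p + q)) + 32 * B\<^sup>2 * (\<delta> * q)"
        by (intro exI[of _ 0]) simp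
      then show ?thesis using intZ intZ2 bias by blast
    qed
    then show "integrable (measure_pmf D) Z" "integrable (measure_pmf D) (\<lambda>N. (Z N)\<^sup>2)"
      "\<bar>?ED Z - \<bar>p - q\<bar>\<bar> \<le> 2 * \<bar>p - q\<bar> * \<kappa> + min (2 * q) (48 * sqrt (\<delta> * q) / (c2 * ln n))"
      "\<exists>m. ?ED (\<lambda>N. (Z N - m)\<^sup>2) \<le> 3 * (p / n + 2 * \<delta> * (p + q)) + 32 * B\<^sup>2 * (\<delta> * q)" by auto
  qed
qed

section \<open>Risk of the estimator\<close>

lemma L1_tilde_eq_sum_cell_stat:
  "L1_tilde c1 c2 c3 n S q N = (\<Sum>i=1..S. cell_stat n c1 (c2 * ln n) c3 (q i) (N (i, 1)) (N (i, 2)))"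
  by (simp add: L1_tilde_def cell_stat_def phat_def)

lemma L1_dist_bounds:
  assumes "P \<in> prob_vectors S" "Q \<in> prob_vectors S"
  shows "0 \<le> L1_dist S P Q" "L1_dist S P Q \<le> 2"
proof -
  have "L1_dist S P Q \<le> (\<Sum>i=1..S. P i + Q i)"
    unfolding L1_dist_def using assms by (intro sum_mono) (force simp: prob_vectors_def abs_le_iff)
  then show "L1_dist S P Q \<le> 2" using assms by (simp add: prob_vectors_def sum.distrib)
qed (simp add: L1_dist_def sum_nonneg)

lemma L1_risk_le_4:
  assumes "P \<in> prob_vectors S" "Q \<in> prob_vectors S"
  shows "L1_risk c1 c2 c3 n S Q P \<le> 4"
proof -
  have "L1_risk c1 c2 c3 n S Q P \<le> (\<integral>\<^sup>+ N. 4 \<partial>measure_pmf (counts_pmf n S P))"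
    unfolding L1_risk_def
  proof (rule nn_integral_mono)
    fix N
    have "\<bar>L1_hat c1 c2 c3 n S Q N - L1_dist S P Q\<bar> \<le> 2"
      using L1_dist_bounds[OF assms] by (auto simp: L1_hat_def abs_le_iff)
    then have "\<bar>L1_hat c1 c2 c3 n S Q N - L1_dist S P Q\<bar>\<^sup>2 \<le> 2\<^sup>2" by (intro power_mono) auto
    then show "ennreal (\<bar>L1_hat c1 c2 c3 n S Q N - L1_dist S P Q\<bar>\<^sup>2) \<le> 4"
      using ennreal_leI by fastforce
  qed
  also have "\<dots> = 4" by simp
  finally show ?thesis .
qed

text \<open>
  Clipping to \<open>{0..2}\<close> is a contraction towards the true distance, which lies there. On the event that all cells
  agree with their idealized versions the squared loss is at most that of the idealized sum; on its complement, whose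
  probability is bounded by a union bound, the loss is at most \<open>4\<close>.
\<close>

lemma L1_risk_bound:
  assumes n: "n > 1" and b: "b > 0" and c2: "c2 > 0" "c2 \<le> 8 * b" and K: "c2 * ln n \<ge> 1"
    and P: "P \<in> prob_vectors S" and Q: "Q \<in> prob_vectors S"
  defines "\<delta> \<equiv> 16 * b * ln n / n" and "\<kappa> \<equiv> exp (- (b * ln n / 64))"
    and "B \<equiv> real (nat \<lfloor>c2 * ln n\<rfloor> + 1) * 24 ^ nat \<lfloor>c2 * ln n\<rfloor>"
  shows "L1_risk (16 * b) c2 b n S Q P \<le> ennreal (4 * (real S * \<kappa>) + (3 / n + 12 * \<delta> + 32 * B\<^sup>2 * \<delta>)
    + (4 * \<kappa> + (\<Sum>i=1..S. min (2 * Q i) (48 * sqrt (\<delta> * Q i) / (c2 * ln n))))\<^sup>2)"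
proof -
  let ?D = "counts_pmf n S P" and ?I = "{1..S}"
  define Z where "Z i N = idealized_cell_stat n (16 * b) (c2 * ln n) b (P i) (Q i) (N (i, 1)) (N (i, 2))"
    for i :: nat and N :: "nat \<times> nat \<Rightarrow> nat"
  define Z0 where "Z0 i N = cell_stat n (16 * b) (c2 * ln n) b (Q i) (N (i, 1)) (N (i, 2))"
    for i :: nat and N :: "nat \<times> nat \<Rightarrow> nat"
  define v where "v i = 3 * (P i / n + 2 * \<delta> * (P i + Q i)) + 32 * B\<^sup>2 * (\<delta> * Q i)" for i
  define e where "e i = min (2 * Q i) (48 * sqrt (\<delta> * Q i) / (c2 * ln n))" for i
  define \<beta> where "\<beta> i = 2 * \<bar>P i - Q i\<bar> * \<kappa> + e i" for i
  let ?L = "L1_dist S P Q"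
  have P0: "P i \<ge> 0" "Q i \<ge> 0" if "i \<in> ?I" for i using P Q that by (auto simp: prob_vectors_def)
  have P1: "(\<Sum>i\<in>?I. P i) = 1" "(\<Sum>i\<in>?I. Q i) = 1" using P Q by (auto simp: prob_vectors_def)
  have n0: "n > 0" and \<delta>: "\<delta> > 0" and \<kappa>: "\<kappa> > 0" using n b by (auto simp: \<delta>_def \<kappa>_def)
  have cell: "integrable ?D (Z i)" "integrable ?D (\<lambda>N. (Z i N)\<^sup>2)"
      "\<bar>measure_pmf.expectation ?D (Z i) - \<bar>P i - Q i\<bar>\<bar> \<le> \<beta> i"
      "\<exists>m. measure_pmf.expectation ?D (\<lambda>N. (Z i N - m)\<^sup>2) \<le> v i"
      "measure_pmf.prob ?D {N. Z i N \<noteq> Z0 i N} \<le> \<kappa>" if i: "i \<in> ?I" for i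
    using idealized_cell_moments[where q = "Q i" and i = i and P = P and S = S, OF n b c2 K P0(2)[OF i] i P0(1)[OF i]]
    unfolding Z_def[abs_def] Z0_def[abs_def] v_def \<beta>_def e_def \<delta>_def \<kappa>_def B_def by simp_all
  obtain m where m: "\<And>i. i \<in> ?I \<Longrightarrow> measure_pmf.expectation ?D (\<lambda>N. (Z i N - m i)\<^sup>2) \<le> v i"
    using cell(4) by metis
  have ind: "prob_space.indep_vars (measure_pmf ?D) (\<lambda>_. borel) Z ?I"
    unfolding Z_def[abs_def] by (rule indep_vars_counts_pairs)
  note sm = prob_space.second_moment_indep_sum[OF measure_pmf.prob_space_axioms finite_atLeastAtMost ind
      cell(1,2,3) m, folded L1_dist_def]
  \<comment> \<open>The number of cells in which the two statistics differ; it dominates the indicator of the bad event.\<close>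
  define bad :: "(nat \<times> nat \<Rightarrow> nat) \<Rightarrow> real" where "bad N = (\<Sum>i\<in>?I. indicator {N. Z i N \<noteq> Z0 i N} N)" for N
  define f :: "(nat \<times> nat \<Rightarrow> nat) \<Rightarrow> real" where "f N = 4 * bad N + ((\<Sum>i\<in>?I. Z i N) - ?L)\<^sup>2" for N
  have intbad: "integrable ?D (\<lambda>N. indicator {N. Z i N \<noteq> Z0 i N} N :: real)" for i
    by (simp add: integrable_indicator_iff less_top[symmetric])
  have intbad': "integrable ?D (\<lambda>N. 4 * bad N)"
    unfolding bad_def by (intro integrable_mult_right Bochner_Integration.integrable_sum intbad)
  have intf: "integrable ?D f" unfolding f_def[abs_def]
    by (intro Bochner_Integration.integrable_add intbad' sm(1))
  have fpos: "0 \<le> f N" for N by (simp add: f_def bad_def sum_nonneg)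
  have pointwise: "\<bar>L1_hat (16 * b) c2 b n S Q N - ?L\<bar>\<^sup>2 \<le> f N" for N
  proof -
    note L = L1_dist_bounds[OF P Q]
    show ?thesis
    proof (cases "\<forall>i\<in>?I. Z i N = Z0 i N")
      case True
      then have "L1_tilde (16 * b) c2 b n S Q N = (\<Sum>i\<in>?I. Z i N)"
        by (simp add: L1_tilde_eq_sum_cell_stat Z0_def)
      then have "\<bar>L1_hat (16 * b) c2 b n S Q N - ?L\<bar> \<le> \<bar>(\<Sum>i\<in>?I. Z i N) - ?L\<bar>"
        using L by (auto simp: L1_hat_def max_def min_def)
      then have "\<bar>L1_hat (16 * b) c2 b n S Q N - ?L\<bar>\<^sup>2 \<le> \<bar>(\<Sum>i\<in>?I. Z i N) - ?L\<bar>\<^sup>2"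
        by (intro power_mono) auto
      moreover have "0 \<le> bad N" by (simp add: bad_def sum_nonneg)
      ultimately show ?thesis by (simp add: f_def)
    next
      case False
      then obtain i where i: "i \<in> ?I" "Z i N \<noteq> Z0 i N" by blast
      have "(indicator {N. Z i N \<noteq> Z0 i N} N :: real) \<le> bad N"
        unfolding bad_def by (rule member_le_sum[OF i(1)]) auto
      then have "1 \<le> bad N" using i(2) by simp
      moreover have "\<bar>L1_hat (16 * b) c2 b n S Q N - ?L\<bar>\<^sup>2 \<le> 2\<^sup>2"
        using L by (intro power_mono) (auto simp: L1_hat_def abs_le_iff)
      moreover have "0 \<le> ((\<Sum>i\<in>?I. Z i N) - ?L)\<^sup>2" by simp
      moreover have "x \<le> 4 * y + z" if "1 \<le> y" "x \<le> 2\<^sup>2" "0 \<le> z" for x y z :: real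
        using that by simp
      ultimately show ?thesis unfolding f_def by blast
    qed
  qed
  have "L1_risk (16 * b) c2 b n S Q P \<le> (\<integral>\<^sup>+ N. ennreal (f N) \<partial>measure_pmf ?D)"
    unfolding L1_risk_def by (intro nn_integral_mono ennreal_leI pointwise)
  also have "\<dots> = ennreal (measure_pmf.expectation ?D f)"
    by (rule nn_integral_eq_integral[OF intf]) (simp add: fpos)
  also have "\<dots> \<le> ennreal (4 * (real S * \<kappa>) + (3 / n + 12 * \<delta> + 32 * B\<^sup>2 * \<delta>) + (4 * \<kappa> + (\<Sum>i\<in>?I. e i))\<^sup>2)"
  proof (rule ennreal_leI)
    have "measure_pmf.expectation ?D (\<lambda>N. 4 * bad N) = 4 * (\<Sum>i\<in>?I. measure_pmf.prob ?D {N. Z i N \<noteq> Z0 i N})"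
      unfolding bad_def integral_mult_right_zero using intbad
      by (subst Bochner_Integration.integral_sum) auto
    also have "\<dots> \<le> 4 * (\<Sum>i\<in>?I. \<kappa>)" by (intro mult_left_mono sum_mono cell(5)) auto
    finally have 1: "measure_pmf.expectation ?D (\<lambda>N. 4 * bad N) \<le> 4 * (real S * \<kappa>)" by simp
    have 2: "(\<Sum>i\<in>?I. v i) = 3 / n + 12 * \<delta> + 32 * B\<^sup>2 * \<delta>"
    proof -
      have "(\<Sum>i\<in>?I. v i) = (3 / n + 6 * \<delta>) * (\<Sum>i\<in>?I. P i) + (6 * \<delta> + 32 * B\<^sup>2 * \<delta>) * (\<Sum>i\<in>?I. Q i)"
        unfolding sum_distrib_left sum.distrib[symmetric] v_def
        by (intro sum.cong) (simp_all add: algebra_simps)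
      then show ?thesis unfolding P1 by simp
    qed
    have 3: "(\<Sum>i\<in>?I. \<beta> i)\<^sup>2 \<le> (4 * \<kappa> + (\<Sum>i\<in>?I. e i))\<^sup>2"
    proof (rule power_mono)
      have e0: "0 \<le> e i" if "i \<in> ?I" for i
        using P0[OF that] \<delta> K by (simp add: e_def)
      have "(\<Sum>i\<in>?I. \<beta> i) = 2 * \<kappa> * ?L + (\<Sum>i\<in>?I. e i)"
        by (simp add: \<beta>_def L1_dist_def sum.distrib sum_distrib_left mult_ac)
      moreover have "2 * \<kappa> * ?L \<le> 2 * \<kappa> * 2"
        using L1_dist_bounds[OF P Q] \<kappa> by (intro mult_left_mono) auto
      ultimately show "(\<Sum>i\<in>?I. \<beta> i) \<le> 4 * \<kappa> + (\<Sum>i\<in>?I. e i)" by linarith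
      show "0 \<le> (\<Sum>i\<in>?I. \<beta> i)" using e0 \<kappa> by (intro sum_nonneg) (simp add: \<beta>_def)
    qed
    have "measure_pmf.expectation ?D f = measure_pmf.expectation ?D (\<lambda>N. 4 * bad N)
        + measure_pmf.expectation ?D (\<lambda>N. ((\<Sum>i\<in>?I. Z i N) - ?L)\<^sup>2)"
      unfolding f_def[abs_def] by (rule Bochner_Integration.integral_add[OF intbad' sm(1)])
    then show "measure_pmf.expectation ?D f
        \<le> 4 * (real S * \<kappa>) + (3 / n + 12 * \<delta> + 32 * B\<^sup>2 * \<delta>) + (4 * \<kappa> + (\<Sum>i\<in>?I. e i))\<^sup>2"
      using 1 sm(2) 3 unfolding 2 by linarith
  qed
  finally show ?thesis unfolding e_def .
qed

text \<open>
  The constant \<open>b = 64 * \<beta>\<close> makes the tail probability \<open>n powr (- \<beta>)\<close>; then \<open>c2\<close> is chosen so small that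
  the exponential growth \<open>48 ^ (c2 * ln n)\<close> of the polynomial estimators stays below \<open>n powr (\<epsilon> / 2)\<close>.
\<close>

lemma L1_risk_rate:
  fixes \<beta> \<epsilon> :: real
  assumes \<beta>: "\<beta> > 0" and \<epsilon>: "\<epsilon> > 0"
  shows "\<exists>c1 c2 c3 M :: real. c1 > c3 \<and> c3 > 0 \<and> c2 > 0 \<and> M > 0 \<and>
    (\<forall>(S :: nat) (n :: real) (P :: nat \<Rightarrow> real) (Q :: nat \<Rightarrow> real). n \<ge> 2 \<longrightarrow> c2 * ln n \<ge> 1 \<longrightarrow>
      P \<in> prob_vectors S \<longrightarrow> Q \<in> prob_vectors S \<longrightarrow>
      L1_risk c1 c2 c3 n S Q P \<le> ennreal (M * (real S * n powr (- \<beta>) + n powr \<epsilon> * ln n / n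
        + n powr (- 2 * \<beta>) + (\<Sum>i=1..S. min (Q i) (sqrt (Q i / (n * ln n))))\<^sup>2)))"
proof -
  define b where "b = 64 * \<beta>"
  define c2 where "c2 = min (8 * b) (\<epsilon> / (2 * ln 48))"
  define C1 where "C1 = max 2 (192 * sqrt b / c2)"
  define M where "M = 41 + 704 * b + 2 * C1\<^sup>2"
  have b: "b > 0" using \<beta> by (simp add: b_def)
  have c2: "c2 > 0" "c2 \<le> 8 * b" "c2 * (2 * ln 48) \<le> \<epsilon>"
  proof -
    have "ln 48 > (0 :: real)" by simp
    then show "c2 > 0" "c2 \<le> 8 * b" using b \<epsilon> by (simp_all add: c2_def)
    have "c2 \<le> \<epsilon> / (2 * ln 48)" by (simp add: c2_def)
    then show "c2 * (2 * ln 48) \<le> \<epsilon>" using \<open>ln 48 > 0\<close> by (simp add: field_simps)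
  qed
  have M: "M > 0" using b by (simp add: M_def add_pos_nonneg)
  have "L1_risk (16 * b) c2 b n S Q P \<le> ennreal (M * (real S * n powr (- \<beta>) + n powr \<epsilon> * ln n / n
        + n powr (- 2 * \<beta>) + (\<Sum>i=1..S. min (Q i) (sqrt (Q i / (n * ln n))))\<^sup>2))"
    if n: "n \<ge> 2" and K: "c2 * ln n \<ge> 1" and P: "P \<in> prob_vectors S" and Q: "Q \<in> prob_vectors S" for S n P Q
  proof (rule order_trans[OF L1_risk_bound[OF _ b c2(1,2) K P Q] ennreal_leI])
    show "n > 1" using n by simp
    define \<delta> where "\<delta> = 16 * b * ln n / n"
    define \<kappa> where "\<kappa> = exp (- (b * ln n / 64))"
    define d where "d = nat \<lfloor>c2 * ln n\<rfloor>"
    define B where "B = real (d + 1) * 24 ^ d"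
    define D where "D = (\<Sum>i=1..S. min (Q i) (sqrt (Q i / (n * ln n))))"
    define X where "X = n powr \<epsilon> * ln n / n"
    have ln: "ln n > 0" and n0: "n > 0" using n by auto
    have ln2: "ln n \<ge> 1 / 2"
    proof -
      have "ln 2 \<le> ln n" using n by simp
      then show ?thesis using ln2_ge_two_thirds by simp
    qed
    have ne: "n powr \<epsilon> \<ge> 1" using n \<epsilon> by (intro ge_one_powr_ge_zero) auto
    have Q0: "Q i \<ge> 0" if "i \<in> {1..S}" for i using Q that by (auto simp: prob_vectors_def)
    have D0: "0 \<le> D" unfolding D_def using Q0 ln n0 by (intro sum_nonneg) simp
    have \<kappa>: "\<kappa> = n powr (- \<beta>)" using n0 by (simp add: \<kappa>_def powr_def b_def)
    have \<kappa>2: "\<kappa>\<^sup>2 = n powr (- 2 * \<beta>)"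
      by (simp add: \<kappa> power2_eq_square powr_add[symmetric])
    have B: "B\<^sup>2 \<le> n powr \<epsilon>"
    proof -
      have "real (d + 1) \<le> 2 ^ d"
      proof -
        have "d + 1 \<le> 2 ^ d" by (induction d) auto
        then show ?thesis by (metis of_nat_le_iff of_nat_numeral of_nat_power)
      qed
      then have "B \<le> 2 ^ d * 24 ^ d" unfolding B_def by (intro mult_right_mono) auto
      also have "\<dots> = 48 ^ d" by (simp add: power_mult_distrib[symmetric])
      also have "\<dots> = exp (real d * ln 48)" by (simp add: exp_of_nat_mult)
      also have "\<dots> \<le> exp (c2 * ln n * ln 48)"
        using K by (simp add: d_def mult_right_mono)
      finally have "B\<^sup>2 \<le> (exp (c2 * ln n * ln 48))\<^sup>2"
        by (intro power_mono) (auto simp: B_def)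
      also have "\<dots> = exp (c2 * (2 * ln 48) * ln n)"
        by (simp add: power2_eq_square exp_add[symmetric])
      also have "\<dots> \<le> exp (\<epsilon> * ln n)"
        using c2(3) ln by (simp add: mult_right_mono)
      finally show ?thesis using n0 by (simp add: powr_def)
    qed
    have t1: "3 / n \<le> 6 * X"
    proof -
      have "1 / 2 \<le> n powr \<epsilon> * ln n" using mult_mono[OF ne ln2] by simp
      then have "(6 * (1 / 2)) / n \<le> (6 * (n powr \<epsilon> * ln n)) / n" using n0 by (intro divide_right_mono mult_left_mono) auto
      then show ?thesis by (simp add: X_def)
    qed
    have t2: "12 * \<delta> + 32 * B\<^sup>2 * \<delta> \<le> 704 * b * X"
    proof -
      have "12 * \<delta> + 32 * B\<^sup>2 * \<delta> = (12 + 32 * B\<^sup>2) * \<delta>" by (simp add: algebra_simps)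
      also have "\<dots> \<le> (44 * n powr \<epsilon>) * \<delta>"
        using B ne b ln n0 by (intro mult_right_mono) (auto simp: \<delta>_def)
      also have "\<dots> = 704 * b * X" by (simp add: \<delta>_def X_def)
      finally show ?thesis .
    qed
    have E: "(\<Sum>i=1..S. min (2 * Q i) (48 * sqrt (\<delta> * Q i) / (c2 * ln n))) \<le> C1 * D"
      unfolding D_def sum_distrib_left
    proof (rule sum_mono)
      fix i assume i: "i \<in> {1..S}"
      have "sqrt (\<delta> * Q i) = 4 * sqrt b * ln n * sqrt (Q i / (n * ln n))"
      proof -
        have "\<delta> * Q i = (4 * ln n)\<^sup>2 * (b * (Q i / (n * ln n)))"
          using n0 ln by (simp add: \<delta>_def power2_eq_square)
        then have "sqrt (\<delta> * Q i) = sqrt ((4 * ln n)\<^sup>2) * (sqrt b * sqrt (Q i / (n * ln n)))"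
          by (simp only: real_sqrt_mult)
        moreover have "sqrt ((4 * ln n)\<^sup>2) = 4 * ln n" by (subst real_sqrt_abs) (use ln in simp)
        ultimately show ?thesis by (simp only: mult_ac)
      qed
      then have eq: "48 * sqrt (\<delta> * Q i) / (c2 * ln n) = (192 * sqrt b / c2) * sqrt (Q i / (n * ln n))"
        using ln by simp
      have "2 * Q i \<le> C1 * Q i" using Q0[OF i] by (intro mult_right_mono) (auto simp: C1_def)
      moreover have "(192 * sqrt b / c2) * sqrt (Q i / (n * ln n)) \<le> C1 * sqrt (Q i / (n * ln n))"
        using Q0[OF i] ln n0 by (intro mult_right_mono) (auto simp: C1_def)
      ultimately show "min (2 * Q i) (48 * sqrt (\<delta> * Q i) / (c2 * ln n)) \<le> C1 * min (Q i) (sqrt (Q i / (n * ln n)))"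
        unfolding eq by (auto simp: min_def)
    qed
    have e0: "0 \<le> (\<Sum>i=1..S. min (2 * Q i) (48 * sqrt (\<delta> * Q i) / (c2 * ln n)))"
      using Q0 b ln n0 c2 by (intro sum_nonneg) (simp add: \<delta>_def)
    have t3: "(4 * \<kappa> + (\<Sum>i=1..S. min (2 * Q i) (48 * sqrt (\<delta> * Q i) / (c2 * ln n))))\<^sup>2
        \<le> 32 * \<kappa>\<^sup>2 + 2 * C1\<^sup>2 * D\<^sup>2"
    proof -
      have "(4 * \<kappa> + (\<Sum>i=1..S. min (2 * Q i) (48 * sqrt (\<delta> * Q i) / (c2 * ln n))))\<^sup>2 \<le> (4 * \<kappa> + C1 * D)\<^sup>2"
        using E e0 by (intro power_mono) (auto simp: \<kappa>_def)
      also have "\<dots> \<le> 2 * (4 * \<kappa>)\<^sup>2 + 2 * (C1 * D)\<^sup>2"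
        using sum_squares_bound[of "4 * \<kappa>" "C1 * D"] by (simp add: power2_sum)
      finally show ?thesis by (simp add: power_mult_distrib)
    qed
    have coeffs: "4 * x + (6 * y + 704 * b * y) + (32 * z + 2 * C1\<^sup>2 * w) \<le> M * (x + y + z + w)"
      if "0 \<le> x" "0 \<le> y" "0 \<le> z" "0 \<le> w" for x y z w :: real
    proof -
      have C0: "0 \<le> C1\<^sup>2" by simp
      have "4 * x \<le> M * x" using that b C0 by (intro mult_right_mono) (auto simp: M_def)
      moreover have "(6 + 704 * b) * y \<le> M * y" using that b C0 by (intro mult_right_mono) (auto simp: M_def)
      moreover have "32 * z \<le> M * z" using that b C0 by (intro mult_right_mono) (auto simp: M_def)
      moreover have "2 * C1\<^sup>2 * w \<le> M * w" using that b C0 by (intro mult_right_mono) (auto simp: M_def)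
      ultimately show ?thesis by (simp add: distrib_left distrib_right)
    qed
    have "4 * (real S * \<kappa>) + (3 / n + 12 * \<delta> + 32 * B\<^sup>2 * \<delta>)
        + (4 * \<kappa> + (\<Sum>i=1..S. min (2 * Q i) (48 * sqrt (\<delta> * Q i) / (c2 * ln n))))\<^sup>2
        \<le> 4 * (real S * \<kappa>) + (6 * X + 704 * b * X) + (32 * \<kappa>\<^sup>2 + 2 * C1\<^sup>2 * D\<^sup>2)"
      using t1 t2 t3 by linarith
    also have "\<dots> \<le> M * (real S * \<kappa> + X + \<kappa>\<^sup>2 + D\<^sup>2)"
      by (rule coeffs) (use ln n0 in \<open>auto simp: \<kappa>_def X_def\<close>)
    finally show "4 * (real S * exp (- (b * ln n / 64)))
        + (3 / n + 12 * (16 * b * ln n / n)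
          + 32 * (real (nat \<lfloor>c2 * ln n\<rfloor> + 1) * 24 ^ nat \<lfloor>c2 * ln n\<rfloor>)\<^sup>2 * (16 * b * ln n / n))
        + (4 * exp (- (b * ln n / 64))
          + (\<Sum>i=1..S. min (2 * Q i) (48 * sqrt (16 * b * ln n / n * Q i) / (c2 * ln n))))\<^sup>2
        \<le> M * (real S * n powr (- \<beta>) + n powr \<epsilon> * ln n / n
        + n powr (- 2 * \<beta>) + (\<Sum>i=1..S. min (Q i) (sqrt (Q i / (n * ln n))))\<^sup>2)"
      unfolding \<kappa>_def[symmetric] \<delta>_def[symmetric] d_def[symmetric] B_def[symmetric] D_def[symmetric]
        X_def[symmetric] \<kappa>2[symmetric] \<kappa>[symmetric] .
  qed
  then show ?thesis using b c2(1) M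
    by (intro exI[of _ "16 * b"] exI[of _ c2] exI[of _ b] exI[of _ M]) auto
qed

section \<open>The two rates\<close>

lemma ln_square_le_powr:
  fixes n a :: real
  assumes "n \<ge> 1" "a > 0"
  shows "(ln n)\<^sup>2 \<le> (2 / a)\<^sup>2 * n powr a"
proof -
  have "(ln n)\<^sup>2 \<le> (n powr (a / 2) / (a / 2))\<^sup>2"
    using assms by (intro power_mono ln_powr_bound) auto
  also have "\<dots> = (2 / a)\<^sup>2 * (n powr (a / 2))\<^sup>2" by (simp add: power_divide power_mult_distrib)
  also have "(n powr (a / 2))\<^sup>2 = n powr a" by (simp add: power2_eq_square powr_add[symmetric])
  finally show ?thesis .
qed

theorem theorem2:
  shows "(\<forall>c C :: real. c > 0 \<longrightarrow> C > 0 \<longrightarrow>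
      (\<exists>c1 c2 c3 A :: real. c1 > c3 \<and> c3 > 0 \<and> c2 > 0 \<and> A > 0 \<and>
        (\<forall>(S :: nat) (n :: real) (Q :: nat \<Rightarrow> real).
          S \<ge> 1 \<longrightarrow> n \<ge> 2 \<longrightarrow> Q \<in> prob_vectors S \<longrightarrow>
          c * ln (real S) \<le> ln n \<longrightarrow>
          ln n \<le> C * ln (\<Sum>i=1..S. min (sqrt (Q i)) (Q i * sqrt (n * ln n))) \<longrightarrow>
          (SUP P\<in>prob_vectors S. L1_risk c1 c2 c3 n S Q P)
            \<le> ennreal (A * (\<Sum>i=1..S. min (Q i) (sqrt (Q i / (n * ln n))))\<^sup>2))))
    \<and> (\<forall>C :: real. C > 0 \<longrightarrow>
      (\<exists>c1 c2 c3 A :: real. c1 > c3 \<and> c3 > 0 \<and> c2 > 0 \<and> A > 0 \<and>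
        (\<forall>(S :: nat) (n :: real).
          S \<ge> 1 \<longrightarrow> n \<ge> 2 \<longrightarrow> ln n \<le> C * ln (real S) \<longrightarrow>
          (SUP (P, Q)\<in>prob_vectors S \<times> prob_vectors S. L1_risk c1 c2 c3 n S Q P)
            \<le> ennreal (A * (real S / (n * ln n))))))"
proof (intro conjI allI impI)
  fix c C :: real
  assume c: "c > 0" and C: "C > 0"
  \<comment> \<open>As \<open>S \<le> n powr (1 / c)\<close>, this exponent makes the bad event cost a multiple of \<open>1 / n\<close>.\<close>
  define \<beta> where "\<beta> = 1 / c + 1"
  have \<beta>: "\<beta> > 0" "\<beta> \<ge> 1" using c by (auto simp: \<beta>_def add_pos_pos)
  obtain c1 c2 c3 M :: real where cs: "c1 > c3" "c3 > 0" "c2 > 0" "M > 0"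
    and rate: "\<And>S n P Q. \<lbrakk>n \<ge> 2; c2 * ln n \<ge> 1; P \<in> prob_vectors S; Q \<in> prob_vectors S\<rbrakk> \<Longrightarrow>
      L1_risk c1 c2 c3 n S Q P \<le> ennreal (M * (real S * n powr (- \<beta>) + n powr (1 / C) * ln n / n
        + n powr (- 2 * \<beta>) + (\<Sum>i=1..S. min (Q i) (sqrt (Q i / (n * ln n))))\<^sup>2))"
    using L1_risk_rate[OF \<beta>(1), of "1 / C"] C by auto
  define G where "G = (2 / (1 / C))\<^sup>2"
  define A where "A = M * (5 * G + 1) + 4 * (exp (1 / c2) / c2)"
  have G: "G \<ge> 0" by (simp add: G_def)
  have A: "A > 0" using cs G by (simp add: A_def add_pos_pos)
  have "L1_risk c1 c2 c3 n S Q P \<le> ennreal (A * (\<Sum>i=1..S. min (Q i) (sqrt (Q i / (n * ln n))))\<^sup>2)"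
    if S: "S \<ge> 1" and n: "n \<ge> 2" and Q: "Q \<in> prob_vectors S" and P: "P \<in> prob_vectors S"
      and Sn: "c * ln (real S) \<le> ln n"
      and nQ: "ln n \<le> C * ln (\<Sum>i=1..S. min (sqrt (Q i)) (Q i * sqrt (n * ln n)))" for S n P Q
  proof -
    define D where "D = (\<Sum>i=1..S. min (Q i) (sqrt (Q i / (n * ln n))))"
    define s where "s = (\<Sum>i=1..S. min (sqrt (Q i)) (Q i * sqrt (n * ln n)))"
    define T where "T = n * ln n"
    have ln: "ln n > 0" and n0: "n > 0" using n by auto
    have T: "T > 0" using ln n0 by (simp add: T_def)
    have ln2: "ln n \<ge> 1 / 2"
    proof -
      have "ln 2 \<le> ln n" using n by simp
      then show ?thesis using ln2_ge_two_thirds by simp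
    qed
    have Q0: "Q i \<ge> 0" if "i \<in> {1..S}" for i using Q that by (auto simp: prob_vectors_def)
    \<comment> \<open>The quantity in the hypothesis is the claimed rate up to normalization, so the hypothesis forces
      \<open>D\<^sup>2\<close> to exceed \<open>1 / T\<close> by the polynomial factor \<open>n powr (2 / C)\<close>.\<close>
    have sD: "s = sqrt T * D"
      unfolding s_def D_def sum_distrib_left
    proof (rule sum.cong[OF refl])
      fix i assume "i \<in> {1..S}"
      have "sqrt T * sqrt (Q i / T) = sqrt (Q i)" using T by (simp add: real_sqrt_mult[symmetric])
      moreover have "sqrt T * min x y = min (sqrt T * x) (sqrt T * y)" for x y
        using T by (simp add: min_mult_distrib_left)
      ultimately show "min (sqrt (Q i)) (Q i * sqrt (n * ln n)) = sqrt T * min (Q i) (sqrt (Q i / (n * ln n)))"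
        by (simp add: T_def[symmetric] min.commute mult.commute)
    qed
    have s0: "s \<ge> 0" unfolding s_def using Q0 ln n0 by (intro sum_nonneg) simp
    have "s \<noteq> 0" using nQ ln unfolding s_def[symmetric] by auto
    then have s: "s > 0" using s0 by simp
    have "n powr (1 / C) \<le> s"
    proof -
      have "ln n / C \<le> ln s" using nQ C unfolding s_def[symmetric] by (simp add: field_simps)
      then have "exp (ln n / C) \<le> exp (ln s)" by simp
      then show ?thesis using s n0 by (simp add: powr_def)
    qed
    then have "(n powr (1 / C))\<^sup>2 \<le> s\<^sup>2" by (intro power_mono) auto
    also have "s\<^sup>2 = T * D\<^sup>2" using T by (simp add: sD power_mult_distrib)
    finally have big: "(n powr (1 / C))\<^sup>2 \<le> T * D\<^sup>2" .
    have ne: "n powr (1 / C) \<ge> 1" using n C by (intro ge_one_powr_ge_zero) auto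
    show ?thesis
    proof (cases "c2 * ln n \<ge> 1")
      case True
      \<comment> \<open>The variance; one factor \<open>n powr (1 / C)\<close> of the two available absorbs \<open>(ln n)\<^sup>2\<close>.\<close>
      define X where "X = n powr (1 / C) * ln n / n"
      have X: "X \<le> G * D\<^sup>2"
      proof -
        have "(ln n)\<^sup>2 \<le> G * n powr (1 / C)"
          unfolding G_def using n C by (intro ln_square_le_powr) auto
        then have "n powr (1 / C) * (ln n)\<^sup>2 \<le> n powr (1 / C) * (G * n powr (1 / C))"
          by (rule mult_left_mono) simp
        also have "\<dots> = G * (n powr (1 / C))\<^sup>2" by (simp add: power2_eq_square)
        also have "\<dots> \<le> G * (T * D\<^sup>2)" using big G by (rule mult_left_mono)
        finally have "n powr (1 / C) * (ln n)\<^sup>2 / T \<le> G * (T * D\<^sup>2) / T" using T by (intro divide_right_mono) auto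
        moreover have "n powr (1 / C) * (ln n)\<^sup>2 / T = X"
          using ln n0 by (simp add: X_def T_def power2_eq_square)
        ultimately show ?thesis using T by simp
      qed
      have inv: "n powr (- 1) \<le> 2 * X"
      proof -
        have "1 / 2 \<le> n powr (1 / C) * ln n" using mult_mono[OF ne ln2] by simp
        then have "1 / 2 / n \<le> n powr (1 / C) * ln n / n" using n0 by (intro divide_right_mono) auto
        then show ?thesis using n0 by (simp add: X_def powr_minus field_simps)
      qed
      have "real S \<le> n powr (1 / c)"
      proof -
        have "ln (real S) \<le> ln n / c" using Sn c by (simp add: field_simps)
        then have "exp (ln (real S)) \<le> exp (ln n / c)" by simp
        then show ?thesis using S n0 by (simp add: powr_def)
      qed
      then have "real S * n powr (- \<beta>) \<le> n powr (1 / c) * n powr (- \<beta>)" by (rule mult_right_mono) simp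
      also have "\<dots> = n powr (- 1)" by (simp add: powr_add[symmetric] \<beta>_def)
      finally have t1: "real S * n powr (- \<beta>) \<le> 2 * X" using inv by linarith
      have "n powr (- 2 * \<beta>) \<le> n powr (- 1)" using n \<beta> by (intro powr_mono) auto
      then have t3: "n powr (- 2 * \<beta>) \<le> 2 * X" using inv by linarith
      have "real S * n powr (- \<beta>) + X + n powr (- 2 * \<beta>) + D\<^sup>2 \<le> (5 * G + 1) * D\<^sup>2"
        using t1 t3 X by (simp add: distrib_right)
      then have "M * (real S * n powr (- \<beta>) + X + n powr (- 2 * \<beta>) + D\<^sup>2) \<le> M * ((5 * G + 1) * D\<^sup>2)"
        using cs by (intro mult_left_mono) auto
      also have "\<dots> \<le> A * D\<^sup>2"
        unfolding mult.assoc[symmetric] using cs by (intro mult_right_mono) (simp_all add: A_def)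
      finally show ?thesis
        using rate[OF n True P Q] unfolding X_def D_def by (meson ennreal_leI order_trans)
    next
      case False
      have "ln n \<le> 1 / c2" using False cs by (simp add: field_simps)
      moreover from this have "exp (ln n) \<le> exp (1 / c2)" by (rule exp_le_cancel_iff[THEN iffD2])
      then have "n \<le> exp (1 / c2)" using n0 by simp
      ultimately have "T \<le> exp (1 / c2) * (1 / c2)"
        unfolding T_def using ln by (intro mult_mono) auto
      moreover have "1 \<le> T * D\<^sup>2"
      proof -
        have "1 \<le> (n powr (1 / C))\<^sup>2" using ne by simp
        then show ?thesis using big by linarith
      qed
      ultimately have "1 \<le> exp (1 / c2) / c2 * D\<^sup>2"
        using mult_right_mono[of T "exp (1 / c2) * (1 / c2)" "D\<^sup>2"] by simp
      then have "4 \<le> 4 * (exp (1 / c2) / c2) * D\<^sup>2" by simp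
      also have "\<dots> \<le> A * D\<^sup>2" using cs G by (intro mult_right_mono) (auto simp: A_def)
      finally have "ennreal 4 \<le> ennreal (A * D\<^sup>2)" by (rule ennreal_leI)
      then show ?thesis
        using L1_risk_le_4[OF P Q, of c1 c2 c3 n] unfolding D_def by (simp add: order_trans)
    qed
  qed
  then show "\<exists>c1 c2 c3 A :: real. c1 > c3 \<and> c3 > 0 \<and> c2 > 0 \<and> A > 0 \<and>
        (\<forall>(S :: nat) (n :: real) (Q :: nat \<Rightarrow> real).
          S \<ge> 1 \<longrightarrow> n \<ge> 2 \<longrightarrow> Q \<in> prob_vectors S \<longrightarrow>
          c * ln (real S) \<le> ln n \<longrightarrow>
          ln n \<le> C * ln (\<Sum>i=1..S. min (sqrt (Q i)) (Q i * sqrt (n * ln n))) \<longrightarrow>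
          (SUP P\<in>prob_vectors S. L1_risk c1 c2 c3 n S Q P)
            \<le> ennreal (A * (\<Sum>i=1..S. min (Q i) (sqrt (Q i / (n * ln n))))\<^sup>2))"
    using cs A by (intro exI[of _ c1] exI[of _ c2] exI[of _ c3] exI[of _ A]) (auto intro!: SUP_least)
next
  fix C :: real
  assume C: "C > 0"
  obtain c1 c2 c3 M :: real where cs: "c1 > c3" "c3 > 0" "c2 > 0" "M > 0"
    and rate: "\<And>S n P Q. \<lbrakk>n \<ge> 2; c2 * ln n \<ge> 1; P \<in> prob_vectors S; Q \<in> prob_vectors S\<rbrakk> \<Longrightarrow>
      L1_risk c1 c2 c3 n S Q P \<le> ennreal (M * (real S * n powr (- 2) + n powr (1 / (2 * C)) * ln n / n
        + n powr (- 2 * 2) + (\<Sum>i=1..S. min (Q i) (sqrt (Q i / (n * ln n))))\<^sup>2))"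
    \<comment> \<open>Half of the polynomial factor \<open>n powr (1 / C) \<le> S\<close> pays for the variance, the other half for \<open>(ln n)\<^sup>2\<close>.\<close>
    using L1_risk_rate[of 2 "1 / (2 * C)"] C by auto
  define G where "G = (2 / (1 / (2 * C)))\<^sup>2"
  define A where "A = M * (G + 3) + 4 * (exp (1 / c2) / c2)"
  have G: "G \<ge> 0" by (simp add: G_def)
  have A: "A > 0" using cs G by (simp add: A_def add_pos_pos)
  have "L1_risk c1 c2 c3 n S Q P \<le> ennreal (A * (real S / (n * ln n)))"
    if S: "S \<ge> 1" and n: "n \<ge> 2" and Q: "Q \<in> prob_vectors S" and P: "P \<in> prob_vectors S"
      and nS: "ln n \<le> C * ln (real S)" for S n P Q
  proof -
    define D where "D = (\<Sum>i=1..S. min (Q i) (sqrt (Q i / (n * ln n))))"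
    define T where "T = n * ln n"
    define Y where "Y = real S / T"
    have ln: "ln n > 0" and n0: "n > 0" using n by auto
    have T: "T > 0" using ln n0 by (simp add: T_def)
    have Y: "Y > 0" using T S by (simp add: Y_def)
    have Q0: "Q i \<ge> 0" if "i \<in> {1..S}" for i using Q that by (auto simp: prob_vectors_def)
    have big: "n powr (1 / C) \<le> real S"
    proof -
      have "ln n / C \<le> ln (real S)" using nS C by (simp add: field_simps)
      then have "exp (ln n / C) \<le> exp (ln (real S))" by simp
      then show ?thesis using S n0 by (simp add: powr_def)
    qed
    show ?thesis
    proof (cases "c2 * ln n \<ge> 1")
      case True
      define X where "X = n powr (1 / (2 * C)) * ln n / n"
      have X: "X \<le> G * Y"
      proof -
        have "(ln n)\<^sup>2 \<le> G * n powr (1 / (2 * C))"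
          unfolding G_def using n C by (intro ln_square_le_powr) auto
        then have "n powr (1 / (2 * C)) * (ln n)\<^sup>2 \<le> n powr (1 / (2 * C)) * (G * n powr (1 / (2 * C)))"
          by (rule mult_left_mono) simp
        also have "\<dots> = G * n powr (1 / (2 * C) + 1 / (2 * C))" by (simp only: powr_add mult_ac)
        also have "1 / (2 * C) + 1 / (2 * C) = 1 / C" by simp
        also have "G * n powr (1 / C) \<le> G * real S" using big G by (rule mult_left_mono)
        finally have "n powr (1 / (2 * C)) * (ln n)\<^sup>2 / T \<le> G * real S / T" using T by (intro divide_right_mono) auto
        moreover have "n powr (1 / (2 * C)) * (ln n)\<^sup>2 / T = X"
          using ln n0 by (simp add: X_def T_def power2_eq_square)
        ultimately show ?thesis by (simp add: Y_def)
      qed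
      have t1: "real S * n powr (- 2) \<le> Y"
      proof -
        have "T \<le> n * n" unfolding T_def using n0 ln_le_minus_one[of n] by (intro mult_left_mono) auto
        then have "real S / (n * n) \<le> real S / T" using T n0 by (intro divide_left_mono) auto
        moreover have "n powr (- 2) = 1 / (n * n)"
          using n0 by (simp add: powr_minus powr_numeral power2_eq_square field_simps)
        ultimately show ?thesis by (simp add: Y_def)
      qed
      have t3: "n powr (- 2 * 2) \<le> Y"
      proof -
        have "n powr (- 2 * 2) \<le> 1 * n powr (- 2)" using n by (simp add: powr_mono)
        also have "\<dots> \<le> real S * n powr (- 2)" using S by (intro mult_right_mono) auto
        finally show ?thesis using t1 by linarith
      qed
      have t4: "D\<^sup>2 \<le> Y"
      proof -
        have "0 \<le> D" unfolding D_def using Q0 ln n0 by (intro sum_nonneg) simp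
        moreover have "D \<le> (\<Sum>i=1..S. 1 * sqrt (Q i / T))" unfolding D_def T_def by (intro sum_mono) simp
        ultimately have "D\<^sup>2 \<le> (\<Sum>i=1..S. 1 * sqrt (Q i / T))\<^sup>2" by (intro power_mono)
        also have "\<dots> \<le> (\<Sum>i=1..S. 1\<^sup>2) * (\<Sum>i=1..S. (sqrt (Q i / T))\<^sup>2)" by (rule Cauchy_Schwarz_ineq_sum)
        also have "(\<Sum>i=1..S. (sqrt (Q i / T))\<^sup>2) = (\<Sum>i=1..S. Q i / T)"
          using Q0 T by (intro sum.cong) auto
        also have "\<dots> = 1 / T" using Q by (simp add: prob_vectors_def sum_divide_distrib[symmetric])
        finally show ?thesis by (simp add: Y_def)
      qed
      have "real S * n powr (- 2) + X + n powr (- 2 * 2) + D\<^sup>2 \<le> (G + 3) * Y"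
        using t1 t3 t4 X by (simp add: distrib_right)
      then have "M * (real S * n powr (- 2) + X + n powr (- 2 * 2) + D\<^sup>2) \<le> M * ((G + 3) * Y)"
        using cs by (intro mult_left_mono) auto
      also have "\<dots> \<le> A * Y" 
        unfolding mult.assoc[symmetric] using cs Y by (intro mult_right_mono) (simp_all add: A_def)
      finally show ?thesis
        using rate[OF n True P Q] unfolding X_def D_def Y_def T_def by (meson ennreal_leI order_trans)
    next
      case False
      have "ln n \<le> 1 / c2" using False cs by (simp add: field_simps)
      moreover from this have "exp (ln n) \<le> exp (1 / c2)" by (rule exp_le_cancel_iff[THEN iffD2])
      then have "n \<le> exp (1 / c2)" using n0 by simp
      ultimately have "T \<le> exp (1 / c2) * (1 / c2)"
        unfolding T_def using ln by (intro mult_mono) auto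
      moreover have "1 \<le> T * Y" using T S by (simp add: Y_def)
      ultimately have "1 \<le> exp (1 / c2) / c2 * Y"
        using mult_right_mono[of T "exp (1 / c2) * (1 / c2)" Y] Y by simp
      then have "4 \<le> 4 * (exp (1 / c2) / c2) * Y" by simp
      also have "\<dots> \<le> A * Y" using cs G Y by (intro mult_right_mono) (auto simp: A_def)
      finally have "ennreal 4 \<le> ennreal (A * Y)" by (rule ennreal_leI)
      then show ?thesis
        using L1_risk_le_4[OF P Q, of c1 c2 c3 n] unfolding Y_def T_def by (simp add: order_trans)
    qed
  qed
  then show "\<exists>c1 c2 c3 A :: real. c1 > c3 \<and> c3 > 0 \<and> c2 > 0 \<and> A > 0 \<and>
        (\<forall>(S :: nat) (n :: real).
          S \<ge> 1 \<longrightarrow> n \<ge> 2 \<longrightarrow> ln n \<le> C * ln (real S) \<longrightarrow>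
          (SUP (P, Q)\<in>prob_vectors S \<times> prob_vectors S. L1_risk c1 c2 c3 n S Q P)
            \<le> ennreal (A * (real S / (n * ln n))))"
    using cs A by (intro exI[of _ c1] exI[of _ c2] exI[of _ c3] exI[of _ A]) (auto intro!: SUP_least)
qed

end
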